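(* (Beloshapka's maximum conjecture in CR dimension one.) Let $M_k\subset\mathbb C^{1+k}$ be a Beloshapka real analytic totally nondegenerate CR model of CR dimension $1$, codimension $k$ and length $\rho\ge3$ (equivalently, $k\ge2$). Then the graded Lie algebra $\mathfrak{aut}_{CR}(M_k)$ of infinitesimal CR automorphisms of $M_k$ contains no nonzero homogeneous component of strictly positive homogeneity (i.e. $\mathfrak g_j=0$ for all $j\ge1$; $M_k$ has rigidity). Moreover, $\dim\mathfrak{aut}_{CR}(M_k)$ is either $3+k$ or $4+k$.
   Context: Models. Use complex coordinates $z,w_1,w_2,\ldots$ with weight $[z]=1$; a variable, its conjugate and its real and imaginary parts have the same weight, and the weight of a monomial is the sum of weights of its factors. Inductively for $j=2,3,\ldots$, suppose $w_1,\ldots,w_r$ are the variables having received weights $\le j-1$, and for $2\le\ell\le j-1$ let ${\bf w}^\ell$ be the tuple of the $k_\ell$ variables of weight $\ell$ and $A_\ell$ an invertible real $k_\ell\times k_\ell$ matrix. Let $\mathcal N_j=\{{\sf t}^j_1,\ldots,{\sf t}^j_{k_j}\}$ be a basis of a complement, in the space of real-valued polynomials of weight $j$ in $z,\overline z,\mathrm{Re}\,w_1,\ldots,\mathrm{Re}\,w_r$, to the subspace of those which are pluriharmonic on (i.e. restrict to the real part of a holomorphic polynomial on) the submanifold $\{\mathrm{Im}\,{\bf w}^\ell=A_\ell({\sf t}^\ell_1,\ldots,{\sf t}^\ell_{k_\ell})^t,\ 2\le\ell\le j-1\}\subset\mathbb C^{1+r}$; the next $k_j$ variables get weight $j$. Given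 $k$, let $\rho$ (the length) be the smallest integer with $k\le k_2+\cdots+k_\rho$, and $m=k-\sum_{i<\rho}k_i$. A model $M_k\subset\mathbb C^{1+k}$ is the submanifold $\mathrm{Im}\,{\bf w}^\ell=A_\ell({\sf t}^\ell_1,\ldots,{\sf t}^\ell_{k_\ell})^t$, $2\le\ell\le\rho$, with $A_\ell$ real invertible for $\ell<\rho$ and $A_\rho$ a real $m\times k_\rho$ matrix of rank $m$ (${\bf w}^\rho$ being the remaining $m$ variables). It is a real analytic generic CR manifold of CR dimension one. Infinitesimal CR automorphisms. $\mathfrak{aut}_{CR}(M_k)$ is the real Lie algebra of (germs at $0$ of) holomorphic vector fields ${\sf X}=Z(z,w)\partial_z+\sum_l W^l(z,w)\partial_{w_l}$ whose real part is tangent to $M_k$; it is finite dimensional, consists of polynomial vector fields and is graded, $\mathfrak{aut}_{CR}(M_k)=\bigoplus_j\mathfrak g_j$, $[\mathfrak g_i,\mathfrak g_j]\subset\mathfrak g_{i+j}$, where $\mathfrak g_j$ is the subspace of weighted homogeneous elements of weight $j$, with $\partial_z$ of weight $-1$ and $\partial_{w_l}$ of weight $-[w_l]$. *)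

theory Defs
  imports
    Complex_Main
    "HOL-Library.Function_Algebras"
    "HOL-Library.Poly_Mapping"
    "HOL-Analysis.Infinite_Sum"
    "Jordan_Normal_Form.DL_Rank"
begin

text \<open>Functions with values in a real vector space, under the pointwise operations. This makes
  span, independence and dimension available for spaces of polynomial functions and of tuples of
  power series.\<close>

instantiation "fun" :: (type, real_vector) real_vector
begin

definition scaleR_fun :: "real \<Rightarrow> ('a \<Rightarrow> 'b) \<Rightarrow> 'a \<Rightarrow> 'b"
  where "scaleR_fun r f = (\<lambda>x. r *\<^sub>R f x)"

instance
  by standard
    (simp_all add: scaleR_fun_def plus_fun_def scaleR_add_right scaleR_add_left)

end


text \<open>A point of \<open>\<complex>\<^sup>n\<close> is a sequence vanishing from index \<open>n\<close> on. Coordinate \<open>0\<close> is \<open>z\<close>, coordinate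
  \<open>i \<ge> 1\<close> is \<open>w\<^sub>i\<close>.\<close>

definition cspace :: "nat \<Rightarrow> (nat \<Rightarrow> complex) set"
  where "cspace n = {p. \<forall>i\<ge>n. p i = 0}"

definition monomial_at :: "(nat \<Rightarrow>\<^sub>0 nat) \<Rightarrow> (nat \<Rightarrow> complex) \<Rightarrow> complex"
  where "monomial_at \<alpha> p = (\<Prod>i\<in>Poly_Mapping.keys \<alpha>. p i ^ Poly_Mapping.lookup \<alpha> i)"

definition hol_polys :: "nat \<Rightarrow> ((nat \<Rightarrow> complex) \<Rightarrow> complex) set"
  where "hol_polys n =
    {h. \<exists>S c. finite S \<and> (\<forall>\<alpha>\<in>S. Poly_Mapping.keys \<alpha> \<subseteq> {..<n}) \<and>
      h = (\<lambda>p. \<Sum>\<alpha>\<in>S. c \<alpha> * monomial_at \<alpha> p)}"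


section \<open>Models\<close>

text \<open>The list \<open>t \<l>\<close> contains \<open>t\<^sup>\<l>\<^sub>1, t\<^sup>\<l>\<^sub>2, \<dots>\<close>, so that \<open>k\<^sub>\<l>\<close> is its length; the polynomials in
  it are functions of \<open>(z, w\<^sub>1, w\<^sub>2, \<dots>)\<close>.\<close>

type_synonym basis_family = "nat \<Rightarrow> ((nat \<Rightarrow> complex) \<Rightarrow> real) list"

definition num_w :: "basis_family \<Rightarrow> nat \<Rightarrow> nat"
  where "num_w t j = (\<Sum>l\<in>{2..j}. length (t l))"

text \<open>The variables \<open>w\<close> of weight \<open>\<le> j\<close> are \<open>w\<^sub>1, \<dots>, w\<^sub>r\<close> with \<open>r = num_w t j\<close>.\<close>

definition wt :: "basis_family \<Rightarrow> nat \<Rightarrow> nat"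
  where "wt t i = (if i = 0 then 1 else (LEAST j. i \<le> num_w t j))"

definition monomial_wt :: "basis_family \<Rightarrow> (nat \<Rightarrow>\<^sub>0 nat) \<Rightarrow> nat"
  where "monomial_wt t \<alpha> = (\<Sum>i\<in>Poly_Mapping.keys \<alpha>. Poly_Mapping.lookup \<alpha> i * wt t i)"

text \<open>Real-valued polynomials of weight \<open>j\<close> in \<open>z\<close>, its conjugate and the real parts of the
  variables \<open>w\<close> of weight \<open>< j\<close>.\<close>

definition real_polys :: "basis_family \<Rightarrow> nat \<Rightarrow> ((nat \<Rightarrow> complex) \<Rightarrow> real) set"
  where "real_polys t j =
    {f. \<exists>S c. finite S \<and>
      (\<forall>(a, b, \<alpha>)\<in>S. Poly_Mapping.keys \<alpha> \<subseteq> {1..num_w t (j - 1)} \<and> a + b + monomial_wt t \<alpha> = j) \<and>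
      (\<forall>p. complex_of_real (f p) =
        (\<Sum>(a, b, \<alpha>)\<in>S. c (a, b, \<alpha>) * p 0 ^ a * cnj (p 0) ^ b *
           monomial_at \<alpha> (\<lambda>i. complex_of_real (Re (p i)))))}"

text \<open>Row \<open>i\<close> (counted from 0) of \<open>Im w\<^sup>\<l> - A\<^sub>\<l> (t\<^sup>\<l>\<^sub>1, t\<^sup>\<l>\<^sub>2, \<dots>)\<^sup>t\<close>.\<close>

definition defining_fun ::
  "basis_family \<Rightarrow> (nat \<Rightarrow> real mat) \<Rightarrow> nat \<Rightarrow> nat \<Rightarrow> (nat \<Rightarrow> complex) \<Rightarrow> real"
  where "defining_fun t A l i p =
    Im (p (num_w t (l - 1) + i + 1)) -
    (A l *\<^sub>v vec_of_list (map (\<lambda>f. f p) (t l))) $ i"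

text \<open>The submanifold of \<open>\<complex>\<^bsup>1+r\<^esup>\<close> given by the equations of weights \<open>2, \<dots>, j\<close>.\<close>

definition model_set ::
  "nat \<Rightarrow> nat \<Rightarrow> basis_family \<Rightarrow> (nat \<Rightarrow> real mat) \<Rightarrow> (nat \<Rightarrow> complex) set"
  where "model_set r j t A =
    {p \<in> cspace (1 + r). \<forall>l\<in>{2..j}. \<forall>i<dim_row (A l). defining_fun t A l i p = 0}"

definition pluriharmonic_polys ::
  "basis_family \<Rightarrow> (nat \<Rightarrow> real mat) \<Rightarrow> nat \<Rightarrow> ((nat \<Rightarrow> complex) \<Rightarrow> real) set"
  where "pluriharmonic_polys t A j =
    {f \<in> real_polys t j. \<exists>h \<in> hol_polys (1 + num_w t (j - 1)).
      \<forall>p \<in> model_set (num_w t (j - 1)) (j - 1) t A. f p = Re (h p)}"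

definition complement_basis :: "basis_family \<Rightarrow> (nat \<Rightarrow> real mat) \<Rightarrow> nat \<Rightarrow> bool"
  where "complement_basis t A j \<longleftrightarrow>
    set (t j) \<subseteq> real_polys t j \<and>
    distinct (t j) \<and> Real_Vector_Spaces.independent (set (t j)) \<and>
    Real_Vector_Spaces.span (set (t j)) \<inter> pluriharmonic_polys t A j = {0} \<and>
    {f + g | f g. f \<in> Real_Vector_Spaces.span (set (t j)) \<and> g \<in> pluriharmonic_polys t A j}
      = real_polys t j"

text \<open>\<open>t\<close> and \<open>A\<close> are the data of a model of codimension \<open>k\<close> and length \<open>\<rho>\<close>, the model itself being
  \<open>model_set k \<rho> t A\<close>.\<close>

definition model_data ::
  "nat \<Rightarrow> nat \<Rightarrow> basis_family \<Rightarrow> (nat \<Rightarrow> real mat) \<Rightarrow> bool"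
  where "model_data k \<rho> t A \<longleftrightarrow>
    k \<ge> 1 \<and>
    k \<le> num_w t \<rho> \<and> (\<forall>j<\<rho>. \<not> k \<le> num_w t j) \<and>
    (\<forall>j\<in>{2..\<rho>}. complement_basis t A j) \<and>
    (\<forall>l\<in>{2..<\<rho>}. A l \<in> carrier_mat (length (t l)) (length (t l)) \<and> invertible_mat (A l)) \<and>
    (let m = k - num_w t (\<rho> - 1) in
      A \<rho> \<in> carrier_mat m (length (t \<rho>)) \<and> vec_space.rank m (A \<rho>) = m)"


section \<open>Infinitesimal CR automorphisms\<close>

text \<open>A germ at 0 of a holomorphic function on \<open>\<complex>\<^sup>n\<close> is represented by its Taylor series, that is, by
  the coefficients of a power series converging absolutely on some polydisc.\<close>

definition hol_germs :: "nat \<Rightarrow> ((nat \<Rightarrow>\<^sub>0 nat) \<Rightarrow> complex) set"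
  where "hol_germs n =
    {c. (\<forall>\<alpha>. c \<alpha> \<noteq> 0 \<longrightarrow> Poly_Mapping.keys \<alpha> \<subseteq> {..<n}) \<and>
      (\<exists>r>0. (\<lambda>\<alpha>. norm (c \<alpha> * monomial_at \<alpha> (\<lambda>_. complex_of_real r))) summable_on UNIV)}"

definition germ_eval :: "((nat \<Rightarrow>\<^sub>0 nat) \<Rightarrow> complex) \<Rightarrow> (nat \<Rightarrow> complex) \<Rightarrow> complex"
  where "germ_eval c p = (\<Sum>\<^sub>\<infinity>\<alpha>. c \<alpha> * monomial_at \<alpha> p)"

text \<open>\<open>X 0\<close> is the coefficient of \<open>\<partial>\<^sub>z\<close> and \<open>X i\<close>, for \<open>i \<ge> 1\<close>, that of the derivation along \<open>w\<^sub>i\<close>.\<close>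

type_synonym vfield = "nat \<Rightarrow> (nat \<Rightarrow>\<^sub>0 nat) \<Rightarrow> complex"

definition hol_vfields :: "nat \<Rightarrow> vfield set"
  where "hol_vfields n = {X. (\<forall>i<n. X i \<in> hol_germs n) \<and> (\<forall>i\<ge>n. X i = 0)}"

text \<open>A vector is tangent to the model iff the differentials of all defining functions vanish on it
  (these differentials are linearly independent at every point).\<close>

definition tangent_at ::
  "nat \<Rightarrow> basis_family \<Rightarrow> (nat \<Rightarrow> real mat) \<Rightarrow> (nat \<Rightarrow> complex) \<Rightarrow> (nat \<Rightarrow> complex) \<Rightarrow> bool"
  where "tangent_at \<rho> t A p v \<longleftrightarrow>
    (\<forall>l\<in>{2..\<rho>}. \<forall>i<dim_row (A l).
      ((\<lambda>s::real. defining_fun t A l i (\<lambda>j. p j + complex_of_real s * v j))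
        has_real_derivative 0) (at 0))"

text \<open>Under the identification of \<open>\<complex>\<^bsup>1+k\<^esup>\<close> with \<open>\<real>\<^bsup>2+2k\<^esup>\<close> the real field \<open>X + conj X\<close>, twice the
  real part of \<open>X\<close>, has at \<open>p\<close> the value \<open>(Z(p), W\<^sup>1(p), \<dots>, W\<^sup>k(p))\<close>.\<close>

definition aut_CR :: "nat \<Rightarrow> nat \<Rightarrow> basis_family \<Rightarrow> (nat \<Rightarrow> real mat) \<Rightarrow> vfield set"
  where "aut_CR k \<rho> t A =
    {X \<in> hol_vfields (1 + k).
      \<exists>r>0. \<forall>p \<in> model_set k \<rho> t A. (\<forall>i\<le>k. norm (p i) < r) \<longrightarrow>
        tangent_at \<rho> t A p (\<lambda>i. germ_eval (X i) p)}"

definition aut_CR_component ::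
  "nat \<Rightarrow> nat \<Rightarrow> basis_family \<Rightarrow> (nat \<Rightarrow> real mat) \<Rightarrow> int \<Rightarrow> vfield set"
  where "aut_CR_component k \<rho> t A j =
    {X \<in> aut_CR k \<rho> t A.
      \<forall>i \<alpha>. X i \<alpha> \<noteq> 0 \<longrightarrow> int (monomial_wt t \<alpha>) - int (wt t i) = j}"

end

theory Submission
  imports Defs "HOL-Analysis.Derivative"
begin

text \<open>A homogeneous infinitesimal automorphism is the same as a real derivation of the algebra of
  polynomials in \<open>z\<close>, \<open>cnj z\<close>, \<open>u = Re w\<close> that preserves the kernel of the CR field \<open>Lb\<close>, so brackets are
  commutators of operators. Total nondegeneracy makes the model of finite type, whence a
  homogeneous automorphism is determined by its \<open>z\<close>-component together with the constant part of its
  \<open>w\<close>-components. In weight \<open>0\<close> this leaves only \<open>z \<mapsto> c z\<close>, hence the dimension at most \<open>2\<close>, and it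
  contains the dilation; in negative weights, a prescribed value at \<open>0\<close> extends recursively to an
  automorphism, because below the top weight all real polynomials are pluriharmonic on the model.
  This accounts for \<open>2 + k + 1\<close> or \<open>2 + k + 2\<close> dimensions. In weight \<open>1\<close> the vanishing is an
  argument with two strings: an element \<open>X\<close> acts on the nilpotent algebra generated by the two fields
  of weight \<open>-1\<close>, and nilpotency forces contradictory eigenvalue conditions as soon as the length is
  at least \<open>3\<close>. Higher weights follow, since \<open>X\<close> then commutes with the transitive algebra of
  negative weight. A general germ is treated by comparing coefficients along the orbits of the
  dilations.\<close>

section \<open>Weighted polynomials and their derivations\<close>

text \<open>Why length 3 is the threshold. Let \<open>E\<close>, \<open>Eb\<close> be the complex
  combinations of the two fields of weight -1 that act on \<open>z\<close>, \<open>cnj z\<close>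
  like the Wirtinger derivatives. An element X of weight 1 is governed by two numbers: [X, E] has
  weight 0 and multiplies \<open>E\<close> by \<alpha> and \<open>Eb\<close> by \<beta>. If (ad E)^n
  [E, Eb] is the last nonzero term of its string, then \<beta> = - (n + 1) / 2 * \<alpha>. Inserted
  into the string of a second pair of fields, n = 0 gives the coefficients -1, 0, ... times
  |\<alpha>|^2, so that string may stop and nothing is contradicted: this is the quadric of
  codimension 1, with its algebra su(2,1). For n >= 1 all coefficients are negative. So the decisive
  input is that [E, [E, Eb]] does not vanish, which a variable of weight 3 ensures. The explicit
  structure of the negative part, which changes with the chosen bases and matrices, never
  enters.\<close>

text \<open>Functions on a model are written in the coordinates \<open>z\<close>, \<open>cnj z\<close>, \<open>u\<^sub>i = Re w\<^sub>i\<close>, that is, as functions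
  of a point \<open>p\<close> which only look at \<open>p 0\<close> and at the real parts of the \<open>p i\<close>.\<close>

type_synonym pfun = "(nat \<Rightarrow> complex) \<Rightarrow> complex"

definition cst :: "complex \<Rightarrow> pfun" where "cst c = (\<lambda>_. c)"

definition cj :: "pfun \<Rightarrow> pfun" where "cj f = (\<lambda>p. cnj (f p))"

text \<open>Identities between functions are mostly proved by ring laws, so pointwise evaluation
  stays folded; \<open>fun_apply\<close> opens it where values at a point are compared.\<close>

declare plus_fun_apply [simp del] times_fun_apply [simp del] zero_fun_apply [simp del]
  one_fun_apply [simp del] minus_apply [simp del] uminus_apply [simp del]

lemma cst_apply: "cst c p = c" by (simp add: cst_def)
lemma cj_apply: "cj f p = cnj (f p)" by (simp add: cj_def)

lemma sum_fun_apply: "(\<Sum>i\<in>I. (f i :: 'a \<Rightarrow> 'b::comm_monoid_add)) p = (\<Sum>i\<in>I. f i p)"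
  by (induction I rule: infinite_finite_induct) (auto simp: plus_fun_apply zero_fun_apply)

lemmas fun_apply = plus_fun_apply times_fun_apply zero_fun_apply one_fun_apply minus_apply
  uminus_apply cst_apply cj_apply sum_fun_apply

lemma cst_0 [simp]: "cst 0 = 0" by (auto simp: fun_apply fun_eq_iff)
lemma cst_1 [simp]: "cst 1 = 1" by (auto simp: fun_apply fun_eq_iff)
lemma cst_add: "cst (a + b) = cst a + cst b" by (auto simp: fun_apply fun_eq_iff)
lemma cst_mult: "cst (a * b) = cst a * cst b" by (auto simp: fun_apply fun_eq_iff)
lemma cst_minus: "cst (- a) = - cst a" by (auto simp: fun_apply fun_eq_iff)
lemma cst_diff: "cst (a - b) = cst a - cst b" by (auto simp: fun_apply fun_eq_iff)
lemma cst_eq_iff [simp]: "cst a = cst b \<longleftrightarrow> a = b" by (auto simp: fun_apply fun_eq_iff)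
lemma cst_eq_0_iff [simp]: "cst a = 0 \<longleftrightarrow> a = 0" by (auto simp: fun_apply fun_eq_iff)

text \<open>Index \<open>0\<close> is \<open>z\<close>, index \<open>1\<close> is \<open>cnj z\<close>, and index \<open>i + 1\<close> is \<open>u\<^sub>i\<close> for \<open>i \<ge> 1\<close>.\<close>

definition xv :: "nat \<Rightarrow> pfun" where
  "xv g = (\<lambda>p. if g = 0 then p 0 else if g = 1 then cnj (p 0) else complex_of_real (Re (p (g - 1))))"

lemma cj_add: "cj (f + g) = cj f + cj g" by (auto simp: fun_apply fun_eq_iff)
lemma cj_diff: "cj (f - g) = cj f - cj g" by (auto simp: fun_apply fun_eq_iff)
lemma cj_mult: "cj (f * g) = cj f * cj g" by (auto simp: fun_apply fun_eq_iff)
lemma cj_cst [simp]: "cj (cst c) = cst (cnj c)" by (auto simp: fun_apply fun_eq_iff)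
lemma cj_cj [simp]: "cj (cj f) = f" by (auto simp: fun_apply fun_eq_iff)
lemma cj_0 [simp]: "cj 0 = 0" by (auto simp: fun_apply fun_eq_iff)
lemma cj_1 [simp]: "cj 1 = 1" by (auto simp: fun_apply fun_eq_iff)
lemma cj_sum: "cj (\<Sum>i\<in>I. f i) = (\<Sum>i\<in>I. cj (f i))" by (auto simp: fun_apply fun_eq_iff)
lemma cj_eq_0 [simp]: "cj f = 0 \<longleftrightarrow> f = 0" by (metis cj_cj cj_0)
lemma cj_xv: "cj (xv g) = (if g = 0 then xv 1 else if g = 1 then xv 0 else xv g)"
  by (auto simp: fun_apply fun_eq_iff xv_def)

section \<open>Polynomials graded by weight\<close>

locale wcoords =
  fixes k :: nat and w :: "nat \<Rightarrow> nat"
  assumes w_ge2: "1 \<le> i \<Longrightarrow> i \<le> k \<Longrightarrow> 2 \<le> w i"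
begin

definition gw :: "nat \<Rightarrow> nat" where "gw g = (if g \<le> 1 then 1 else w (g - 1))"

definition gens :: "nat set" where "gens = {..k + 1}"

lemma gens_iff [simp]: "g \<in> gens \<longleftrightarrow> g \<le> k + 1" by (simp add: gens_def)
lemma finite_gens [simp]: "finite gens" by (simp add: gens_def)

lemma gw_simps [simp]: "gw 0 = 1" "gw 1 = 1" "gw (Suc 0) = 1" "1 \<le> i \<Longrightarrow> gw (Suc i) = w i"
  by (auto simp: gw_def)

lemma gw_pos: "g \<le> k + 1 \<Longrightarrow> gw g \<ge> 1"
proof (cases "g \<le> 1")
  case False
  assume "g \<le> k + 1"
  with False have "2 \<le> w (g - 1)" by (intro w_ge2) auto
  with False show ?thesis by (simp add: gw_def)
qed (auto simp: gw_def)

inductive isR :: "pfun \<Rightarrow> bool" where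
  "h = cst c \<Longrightarrow> isR h"
| "g \<le> k + 1 \<Longrightarrow> h = xv g \<Longrightarrow> isR h"
| "isR f \<Longrightarrow> isR g \<Longrightarrow> h = f + g \<Longrightarrow> isR h"
| "isR f \<Longrightarrow> isR g \<Longrightarrow> h = f * g \<Longrightarrow> isR h"

definition R :: "pfun set" where "R = {f. isR f}"

lemma R_cst: "cst c \<in> R"
  and R_xv: "g \<le> k + 1 \<Longrightarrow> xv g \<in> R"
  and R_add: "f \<in> R \<Longrightarrow> f' \<in> R \<Longrightarrow> f + f' \<in> R"
  and R_mult: "f \<in> R \<Longrightarrow> f' \<in> R \<Longrightarrow> f * f' \<in> R"
  unfolding R_def mem_Collect_eq by (rule isR.intros; (assumption | rule refl))+

lemmas R_intros = R_cst R_xv R_add R_mult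

lemma R_induct [consumes 1, case_names R_cst R_xv R_add R_mult]:
  assumes "f \<in> R"
    and "\<And>c. P (cst c)" and "\<And>g. g \<le> k + 1 \<Longrightarrow> P (xv g)"
    and "\<And>f g. f \<in> R \<Longrightarrow> P f \<Longrightarrow> g \<in> R \<Longrightarrow> P g \<Longrightarrow> P (f + g)"
    and "\<And>f g. f \<in> R \<Longrightarrow> P f \<Longrightarrow> g \<in> R \<Longrightarrow> P g \<Longrightarrow> P (f * g)"
  shows "P f"
proof -
  have "isR f" using assms(1) by (simp add: R_def)
  then show ?thesis by (induction rule: isR.induct) (use assms(2-) in \<open>unfold R_def mem_Collect_eq, blast\<close>)+
qed

text \<open>Weights are integers, so that a derivation of weight \<open>j\<close> maps
  \<open>RW d\<close> to \<open>RW (d + j)\<close> without truncation; 0 belongs to every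
  weight.\<close>

inductive isRW :: "int \<Rightarrow> pfun \<Rightarrow> bool" where
  "h = 0 \<Longrightarrow> isRW d h"
| "h = cst c \<Longrightarrow> isRW 0 h"
| "g \<le> k + 1 \<Longrightarrow> h = xv g \<Longrightarrow> isRW (int (gw g)) h"
| "isRW d f \<Longrightarrow> isRW d g \<Longrightarrow> h = f + g \<Longrightarrow> isRW d h"
| "isRW d f \<Longrightarrow> isRW e g \<Longrightarrow> h = f * g \<Longrightarrow> isRW (d + e) h"

definition RW :: "int \<Rightarrow> pfun set" where "RW d = {f. isRW d f}"

lemma RW_0: "0 \<in> RW d"
  and RW_cst: "cst c \<in> RW 0"
  and RW_xv: "g \<le> k + 1 \<Longrightarrow> xv g \<in> RW (int (gw g))"
  and RW_add: "f \<in> RW d \<Longrightarrow> f' \<in> RW d \<Longrightarrow> f + f' \<in> RW d"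
  and RW_mult: "f \<in> RW d \<Longrightarrow> f' \<in> RW e \<Longrightarrow> f * f' \<in> RW (d + e)"
  unfolding RW_def mem_Collect_eq by (rule isRW.intros; (assumption | rule refl))+

lemmas RW_intros = RW_0 RW_cst RW_xv RW_add RW_mult

lemma RW_induct [consumes 1, case_names RW_0 RW_cst RW_xv RW_add RW_mult]:
  assumes "f \<in> RW d"
    and "\<And>d. P d 0" and "\<And>c. P 0 (cst c)" and "\<And>g. g \<le> k + 1 \<Longrightarrow> P (int (gw g)) (xv g)"
    and "\<And>d f g. f \<in> RW d \<Longrightarrow> P d f \<Longrightarrow> g \<in> RW d \<Longrightarrow> P d g \<Longrightarrow> P d (f + g)"
    and "\<And>d f e g. f \<in> RW d \<Longrightarrow> P d f \<Longrightarrow> g \<in> RW e \<Longrightarrow> P e g \<Longrightarrow> P (d + e) (f * g)"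
  shows "P d f"
proof -
  have "isRW d f" using assms(1) by (simp add: RW_def)
  then show ?thesis by (induction rule: isRW.induct) (use assms(2-) in \<open>unfold RW_def mem_Collect_eq, blast\<close>)+
qed

lemma zero_R [simp]: "0 \<in> R" using R_cst[of 0] by simp
lemma one_R [simp]: "1 \<in> R" using R_cst[of 1] by simp
lemma cst_R [simp]: "cst c \<in> R" by (rule R_cst)

lemma R_uminus: "f \<in> R \<Longrightarrow> - f \<in> R"
  using R_mult[OF R_cst[of "-1"], of f] by (simp add: cst_minus)
lemma R_diff: "f \<in> R \<Longrightarrow> g \<in> R \<Longrightarrow> f - g \<in> R"
  using R_add[OF _ R_uminus, of f g] by simp
lemma R_sum: "(\<And>i. i \<in> I \<Longrightarrow> f i \<in> R) \<Longrightarrow> (\<Sum>i\<in>I. f i) \<in> R"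
  by (induction I rule: infinite_finite_induct) (auto intro: R_add)

lemma RW_imp_R: "f \<in> RW d \<Longrightarrow> f \<in> R"
  by (induction rule: RW_induct) (auto intro: R_intros)

lemma RW_smult: "f \<in> RW d \<Longrightarrow> cst c * f \<in> RW d"
  using RW_mult[OF RW_cst, of f d] by simp
lemma RW_uminus: "f \<in> RW d \<Longrightarrow> - f \<in> RW d"
  using RW_smult[of f d "-1"] by (simp add: cst_minus)
lemma RW_diff: "f \<in> RW d \<Longrightarrow> g \<in> RW d \<Longrightarrow> f - g \<in> RW d"
  using RW_add[OF _ RW_uminus, of f d g] by simp
lemma RW_sum: "(\<And>i. i \<in> I \<Longrightarrow> f i \<in> RW d) \<Longrightarrow> (\<Sum>i\<in>I. f i) \<in> RW d"
  by (induction I rule: infinite_finite_induct) (auto intro: RW_add RW_0)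

lemma R_cj: "f \<in> R \<Longrightarrow> cj f \<in> R"
proof (induction rule: R_induct)
  case (R_xv g) then show ?case by (auto simp: cj_xv intro: R_intros)
qed (auto simp: cj_add cj_mult intro: R_intros)

lemma RW_cj: "f \<in> RW d \<Longrightarrow> cj f \<in> RW d"
proof (induction rule: RW_induct)
  case (RW_xv g)
  then show ?case using RW_intros(3)[of g] RW_intros(3)[of 0] RW_intros(3)[of 1]
    by (auto simp: cj_xv)
qed (auto simp: cj_add cj_mult intro: RW_intros)

text \<open>All generators have positive weight, so a product of weight at most 0 has a factor of
  negative weight or two constant factors. Most vanishing arguments below end here.\<close>

lemma RW_nonpos: assumes "f \<in> RW d" shows "(d < 0 \<longrightarrow> f = 0) \<and> (d = 0 \<longrightarrow> (\<exists>c. f = cst c))"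
  using assms
proof (induction rule: RW_induct)
  case (RW_0 d) show ?case by (auto intro: exI[of _ 0])
next
  case (RW_xv g) then show ?case using gw_pos[of g] by auto
next
  case (RW_add d f g) then show ?case by (auto simp: cst_add[symmetric])
next
  case (RW_mult d f e g)
  show ?case
  proof (intro conjI impI)
    assume "d + e < 0" then have "d < 0 \<or> e < 0" by linarith
    then show "f * g = 0" using RW_mult by auto
  next
    assume "d + e = 0" then have "d < 0 \<or> e < 0 \<or> (d = 0 \<and> e = 0)" by linarith
    then show "\<exists>c. f * g = cst c" using RW_mult by (auto simp: cst_mult[symmetric] intro: exI[of _ 0])
  qed
qed auto

lemma RW_neg: "f \<in> RW d \<Longrightarrow> d < 0 \<Longrightarrow> f = 0" using RW_nonpos by blast
lemma RW_zero: "f \<in> RW 0 \<Longrightarrow> \<exists>c. f = cst c" using RW_nonpos by blast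

section \<open>Gradients and partial derivatives\<close>

definition ray :: "(nat \<Rightarrow> complex) \<Rightarrow> (nat \<Rightarrow> complex) \<Rightarrow> real \<Rightarrow> (nat \<Rightarrow> complex)" where
  "ray p v s = (\<lambda>j. p j + complex_of_real s * v j)"

text \<open>The coordinates are real linear, so \<open>xv g v\<close> is the differential of
  \<open>xv g\<close> in the direction \<open>v\<close>. Derivatives are taken along real lines
  because tangency to the model is defined through them.\<close>

definition has_grad :: "pfun \<Rightarrow> (nat \<Rightarrow> pfun) \<Rightarrow> bool" where
  "has_grad f G \<longleftrightarrow> (\<forall>p v. ((\<lambda>s. f (ray p v s)) has_vector_derivative (\<Sum>g\<in>gens. G g p * xv g v)) (at 0))"

definition dirv :: "(nat \<Rightarrow> complex) \<Rightarrow> pfun \<Rightarrow> pfun" where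
  "dirv v f = (\<lambda>p. vector_derivative (\<lambda>s. f (ray p v s)) (at 0))"

text \<open>Wirtinger derivatives for the indices \<open>0\<close> and \<open>1\<close>.\<close>

definition pd :: "nat \<Rightarrow> pfun \<Rightarrow> pfun" where
  "pd g f = (\<lambda>p. if g = 0 then (dirv (\<lambda>j. if j = 0 then 1 else 0) f p - \<i> * dirv (\<lambda>j. if j = 0 then \<i> else 0) f p) / 2
     else if g = 1 then (dirv (\<lambda>j. if j = 0 then 1 else 0) f p + \<i> * dirv (\<lambda>j. if j = 0 then \<i> else 0) f p) / 2
     else dirv (\<lambda>j. if j = g - 1 then 1 else 0) f p)"

lemma sum_gens_single: fixes f :: "nat \<Rightarrow> 'a::comm_monoid_add"
  shows "(\<And>j. j \<le> k + 1 \<Longrightarrow> j \<noteq> g \<Longrightarrow> f j = 0) \<Longrightarrow> g \<le> k + 1 \<Longrightarrow> (\<Sum>j\<in>gens. f j) = f g"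
  by (subst sum.remove[of _ g]) (auto intro!: sum.neutral)

text \<open>Real directional derivatives along the axes determine the gradient. Hence
  \<open>pd\<close> depends on the function alone and not on how it is written as a
  polynomial.\<close>

lemma has_grad_pd: assumes "has_grad f G" "g \<le> k + 1" shows "pd g f = G g"
proof
  fix p
  have D: "dirv v f p = (\<Sum>g\<in>gens. G g p * xv g v)" for v
    using assms(1) unfolding has_grad_def dirv_def by (blast intro: vector_derivative_at)
  have two: "(\<Sum>g\<in>gens. h g) = h 0 + h 1" if "\<And>g. g \<ge> 2 \<Longrightarrow> h g = 0" for h :: "nat \<Rightarrow> complex"
  proof -
    have "(\<Sum>g\<in>gens. h g) = (\<Sum>g\<in>{0,1}. h g)"
      by (rule sum.mono_neutral_right) (auto intro: that)
    then show ?thesis by simp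
  qed
  consider "g = 0" | "g = 1" | "g \<ge> 2" by linarith
  then show "pd g f p = G g p"
  proof cases
    case 1 then show ?thesis unfolding pd_def D by (subst (1 2) two) (auto simp: xv_def algebra_simps)
  next
    case 2 then show ?thesis unfolding pd_def D by (subst (1 2) two) (auto simp: xv_def algebra_simps)
  next
    case 3
    have "(\<Sum>h\<in>gens. G h p * xv h (\<lambda>j. if j = g - 1 then 1 else 0)) = G g p"
      by (subst sum_gens_single[of g]) (use 3 assms in \<open>auto simp: xv_def\<close>)
    then show ?thesis using 3 unfolding pd_def D by auto
  qed
qed

lemma has_grad_cst: "has_grad (cst c) (\<lambda>_. 0)" by (auto simp: has_grad_def fun_apply)

lemma has_grad_xv: assumes "g \<le> k + 1" shows "has_grad (xv g) (\<lambda>h. if h = g then 1 else 0)"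
  unfolding has_grad_def
proof (intro allI)
  fix p v
  have "(\<Sum>h\<in>gens. (if h = g then 1 else 0::pfun) p * xv h v) = xv g v"
    by (subst sum_gens_single[of g]) (use assms in \<open>auto simp: fun_apply\<close>)
  moreover have "((\<lambda>s. xv g p + complex_of_real s * xv g v) has_vector_derivative xv g v) (at 0)"
    by (auto intro!: derivative_eq_intros simp: has_vector_derivative_def scaleR_conv_of_real mult.commute)
  moreover have "(\<lambda>s. xv g (ray p v s)) = (\<lambda>s. xv g p + complex_of_real s * xv g v)"
    by (auto simp: xv_def ray_def fun_eq_iff)
  ultimately show "((\<lambda>s. xv g (ray p v s)) has_vector_derivative (\<Sum>h\<in>gens. (if h = g then 1 else 0::pfun) p * xv h v)) (at 0)"
    by simp
qed

lemma has_grad_add: assumes "has_grad f F" "has_grad g G" shows "has_grad (f + g) (\<lambda>i. F i + G i)"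
  unfolding has_grad_def
  using assms by (auto simp: has_grad_def fun_apply distrib_right sum.distrib intro!: derivative_intros)

lemma ray_0 [simp]: "ray p v 0 = p" by (simp add: ray_def)

lemma has_grad_mult: assumes "has_grad f F" "has_grad g G" shows "has_grad (f * g) (\<lambda>i. F i * g + f * G i)"
  unfolding has_grad_def
proof (intro allI)
  fix p v
  have "((\<lambda>s. f (ray p v s) * g (ray p v s)) has_vector_derivative
    (f (ray p v 0) * (\<Sum>i\<in>gens. G i p * xv i v) + (\<Sum>i\<in>gens. F i p * xv i v) * g (ray p v 0))) (at 0)"
    using assms unfolding has_grad_def by (intro has_vector_derivative_mult) auto
  then show "((\<lambda>s. (f * g) (ray p v s)) has_vector_derivative (\<Sum>i\<in>gens. (F i * g + f * G i) p * xv i v)) (at 0)"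
    by (simp add: fun_apply sum_distrib_left sum_distrib_right sum.distrib algebra_simps)
qed

lemma R_has_grad_ex: "f \<in> R \<Longrightarrow> \<exists>G. has_grad f G"
  by (induction rule: R_induct) (use has_grad_cst has_grad_xv has_grad_add has_grad_mult in blast)+

lemma has_grad_cong: "(\<And>g. g \<le> k + 1 \<Longrightarrow> G g = G' g) \<Longrightarrow> has_grad f G = has_grad f G'"
proof -
  assume "\<And>g. g \<le> k + 1 \<Longrightarrow> G g = G' g"
  then have "(\<Sum>g\<in>gens. G g p * xv g v) = (\<Sum>g\<in>gens. G' g p * xv g v)" for p v
    by (intro sum.cong) auto
  then show ?thesis by (simp add: has_grad_def)
qed

lemma R_has_grad: assumes "f \<in> R" shows "has_grad f (\<lambda>g. pd g f)"
proof -
  obtain G where G: "has_grad f G" using R_has_grad_ex[OF assms] by blast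
  then show ?thesis using has_grad_cong[of "\<lambda>g. pd g f" G f] has_grad_pd[OF G] by simp
qed

lemma R_deriv: "f \<in> R \<Longrightarrow> ((\<lambda>s. f (ray p v s)) has_vector_derivative (\<Sum>g\<in>gens. pd g f p * xv g v)) (at 0)"
  using R_has_grad unfolding has_grad_def by blast

lemma pd_cst: "g \<le> k + 1 \<Longrightarrow> pd g (cst c) = 0" using has_grad_pd[OF has_grad_cst] by blast
lemma pd_xv: "g \<le> k + 1 \<Longrightarrow> h \<le> k + 1 \<Longrightarrow> pd g (xv h) = (if g = h then 1 else 0)"
  using has_grad_pd[OF has_grad_xv] by blast
lemma pd_add: "g \<le> k + 1 \<Longrightarrow> f \<in> R \<Longrightarrow> f' \<in> R \<Longrightarrow> pd g (f + f') = pd g f + pd g f'"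
  using has_grad_pd[OF has_grad_add[OF R_has_grad R_has_grad]] by blast
lemma pd_mult: "g \<le> k + 1 \<Longrightarrow> f \<in> R \<Longrightarrow> f' \<in> R \<Longrightarrow> pd g (f * f') = pd g f * f' + f * pd g f'"
  using has_grad_pd[OF has_grad_mult[OF R_has_grad R_has_grad]] by blast

lemma pd_R: "f \<in> R \<Longrightarrow> g \<le> k + 1 \<Longrightarrow> pd g f \<in> R"
  by (induction rule: R_induct) (auto simp: pd_cst pd_xv pd_add pd_mult intro: R_intros)

lemma pd_RW: "f \<in> RW d \<Longrightarrow> g \<le> k + 1 \<Longrightarrow> pd g f \<in> RW (d - int (gw g))"
proof (induction rule: RW_induct)
  case (RW_0 d) then show ?case using pd_cst[of g 0] by (auto intro: RW_intros(1))
next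
  case (RW_cst c) then show ?case using pd_cst[of g c] by (auto intro: RW_intros(1))
next
  case (RW_xv h) then show ?case using RW_intros(2)[of 1] by (auto simp: pd_xv intro: RW_intros(1))
next
  case (RW_add d f f') then show ?case by (auto simp: pd_add RW_imp_R intro: RW_intros(4))
next
  case (RW_mult d f e f')
  have "pd g f * f' \<in> RW (d + e - int (gw g))"
    using RW_intros(5)[of "pd g f" "d - int (gw g)" f' e] RW_mult by (simp add: algebra_simps)
  moreover have "f * pd g f' \<in> RW (d + e - int (gw g))"
    using RW_intros(5)[of f d "pd g f'" "e - int (gw g)"] RW_mult by (simp add: algebra_simps)
  ultimately show ?case using RW_mult by (auto simp: pd_mult RW_imp_R intro: RW_intros(4))
qed

lemma pd_uminus: "g \<le> k + 1 \<Longrightarrow> f \<in> R \<Longrightarrow> pd g (- f) = - pd g f"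
  using pd_mult[of g "cst (-1)" f, OF _ cst_R] pd_cst[of g "-1"] by (simp add: cst_minus)
lemma pd_diff: "g \<le> k + 1 \<Longrightarrow> f \<in> R \<Longrightarrow> f' \<in> R \<Longrightarrow> pd g (f - f') = pd g f - pd g f'"
  using pd_add[of g f "- f'"] by (simp add: pd_uminus R_uminus)
lemma pd_smult: "g \<le> k + 1 \<Longrightarrow> f \<in> R \<Longrightarrow> pd g (cst c * f) = cst c * pd g f"
  using pd_mult[of g "cst c" f, OF _ cst_R] by (simp add: pd_cst)
lemma pd_0: "g \<le> k + 1 \<Longrightarrow> pd g 0 = 0" using pd_cst[of g 0] by simp
lemma pd_sum: "g \<le> k + 1 \<Longrightarrow> (\<And>i. i \<in> I \<Longrightarrow> f i \<in> R) \<Longrightarrow> pd g (\<Sum>i\<in>I. f i) = (\<Sum>i\<in>I. pd g (f i))"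
  by (induction I rule: infinite_finite_induct) (auto simp: pd_0 pd_add R_sum)

section \<open>Derivations of the polynomial algebra\<close>

text \<open>Derivations are set to \<open>0\<close> off \<open>R\<close>, so that they are equal as soon as they agree on the generators.\<close>

definition der :: "(pfun \<Rightarrow> pfun) \<Rightarrow> bool" where
  "der D \<longleftrightarrow> (\<forall>f\<in>R. D f \<in> R) \<and> (\<forall>f\<in>R. \<forall>g\<in>R. D (f + g) = D f + D g) \<and>
    (\<forall>f\<in>R. \<forall>g\<in>R. D (f * g) = D f * g + f * D g) \<and> (\<forall>c. D (cst c) = 0) \<and> (\<forall>f. f \<notin> R \<longrightarrow> D f = 0)"

definition mk :: "(nat \<Rightarrow> pfun) \<Rightarrow> pfun \<Rightarrow> pfun" where
  "mk V f = (if f \<in> R then (\<Sum>g\<in>gens. V g * pd g f) else 0)"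

lemma der_R: "der D \<Longrightarrow> f \<in> R \<Longrightarrow> D f \<in> R"
  and der_add: "der D \<Longrightarrow> f \<in> R \<Longrightarrow> g \<in> R \<Longrightarrow> D (f + g) = D f + D g"
  and der_mult: "der D \<Longrightarrow> f \<in> R \<Longrightarrow> g \<in> R \<Longrightarrow> D (f * g) = D f * g + f * D g"
  and der_cst: "der D \<Longrightarrow> D (cst c) = 0"
  and der_out: "der D \<Longrightarrow> f \<notin> R \<Longrightarrow> D f = 0"
  unfolding der_def by blast+

lemma der_0: "der D \<Longrightarrow> D 0 = 0" using der_cst[of D 0] by simp
lemma der_1: "der D \<Longrightarrow> D 1 = 0" using der_cst[of D 1] by simp
lemma der_smult: "der D \<Longrightarrow> D (cst c * f) = cst c * D f"
proof (cases "f \<in> R")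
  case False
  assume D: "der D"
  show ?thesis
  proof (cases "c = 0")
    case True then show ?thesis using der_0[OF D] by simp
  next
    case c: False
    have "cst c * f \<notin> R"
    proof
      assume "cst c * f \<in> R"
      then have "cst (1/c) * (cst c * f) \<in> R" by (rule R_mult[OF cst_R])
      moreover have "cst (1/c) * (cst c * f) = f" using c by (auto simp: fun_apply fun_eq_iff)
      ultimately show False using False by simp
    qed
    then show ?thesis using der_out[OF D] False by auto
  qed
qed (auto simp: der_mult der_cst)
lemma der_uminus: "der D \<Longrightarrow> D (- f) = - D f"
  using der_smult[of D "- 1" f] by (simp add: cst_minus)
lemma der_diff: "der D \<Longrightarrow> f \<in> R \<Longrightarrow> g \<in> R \<Longrightarrow> D (f - g) = D f - D g"
  using der_add[of D f "- g"] by (simp add: der_uminus R_uminus)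
lemma der_sum: "der D \<Longrightarrow> (\<And>i. i \<in> I \<Longrightarrow> f i \<in> R) \<Longrightarrow> D (\<Sum>i\<in>I. f i) = (\<Sum>i\<in>I. D (f i))"
  by (induction I rule: infinite_finite_induct) (auto simp: der_0 der_add R_sum)

lemma der_mk: assumes "\<And>g. g \<le> k + 1 \<Longrightarrow> V g \<in> R" shows "der (mk V)"
  unfolding der_def
proof (intro conjI ballI allI impI)
  fix f assume "f \<in> R" then show "mk V f \<in> R" using assms by (auto simp: mk_def intro!: R_sum R_mult pd_R)
next
  fix f g assume fg: "f \<in> R" "g \<in> R"
  then show "mk V (f + g) = mk V f + mk V g"
    by (simp add: mk_def R_add pd_add sum.distrib distrib_left)
  show "mk V (f * g) = mk V f * g + f * mk V g"
    using fg by (simp add: mk_def R_mult pd_mult sum.distrib distrib_left sum_distrib_left sum_distrib_right algebra_simps)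
qed (auto simp: mk_def pd_cst)

lemma mk_xv: assumes "g \<le> k + 1" shows "mk V (xv g) = V g"
proof -
  have "(\<Sum>h\<in>gens. V h * pd h (xv g)) = V g * pd g (xv g)"
    by (rule sum_gens_single) (use assms in \<open>auto simp: pd_xv\<close>)
  then show ?thesis using assms by (simp add: mk_def R_xv pd_xv)
qed

lemma der_ext: assumes "der D" "der D'" "\<And>g. g \<le> k + 1 \<Longrightarrow> D (xv g) = D' (xv g)" shows "D = D'"
proof
  fix f show "D f = D' f"
  proof (cases "f \<in> R")
    case True then show ?thesis
      by (induction rule: R_induct)
         (use assms in \<open>auto simp: der_add der_mult der_cst\<close>)
  qed (use assms in \<open>auto simp: der_out\<close>)
qed

lemma der_expand: assumes "der D" "f \<in> R" shows "D f = (\<Sum>g\<in>gens. D (xv g) * pd g f)"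
proof -
  have 1: "der (mk (\<lambda>g. D (xv g)))"
    by (rule der_mk) (use der_R[OF assms(1)] R_xv in blast)
  have "D = mk (\<lambda>g. D (xv g))"
    by (rule der_ext[OF assms(1) 1]) (simp add: mk_xv)
  then have "D f = mk (\<lambda>g. D (xv g)) f" by (rule fun_cong)
  then show ?thesis using assms(2) by (simp only: mk_def if_True)
qed

section \<open>Brackets, weights of derivations, the Euler field\<close>

definition br :: "(pfun \<Rightarrow> pfun) \<Rightarrow> (pfun \<Rightarrow> pfun) \<Rightarrow> pfun \<Rightarrow> pfun" where
  "br X Y = (\<lambda>f. X (Y f) - Y (X f))"

lemma der_br: assumes "der X" "der Y" shows "der (br X Y)"
  unfolding der_def br_def using assms
  by (auto simp: der_R der_add der_mult der_cst der_out der_0 R_add R_mult R_diff algebra_simps)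

definition wd :: "int \<Rightarrow> (pfun \<Rightarrow> pfun) \<Rightarrow> bool" where
  "wd j D \<longleftrightarrow> der D \<and> (\<forall>d. \<forall>f\<in>RW d. D f \<in> RW (d + j))"

lemma wdI: assumes D: "der D" and G: "\<And>g. g \<le> k + 1 \<Longrightarrow> D (xv g) \<in> RW (int (gw g) + j)" shows "wd j D"
proof -
  have "D f \<in> RW (d + j)" if "f \<in> RW d" for f d using that
  proof (induction rule: RW_induct)
    case (RW_mult d f e g)
    have "D f * g \<in> RW (d + e + j)" using RW_intros(5)[of "D f" "d + j" g e] RW_mult by (simp add: algebra_simps)
    moreover have "f * D g \<in> RW (d + e + j)" using RW_intros(5)[of f d "D g" "e + j"] RW_mult by (simp add: algebra_simps)
    ultimately show ?case using RW_mult D by (auto simp: der_mult RW_imp_R intro: RW_intros(4))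
  qed (use D G in \<open>auto simp: der_0 der_cst der_add RW_imp_R intro: RW_0 RW_add\<close>)
  then show ?thesis using D by (auto simp: wd_def)
qed

lemma wd_der: "wd j D \<Longrightarrow> der D" by (simp add: wd_def)
lemma wd_RW: "wd j D \<Longrightarrow> f \<in> RW d \<Longrightarrow> D f \<in> RW (d + j)" by (simp add: wd_def)

lemma wd_br: assumes "wd i X" "wd j Y" shows "wd (i + j) (br X Y)"
  unfolding wd_def
proof (intro conjI allI ballI)
  show "der (br X Y)" using assms by (auto simp: wd_def der_br)
  fix d f assume f: "f \<in> RW d"
  show "br X Y f \<in> RW (d + (i + j))"
    using wd_RW[OF assms(1) wd_RW[OF assms(2) f]] wd_RW[OF assms(2) wd_RW[OF assms(1) f]]
    by (auto simp: br_def algebra_simps intro!: RW_diff)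
qed

definition euler :: "pfun \<Rightarrow> pfun" where "euler = mk (\<lambda>g. cst (of_nat (gw g)) * xv g)"

lemma der_euler: "der euler" unfolding euler_def by (rule der_mk) (intro R_mult R_cst R_xv)

lemma euler_RW: "f \<in> RW d \<Longrightarrow> euler f = cst (of_int d) * f"
proof (induction rule: RW_induct)
  case (RW_xv g) then show ?case by (simp add: euler_def mk_xv)
qed (auto simp: der_euler der_0 der_cst der_add der_mult RW_imp_R cst_add cst_mult algebra_simps)

lemma euler_formula: assumes "f \<in> RW d"
  shows "cst (of_int d) * f = (\<Sum>g\<in>gens. cst (of_nat (gw g)) * xv g * pd g f)"
  using euler_RW[OF assms] RW_imp_R[OF assms] by (simp add: euler_def mk_def)

text \<open>Euler's identity expresses \<open>d * f\<close> through the partial derivatives, and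
  \<open>d\<close> can be divided out.\<close>

lemma RW_const_pd: assumes "f \<in> RW d" "d \<noteq> 0" "\<And>g. g \<le> k + 1 \<Longrightarrow> pd g f = 0" shows "f = 0"
proof -
  have "cst (of_int d) * f = 0" using euler_formula[OF assms(1)] assms(3) by simp
  then show ?thesis using assms(2) by (auto simp: fun_apply fun_eq_iff)
qed

end

declare One_nat_def [simp del]

context wcoords
begin

lemma gens_cases: "g \<le> k + 1 \<Longrightarrow> (g = 0 \<Longrightarrow> P) \<Longrightarrow> (g = 1 \<Longrightarrow> P) \<Longrightarrow>
    (\<And>i. 1 \<le> i \<Longrightarrow> i \<le> k \<Longrightarrow> g = Suc i \<Longrightarrow> P) \<Longrightarrow> P"
  by (cases g; cases "g - 1") auto

lemma sum_gens: fixes f :: "nat \<Rightarrow> 'a::comm_monoid_add"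
  shows "(\<Sum>g\<in>gens. f g) = f 0 + (f 1 + (\<Sum>j\<in>{1..k}. f (Suc j)))"
proof -
  have "gens = insert 0 (insert 1 (Suc ` {1..k}))" by (auto simp: gens_def image_iff elim!: gens_cases)
  then show ?thesis by (simp add: sum.reindex image_iff del: image_Suc_atLeastAtMost sum.cl_ivl_Suc)
qed

section \<open>Conjugation and real derivations\<close>

definition dl :: "nat \<Rightarrow> pfun \<Rightarrow> pfun" where "dl g = mk (\<lambda>h. if h = g then 1 else 0)"

lemma der_dl: "der (dl g)" unfolding dl_def by (rule der_mk) auto
lemma dl_xv: "h \<le> k + 1 \<Longrightarrow> dl g (xv h) = (if h = g then 1 else 0)"
  unfolding dl_def by (rule mk_xv)

lemma dl_pd: assumes "g \<le> k + 1" "f \<in> R" shows "dl g f = pd g f"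
proof -
  have "(\<Sum>h\<in>gens. (if h = g then 1 else 0) * pd h f) = (if g = g then 1 else 0) * pd g f"
    by (rule sum_gens_single) (use assms in auto)
  then show ?thesis using assms by (simp add: dl_def mk_def)
qed

text \<open>The conjugate operator; \<open>cjd D = D\<close> expresses that the field
  \<open>D\<close> is real.\<close>

definition cjd :: "(pfun \<Rightarrow> pfun) \<Rightarrow> pfun \<Rightarrow> pfun" where "cjd D = (\<lambda>f. cj (D (cj f)))"

lemma R_cj_iff: "cj f \<in> R \<longleftrightarrow> f \<in> R" using R_cj[of f] R_cj[of "cj f"] by auto

lemma der_cjd: assumes "der D" shows "der (cjd D)"
  unfolding der_def cjd_def
  using der_R[OF assms] der_add[OF assms] der_mult[OF assms] der_cst[OF assms] der_out[OF assms]
  by (auto simp: R_cj_iff cj_add cj_mult)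

lemma wd_cjd: "wd j D \<Longrightarrow> wd j (cjd D)"
  using der_cjd[of D] by (auto simp: wd_def cjd_def intro: RW_cj)

lemma real_der: assumes "der D" "D (xv 1) = cj (D (xv 0))"
    "\<And>i. 1 \<le> i \<Longrightarrow> i \<le> k \<Longrightarrow> cj (D (xv (Suc i))) = D (xv (Suc i))"
  shows "cjd D = D"
proof (rule der_ext)
  fix g assume "g \<le> k + 1"
  then show "cjd D (xv g) = D (xv g)"
    by (rule gens_cases) (use assms in \<open>auto simp: cjd_def cj_xv\<close>)
qed (use assms der_cjd in auto)

lemma cjd_dl: "g \<le> k + 1 \<Longrightarrow> cjd (dl g) = dl (if g = 0 then 1 else if g = 1 then 0 else g)"
proof (rule der_ext)
  fix h assume "h \<le> k + 1"
  then show "cjd (dl g) (xv h) = dl (if g = 0 then 1 else if g = 1 then 0 else g) (xv h)"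
    by (rule gens_cases) (auto simp: cjd_def cj_xv dl_xv)
qed (auto simp: der_cjd der_dl)

lemma pd_cj: assumes "g \<le> k + 1" "f \<in> R"
  shows "cj (pd g f) = pd (if g = 0 then 1 else if g = 1 then 0 else g) (cj f)"
proof -
  have "cj (dl g f) = cjd (dl g) (cj f)" by (simp add: cjd_def)
  also have "\<dots> = dl (if g = 0 then 1 else if g = 1 then 0 else g) (cj f)"
    using assms by (simp add: cjd_dl)
  finally show ?thesis using assms by (auto simp: dl_pd R_cj split: if_splits)
qed

lemma der_scale: assumes "der D" "f \<in> R" shows "der (\<lambda>g. f * D g)"
  unfolding der_def
  using der_R[OF assms(1)] der_add[OF assms(1)] der_mult[OF assms(1)] der_cst[OF assms(1)] der_out[OF assms(1)] assms(2)
  by (auto simp: R_mult distrib_left algebra_simps)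

lemma der_plus: assumes "der D" "der D'" shows "der (\<lambda>f. D f + D' f)"
  unfolding der_def
  using der_R[OF assms(1)] der_add[OF assms(1)] der_mult[OF assms(1)] der_cst[OF assms(1)] der_out[OF assms(1)]
    der_R[OF assms(2)] der_add[OF assms(2)] der_mult[OF assms(2)] der_cst[OF assms(2)] der_out[OF assms(2)]
  by (auto simp: R_add algebra_simps)

lemma der_zero: "der (\<lambda>_. 0)" by (auto simp: der_def)

text \<open>The derivatives along the \<open>u\<close> have negative weight and vanish, those along
  \<open>z\<close> and \<open>cnj z\<close> are constants; Euler's identity puts them
  together.\<close>

lemma RW_1_linear: assumes "f \<in> RW 1" shows "\<exists>a b. f = cst a * xv 0 + cst b * xv 1"
proof -
  have "pd 0 f \<in> RW 0" "pd 1 f \<in> RW 0" using pd_RW[OF assms, of 0] pd_RW[OF assms, of 1] by auto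
  then obtain a b where ab: "pd 0 f = cst a" "pd 1 f = cst b" using RW_zero by meson
  have "pd (Suc i) f = 0" if "i \<in> {1..k}" for i
    by (rule RW_neg[OF pd_RW[OF assms]]) (use that w_ge2[of i] in auto)
  then have "f = xv 0 * pd 0 f + xv 1 * pd 1 f"
    using euler_formula[OF assms] by (simp add: sum_gens)
  then show ?thesis using ab by (metis mult.commute)
qed

end

section \<open>The CR structure in intrinsic coordinates\<close>

text \<open>The model is \<open>Im w\<^sub>i = \<Phi>\<^sub>i(z, cnj z, u)\<close>. The function \<open>W i\<close> below is the restriction of \<open>w\<^sub>i\<close> to it, \<open>Lb\<close> is the
  antiholomorphic CR field, determined by \<open>Lb (cnj z) = 1\<close> and by annihilating \<open>z\<close> and all \<open>W i\<close>, and
  restrictions of holomorphic polynomials are the elements of its kernel.\<close>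

locale cr_pre = wcoords +
  fixes \<Phi> :: "nat \<Rightarrow> pfun" and \<rho> :: nat
  assumes Phi_RW: "1 \<le> i \<Longrightarrow> i \<le> k \<Longrightarrow> \<Phi> i \<in> RW (int (w i))"
    and Phi_real: "1 \<le> i \<Longrightarrow> i \<le> k \<Longrightarrow> cj (\<Phi> i) = \<Phi> i"
    and Phi_dep: "1 \<le> i \<Longrightarrow> i \<le> k \<Longrightarrow> 1 \<le> j \<Longrightarrow> j \<le> k \<Longrightarrow> w i \<le> w j \<Longrightarrow> pd (Suc j) (\<Phi> i) = 0"
    and w_le: "1 \<le> i \<Longrightarrow> i \<le> k \<Longrightarrow> w i \<le> \<rho>"
begin

lemma Phi_R: "1 \<le> i \<Longrightarrow> i \<le> k \<Longrightarrow> \<Phi> i \<in> R" using Phi_RW RW_imp_R by blast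

lemma sum_lower: assumes i: "1 \<le> i" "i \<le> k"
  shows "(\<Sum>j\<in>{1..k}. V j * pd (Suc j) (\<Phi> i)) = (\<Sum>j\<in>{j\<in>{1..k}. w j < w i}. V j * pd (Suc j) (\<Phi> i))"
  by (rule sum.mono_neutral_right) (use Phi_dep[OF i] in \<open>auto simp: not_less\<close>)

lemma Phi_expand: assumes D: "der D" and i: "1 \<le> i" "i \<le> k"
  shows "D (\<Phi> i) = D (xv 0) * pd 0 (\<Phi> i) + (D (xv 1) * pd 1 (\<Phi> i) +
    (\<Sum>j\<in>{j\<in>{1..k}. w j < w i}. D (xv (Suc j)) * pd (Suc j) (\<Phi> i)))"
  unfolding der_expand[OF D Phi_R[OF i]] sum_gens sum_lower[OF i] by (rule refl)

text \<open>Solution of \<open>Lb (W i) = 0\<close>: this equation reads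
  \<open>Lb u = - \<i> * Lb (\<Phi> i)\<close> for the variable \<open>u\<close> of index
  \<open>i\<close>, and the right-hand side involves only variables of smaller weight by
  \<open>Phi_dep\<close>, which also gives termination.\<close>

function lb :: "nat \<Rightarrow> pfun" where
  "lb i = cst (-\<i>) * (pd 1 (\<Phi> i) + (\<Sum>j\<in>{j\<in>{1..k}. w j < w i}. lb j * pd (Suc j) (\<Phi> i)))"
  by pat_completeness auto
termination by (relation "measure w") auto

declare lb.simps [simp del]

lemma lb_RW: "1 \<le> i \<Longrightarrow> i \<le> k \<Longrightarrow> lb i \<in> RW (int (w i) - 1)"
proof (induction i rule: lb.induct)
  case (1 i)
  have "lb j * pd (Suc j) (\<Phi> i) \<in> RW (int (w i) - 1)" if "j \<in> {j\<in>{1..k}. w j < w i}" for j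
    using RW_mult[OF 1(1)[OF that] pd_RW[OF Phi_RW[OF 1(2,3)], of "Suc j"]] that by simp
  then show ?case using pd_RW[OF Phi_RW[OF 1(2,3)], of 1]
    by (subst lb.simps) (auto intro!: RW_smult RW_add RW_sum)
qed

definition Lb :: "pfun \<Rightarrow> pfun" where
  "Lb = mk (\<lambda>g. if g = 0 then 0 else if g = 1 then 1 else lb (g - 1))"

lemma der_Lb: "der Lb"
  unfolding Lb_def
proof (rule der_mk)
  fix g assume "g \<le> k + 1"
  then show "(if g = 0 then 0 else if g = 1 then 1 else lb (g - 1)) \<in> R"
    by (rule gens_cases) (auto intro: RW_imp_R lb_RW)
qed

lemma Lb_xv: "Lb (xv 0) = 0" "Lb (xv 1) = 1" "Lb (xv (Suc 0)) = 1"
  "1 \<le> i \<Longrightarrow> i \<le> k \<Longrightarrow> Lb (xv (Suc i)) = lb i"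
  unfolding Lb_def by (auto simp: mk_xv)

lemma wd_Lb: "wd (-1) Lb"
proof (rule wdI[OF der_Lb])
  fix g assume "g \<le> k + 1"
  then show "Lb (xv g) \<in> RW (int (gw g) + -1)"
    by (rule gens_cases) (use RW_cst[of 1] in \<open>auto simp: Lb_xv intro: lb_RW RW_0\<close>)
qed

definition W :: "nat \<Rightarrow> pfun" where "W i = (if i = 0 then xv 0 else xv (Suc i) + cst \<i> * \<Phi> i)"

lemma W_0: "W 0 = xv 0" by (simp add: W_def)

lemma W_RW: "i \<le> k \<Longrightarrow> W i \<in> RW (if i = 0 then 1 else int (w i))"
  using RW_xv[of 0] RW_xv[of "Suc i"] by (auto simp: W_def intro!: RW_add RW_smult Phi_RW)

lemma W_R: "i \<le> k \<Longrightarrow> W i \<in> R" using W_RW RW_imp_R by blast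

lemma der_W: assumes "der D" "1 \<le> i" "i \<le> k"
  shows "D (W i) = D (xv (Suc i)) + cst \<i> * D (\<Phi> i)"
  using assms R_xv[of "Suc i"] Phi_R[of i] by (simp add: W_def der_add der_smult R_mult)

lemma Lb_W: assumes "i \<le> k" shows "Lb (W i) = 0"
proof (cases "i = 0")
  case False
  then have i: "1 \<le> i" "i \<le> k" using assms by auto
  have "(\<Sum>j\<in>{j\<in>{1..k}. w j < w i}. Lb (xv (Suc j)) * pd (Suc j) (\<Phi> i)) =
    (\<Sum>j\<in>{j\<in>{1..k}. w j < w i}. lb j * pd (Suc j) (\<Phi> i))"
    by (rule sum.cong) (auto simp: Lb_xv)
  then have "lb i = cst (-\<i>) * Lb (\<Phi> i)"
    by (subst lb.simps) (simp add: Phi_expand[OF der_Lb i] Lb_xv(1,2))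
  then have "Lb (W i) = (cst (-\<i>) + cst \<i>) * Lb (\<Phi> i)"
    using der_W[OF der_Lb i] i by (simp add: Lb_xv algebra_simps)
  then show ?thesis by (simp add: cst_minus)
qed (simp add: W_0 Lb_xv)

lemma pd_W: assumes "1 \<le> i" "i \<le> k" "1 \<le> j" "j \<le> k" "w j \<le> w i"
  shows "pd (Suc i) (W j) = (if i = j then 1 else 0)"
  using assms Phi_dep[of j i] R_xv[of "Suc j"] Phi_R[of j]
  by (simp add: W_def pd_add pd_smult R_mult pd_xv)

definition L :: "pfun \<Rightarrow> pfun" where "L = cjd Lb"

lemma der_L: "der L" unfolding L_def by (rule der_cjd[OF der_Lb])
lemma wd_L: "wd (-1) L" unfolding L_def by (rule wd_cjd[OF wd_Lb])
lemma L_xv: "L (xv 0) = 1" "L (xv 1) = 0"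
  by (simp_all add: L_def cjd_def cj_xv Lb_xv)
lemma Lb_cj: "Lb (cj f) = cj (L f)" by (simp add: L_def cjd_def)

text \<open>The commutator of \<open>D\<close> with the derivative along the \<open>i\<close>-th
  real variable kills \<open>z\<close> and \<open>cnj z\<close>, and its value on the
  \<open>j\<close>-th real variable has weight \<open>w j - 1 - w i\<close>. This is negative unless
  \<open>w i < w j\<close>, and then the corresponding derivative of \<open>f\<close> vanishes by
  \<open>top\<close>. So the commutator annihilates \<open>f\<close>.\<close>

lemma comm_pd:
  assumes D: "wd (-1) D" and c: "D (xv 0) = cst a" "D (xv 1) = cst b" and f: "f \<in> R" "D f = 0"
    and i: "1 \<le> i" "i \<le> k" and top: "\<And>j. 1 \<le> j \<Longrightarrow> j \<le> k \<Longrightarrow> w i < w j \<Longrightarrow> pd (Suc j) f = 0"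
  shows "D (pd (Suc i) f) = 0"
proof -
  have dD: "der D" using D by (rule wd_der)
  have C: "der (br D (dl (Suc i)))" by (rule der_br[OF dD der_dl])
  have z: "br D (dl (Suc i)) (xv g) * pd g f = 0" if "g \<le> k + 1" for g
    using that
  proof (rule gens_cases)
    fix j assume j: "1 \<le> j" "j \<le> k" "g = Suc j"
    show ?thesis
    proof (cases "w i < w j")
      case False
      have "D (xv g) \<in> RW (int (w j) + -1)" using wd_RW[OF D RW_xv[of g]] j by auto
      then have "pd (Suc i) (D (xv g)) \<in> RW (int (w j) + -1 - int (w i))" "D (xv g) \<in> R"
        using pd_RW[of _ _ "Suc i"] i RW_imp_R by auto
      then have "dl (Suc i) (D (xv g)) = 0"
        using RW_neg[of _ "int (w j) + -1 - int (w i)"] False i by (auto simp: dl_pd)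
      moreover have "D (dl (Suc i) (xv g)) = 0" using j by (simp add: dl_xv der_1[OF dD] der_0[OF dD])
      ultimately show ?thesis by (simp add: br_def)
    qed (use top j in auto)
  qed (use i c in \<open>auto simp: br_def dl_xv der_0[OF dD] der_cst[OF der_dl]\<close>)
  have "br D (dl (Suc i)) f = 0"
    unfolding der_expand[OF C f(1)] by (rule sum.neutral) (use z in auto)
  then show ?thesis using f i by (simp add: br_def dl_pd der_0[OF der_dl])
qed

text \<open>The passage from the \<open>u\<close> to the \<open>W\<close> is triangular with respect
  to weight: \<open>W i\<close> differs from its real variable by \<open>\<Phi> i\<close>, on which
  the derivations agree by induction.\<close>

lemma der_ext_W: assumes D: "der D" "der D'" and 1: "D (xv 1) = D' (xv 1)" and W: "\<And>i. i \<le> k \<Longrightarrow> D (W i) = D' (W i)"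
  shows "D = D'"
proof (rule der_ext[OF D])
  have u: "D (xv (Suc i)) = D' (xv (Suc i))" if "1 \<le> i" "i \<le> k" for i
    using that
  proof (induction "w i" arbitrary: i rule: less_induct)
    case less
    have "D (\<Phi> i) = D' (\<Phi> i)"
      unfolding Phi_expand[OF D(1) less(2,3)] Phi_expand[OF D(2) less(2,3)]
      using less(1) 1 W[of 0] by (auto simp: W_0 intro!: sum.cong arg_cong2[where f = "(+)"])
    then show ?case using W[of i] der_W[OF D(1) less(2,3)] der_W[OF D(2) less(2,3)] less by simp
  qed
  fix g assume "g \<le> k + 1"
  then show "D (xv g) = D' (xv g)" by (rule gens_cases) (use u 1 W[of 0] in \<open>auto simp: W_0\<close>)
qed

section \<open>Infinitesimal automorphisms as derivations\<close>

text \<open>An operator in the intrinsic coordinates is tangent to the model automatically.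
  \<open>cjd D = D\<close> makes it real, and \<open>Lb (D (W i)) = 0\<close> says that its
  components along \<open>z\<close> and the \<open>w\<close> are CR, hence restrictions of
  holomorphic polynomials.\<close>

definition aut :: "int \<Rightarrow> (pfun \<Rightarrow> pfun) \<Rightarrow> bool" where
  "aut j D \<longleftrightarrow> wd j D \<and> cjd D = D \<and> (\<forall>i\<le>k. Lb (D (W i)) = 0)"

lemma aut_der: "aut j D \<Longrightarrow> der D" by (auto simp: aut_def wd_def)
lemma aut_wd: "aut j D \<Longrightarrow> wd j D" by (auto simp: aut_def)
lemma aut_cj: "aut j D \<Longrightarrow> D (cj f) = cj (D f)" unfolding aut_def cjd_def by (metis cj_cj)

text \<open>Both sides are derivations, and they agree on \<open>cnj z\<close> and on the \<open>W i\<close>, which generate \<open>R\<close>.\<close>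

lemma aut_br_Lb: assumes "aut j D" shows "Lb (D f) = D (Lb f) + Lb (D (xv 1)) * Lb f"
proof -
  note D = aut_der[OF assms]
  have r: "Lb (D (xv 1)) \<in> R" using der_R[OF der_Lb der_R[OF D R_xv[of 1]]] by simp
  have "br Lb D = (\<lambda>f. Lb (D (xv 1)) * Lb f)"
  proof (rule der_ext_W)
    show "der (br Lb D)" by (rule der_br[OF der_Lb D])
    show "der (\<lambda>f. Lb (D (xv 1)) * Lb f)" by (rule der_scale[OF der_Lb r])
    show "br Lb D (xv 1) = Lb (D (xv 1)) * Lb (xv 1)" unfolding br_def Lb_xv by (simp add: der_1[OF D])
    fix i assume "i \<le> k"
    then show "br Lb D (W i) = Lb (D (xv 1)) * Lb (W i)"
      using assms by (simp add: br_def Lb_W der_0[OF D] aut_def)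
  qed
  then have "br Lb D f = Lb (D (xv 1)) * Lb f" by (rule fun_cong)
  then show ?thesis by (simp add: br_def algebra_simps)
qed

lemma aut_H: "aut j D \<Longrightarrow> Lb f = 0 \<Longrightarrow> Lb (D f) = 0"
  using aut_br_Lb[of j D f] by (simp add: der_0 aut_der)

text \<open>In general \<open>D\<close> commutes with \<open>Lb\<close> only up to the multiple
  \<open>Lb (D (xv 1))\<close> of \<open>Lb\<close>; a constant value on \<open>z\<close> makes this
  factor 0. The identity for \<open>L\<close> is the conjugate one.\<close>

lemma aut_comm: assumes "aut j D" "D (xv 0) = cst c" shows "Lb (D f) = D (Lb f)" "L (D f) = D (L f)"
proof -
  have "D (xv 1) = cst (cnj c)" using aut_cj[OF assms(1), of "xv 0"] assms(2) by (simp add: cj_xv)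
  then have 1: "Lb (D f) = D (Lb f)" for f using aut_br_Lb[OF assms(1), of f] by (simp add: der_cst[OF der_Lb])
  then show "Lb (D f) = D (Lb f)" .
  show "L (D f) = D (L f)"
    unfolding L_def cjd_def using aut_cj[OF assms(1)] 1 by metis
qed

lemma aut_br: assumes "aut i X" "aut j Y" shows "aut (i + j) (br X Y)"
  unfolding aut_def
proof (intro conjI allI impI)
  show "wd (i + j) (br X Y)" using assms by (auto simp: aut_def wd_br)
  show "cjd (br X Y) = br X Y"
    by (rule ext) (simp add: cjd_def br_def aut_cj[OF assms(1)] aut_cj[OF assms(2)] cj_diff)
  fix l assume l: "l \<le> k"
  have "Lb (X (Y (W l))) = 0" "Lb (Y (X (W l))) = 0"
    using aut_H[OF assms(1) aut_H[OF assms(2) Lb_W[OF l]]] aut_H[OF assms(2) aut_H[OF assms(1) Lb_W[OF l]]] by auto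
  moreover have "X (Y (W l)) \<in> R" "Y (X (W l)) \<in> R"
    using der_R[OF aut_der[OF assms(1)] der_R[OF aut_der[OF assms(2)] W_R[OF l]]]
      der_R[OF aut_der[OF assms(2)] der_R[OF aut_der[OF assms(1)] W_R[OF l]]] by auto
  ultimately show "Lb (br X Y (W l)) = 0" by (simp add: br_def der_diff[OF der_Lb])
qed

lemma wd_comb: assumes "wd j X" "wd j Y" shows "wd j (\<lambda>f. cst a * X f + cst b * Y f)"
  unfolding wd_def
proof (intro conjI allI ballI)
  show "der (\<lambda>f. cst a * X f + cst b * Y f)"
    by (rule der_plus[OF der_scale[OF wd_der[OF assms(1)] cst_R] der_scale[OF wd_der[OF assms(2)] cst_R]])
qed (intro RW_add RW_smult wd_RW[OF assms(1)] wd_RW[OF assms(2)])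

lemma aut_comb: assumes "aut j X" "aut j Y" shows "aut j (\<lambda>f. cst (complex_of_real a) * X f + cst (complex_of_real b) * Y f)"
  unfolding aut_def
proof (intro conjI allI impI)
  show "wd j (\<lambda>f. cst (complex_of_real a) * X f + cst (complex_of_real b) * Y f)"
    using assms by (intro wd_comb) (auto simp: aut_def)
  show "cjd (\<lambda>f. cst (complex_of_real a) * X f + cst (complex_of_real b) * Y f) = (\<lambda>f. cst (complex_of_real a) * X f + cst (complex_of_real b) * Y f)"
    by (rule ext) (simp add: cjd_def aut_cj[OF assms(1)] aut_cj[OF assms(2)] cj_add cj_mult)
  fix l assume l: "l \<le> k"
  have "X (W l) \<in> R" "Y (W l) \<in> R" using der_R[OF aut_der[OF assms(1)] W_R[OF l]] der_R[OF aut_der[OF assms(2)] W_R[OF l]] by auto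
  then show "Lb (cst (complex_of_real a) * X (W l) + cst (complex_of_real b) * Y (W l)) = 0"
    using assms l by (simp add: der_add[OF der_Lb] R_mult der_smult[OF der_Lb] aut_def)
qed

lemma aut_euler: "aut 0 euler"
  unfolding aut_def
proof (intro conjI allI impI)
  show "wd 0 euler" by (auto simp: wd_def der_euler euler_RW intro: RW_smult)
  have e: "euler (xv g) = cst (of_nat (gw g)) * xv g" if "g \<le> k + 1" for g
    using euler_RW[OF RW_xv[OF that]] by simp
  show "cjd euler = euler"
    by (rule real_der[OF der_euler]) (use e in \<open>auto simp: cj_mult cj_xv\<close>)
  fix i assume "i \<le> k"
  then show "Lb (euler (W i)) = 0"
    using euler_RW[OF W_RW] by (simp add: der_smult[OF der_Lb] Lb_W)
qed

end

section \<open>Finite type, uniqueness and extension of automorphisms\<close>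

text \<open>\<open>real_is_Im\<close>: below the top weight every real polynomial is pluriharmonic on the model, because the
  chosen complements have become imaginary parts of coordinates. \<open>nondegenerate\<close>: no combination of the
  defining functions of one weight is pluriharmonic on the part of lower weight.\<close>

locale cr_model = cr_pre +
  assumes real_is_Im: "f \<in> RW (int d) \<Longrightarrow> cj f = f \<Longrightarrow> d < \<rho> \<Longrightarrow>
      \<exists>h\<in>RW (int d). Lb h = 0 \<and> (\<forall>p. Im (h p) = Re (f p))"
    and nondegenerate: "h \<in> RW (int l) \<Longrightarrow> Lb h = 0 \<Longrightarrow>
      (\<And>j. 1 \<le> j \<Longrightarrow> j \<le> k \<Longrightarrow> l \<le> w j \<Longrightarrow> pd (Suc j) h = 0) \<Longrightarrow>
      (\<And>p. Im (h p) = (\<Sum>j\<in>{j\<in>{1..k}. w j = l}. c j * Re (\<Phi> j p))) \<Longrightarrow>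
      1 \<le> i \<Longrightarrow> i \<le> k \<Longrightarrow> w i = l \<Longrightarrow> c i = 0"
begin

text \<open>The derivatives of \<open>f\<close> along the variables of weight \<open>l\<close> are
  real constants. Subtracting the corresponding combination of the \<open>W\<close> leaves a CR
  function free of these variables, whose imaginary part is a combination of the
  \<open>\<Phi>\<close> of weight \<open>l\<close>; nondegeneracy makes the constants 0.\<close>

lemma real_CR_no_linear:
  assumes f: "f \<in> RW (int l)" "cj f = f" "Lb f = 0"
    and top: "\<And>j. 1 \<le> j \<Longrightarrow> j \<le> k \<Longrightarrow> l < w j \<Longrightarrow> pd (Suc j) f = 0"
    and i: "1 \<le> i" "i \<le> k" "w i = l"
  shows "pd (Suc i) f = 0"
proof -
  let ?I = "{j\<in>{1..k}. w j = l}"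
  note fR = RW_imp_R[OF f(1)]
  have "\<exists>c. pd (Suc j) f = cst (complex_of_real c)" if j: "j \<in> ?I" for j
  proof -
    have "pd (Suc j) f \<in> RW 0" using pd_RW[OF f(1), of "Suc j"] j by auto
    then obtain c where c: "pd (Suc j) f = cst c" using RW_zero by blast
    have "cj (pd (Suc j) f) = pd (Suc j) f" using pd_cj[of "Suc j" f] j fR f(2) by auto
    then have "cnj c = c" using c by simp
    then have "c = complex_of_real (Re c)" by (simp add: complex_eq_iff)
    then show ?thesis using c by metis
  qed
  then obtain c where c: "\<And>j. j \<in> ?I \<Longrightarrow> pd (Suc j) f = cst (complex_of_real (c j))" by metis
  define h where "h = f - (\<Sum>j\<in>?I. cst (complex_of_real (c j)) * W j)"
  have WR: "W j \<in> R" if "j \<in> ?I" for j using W_R[of j] that by auto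
  have sR: "(\<Sum>j\<in>?I. cst (complex_of_real (c j)) * W j) \<in> R" using WR by (intro R_sum R_mult cst_R)
  have "- c i = 0"
  proof (rule nondegenerate[of h l "\<lambda>j. - c j" i])
    have "cst (complex_of_real (c j)) * W j \<in> RW (int l)" if "j \<in> ?I" for j
      using W_RW[of j] that by (intro RW_smult) auto
    then show "h \<in> RW (int l)" unfolding h_def by (intro RW_diff f RW_sum)
    have "Lb (\<Sum>j\<in>?I. cst (complex_of_real (c j)) * W j) = (\<Sum>j\<in>?I. Lb (cst (complex_of_real (c j)) * W j))"
      by (rule der_sum[OF der_Lb]) (intro R_mult cst_R WR)
    also have "\<dots> = 0" by (rule sum.neutral) (auto simp: der_smult[OF der_Lb] Lb_W)
    finally show "Lb h = 0" unfolding h_def using der_diff[OF der_Lb fR sR] f by simp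
    fix p
    have "Im (f p) = 0" using fun_cong[OF f(2), of p] by (simp add: cj_apply complex_eq_iff)
    moreover have "Im (W j p) = Re (\<Phi> j p)" if "j \<in> ?I" for j
      using that by (auto simp: W_def fun_apply xv_def)
    ultimately show "Im (h p) = (\<Sum>j\<in>?I. - c j * Re (\<Phi> j p))"
      by (simp add: h_def fun_apply sum_negf)
  next
    fix j assume j: "1 \<le> j" "j \<le> k" "l \<le> w j"
    have "pd (Suc j) (\<Sum>j\<in>?I. cst (complex_of_real (c j)) * W j) = (\<Sum>i\<in>?I. pd (Suc j) (cst (complex_of_real (c i)) * W i))"
      using j by (intro pd_sum R_mult cst_R WR) auto
    also have "\<dots> = (\<Sum>i\<in>?I. if j = i then cst (complex_of_real (c i)) else 0)"
    proof (rule sum.cong[OF refl])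
      fix i assume i: "i \<in> ?I"
      show "pd (Suc j) (cst (complex_of_real (c i)) * W i) = (if j = i then cst (complex_of_real (c i)) else 0)"
        using i j WR[OF i] pd_W[of j i] by (simp add: pd_smult)
    qed
    also have "\<dots> = pd (Suc j) f" using j top[of j] c[of j] by (cases "w j = l") (auto simp: sum.delta)
    finally show "pd (Suc j) h = 0"
      unfolding h_def using pd_diff[OF _ fR sR, of "Suc j"] j by simp
  qed (use i in auto)
  then show ?thesis using c[of i] i by simp
qed

text \<open>The model is of finite type. A partial derivative of \<open>f\<close> along a variable of maximal weight is again
  annihilated by both fields, so by induction it is constant; then \<open>f\<close> is linear in the variables of top
  weight and the nondegeneracy of the model applies.\<close>

lemma CR_antiCR_const:
  "f \<in> RW (int n) \<Longrightarrow> n > 0 \<Longrightarrow> L f = 0 \<Longrightarrow> Lb f = 0 \<Longrightarrow> f = 0"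
proof (induction n arbitrary: f rule: less_induct)
  case (less n)
  note f = less.prems
  note fR = RW_imp_R[OF f(1)]
  show ?case
  proof (rule ccontr)
    assume nz: "f \<noteq> 0"
    define I where "I = {j\<in>{1..k}. pd (Suc j) f \<noteq> 0}"
    have "I \<noteq> {}"
    proof
      assume e: "I = {}"
      have u: "pd (Suc j) f = 0" if "j \<in> {1..k}" for j using e that by (auto simp: I_def)
      have "Lb f = pd 1 f" "L f = pd 0 f"
        unfolding der_expand[OF der_Lb fR] der_expand[OF der_L fR] by (simp_all add: sum_gens u Lb_xv L_xv)
      then have "pd g f = 0" if "g \<le> k + 1" for g using that by (rule_tac gens_cases) (use u f in auto)
      then show False using RW_const_pd[OF f(1)] f(2) nz by auto
    qed
    moreover have "finite I" by (simp add: I_def)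
    ultimately have "Max (w ` I) \<in> w ` I" by (intro Max_in) auto
    then obtain i where iI: "i \<in> I" and "Max (w ` I) = w i" by auto
    then have mx: "w j \<le> w i" if "j \<in> I" for j
      using Max_ge[of "w ` I" "w j"] \<open>finite I\<close> that by auto
    have i: "1 \<le> i" "i \<le> k" and ne: "pd (Suc i) f \<noteq> 0" using iI by (auto simp: I_def)
    have top: "pd (Suc j) f = 0" if "1 \<le> j" "j \<le> k" "w i < w j" for j
      using mx[of j] that by (auto simp: I_def)
    have k: "Lb (pd (Suc i) f) = 0" "L (pd (Suc i) f) = 0"
    proof -
      have c: "Lb (xv 0) = cst 0" "Lb (xv 1) = cst 1" "L (xv 0) = cst 1" "L (xv 1) = cst 0"
        by (simp_all add: Lb_xv L_xv)
      show "Lb (pd (Suc i) f) = 0" by (rule comm_pd[OF wd_Lb c(1,2) fR f(4) i top])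
      show "L (pd (Suc i) f) = 0" by (rule comm_pd[OF wd_L c(3,4) fR f(3) i top])
    qed
    have pw: "pd (Suc i) f \<in> RW (int n - int (w i))" using pd_RW[OF f(1), of "Suc i"] i by auto
    consider "n < w i" | "n > w i" | "n = w i" by linarith
    then show False
    proof cases
      case 1 then show ?thesis using RW_neg[OF pw] ne by auto
    next
      case 2
      then have "pd (Suc i) f = 0" using less.IH[of "n - w i" "pd (Suc i) f"] pw k w_ge2[OF i] by (auto simp: of_nat_diff)
      then show ?thesis using ne by auto
    next
      case 3
      have cf: "cj f \<in> R" "cj f \<in> RW (int n)" using fR f by (auto intro: R_cj RW_cj)
      have Lc: "Lb (cj f) = 0" using f by (simp add: Lb_cj)
      have pc: "pd (Suc j) (cj f) = 0" if "1 \<le> j" "j \<le> k" "w i < w j" for j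
        using pd_cj[of "Suc j" f] fR that top[of j] by auto
      \<comment> \<open>\<open>real_CR_no_linear\<close> concerns real functions, so it is applied
        to the real and imaginary parts of \<open>f\<close>. Both are CR since \<open>L\<close>
        annihilates \<open>f\<close> as well.\<close>
      have "pd (Suc i) (f + cj f) = 0"
        by (rule real_CR_no_linear[of _ n])
          (use f fR cf i 3 top pc Lc in \<open>auto simp: cj_add RW_add pd_add der_add[OF der_Lb]\<close>)
      moreover have "pd (Suc i) (cst \<i> * (f - cj f)) = 0"
      proof (rule real_CR_no_linear[of _ n])
        show "cst \<i> * (f - cj f) \<in> RW (int n)" using f cf by (intro RW_smult RW_diff) auto
        show "cj (cst \<i> * (f - cj f)) = cst \<i> * (f - cj f)"
          by (simp add: cj_diff cj_mult cst_minus algebra_simps)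
        show "Lb (cst \<i> * (f - cj f)) = 0"
          using der_diff[OF der_Lb fR cf(1)] Lc f by (simp add: der_smult[OF der_Lb])
        show "pd (Suc j) (cst \<i> * (f - cj f)) = 0" if "1 \<le> j" "j \<le> k" "n < w j" for j
          using that 3 top[of j] pc[of j] pd_diff[OF _ fR cf(1), of "Suc j"] pd_smult[OF _ R_diff[OF fR cf(1)], of "Suc j"]
          by simp
      qed (use i 3 in auto)
      ultimately have "pd (Suc i) f + pd (Suc i) (cj f) = 0" "cst \<i> * (pd (Suc i) f - pd (Suc i) (cj f)) = 0"
        using i fR cf by (auto simp: pd_add pd_smult pd_diff R_diff)
      then have "pd (Suc i) f = 0" by (auto simp: fun_eq_iff fun_apply)
      then show ?thesis using ne by auto
    qed
  qed
qed

text \<open>By induction on weight \<open>D (\<Phi> i) = 0\<close>, so \<open>D (W i)\<close> equals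
  the value of \<open>D\<close> on the real variable. It is real and CR, hence annihilated by both
  fields, and finite type leaves only constants, which are excluded by \<open>u\<close>.\<close>

lemma aut_eqI0:
  assumes D: "aut j D" "D (xv 0) = 0" and u: "\<And>i. 1 \<le> i \<Longrightarrow> i \<le> k \<Longrightarrow> int (w i) + j = 0 \<Longrightarrow> D (xv (Suc i)) = 0"
  shows "D = (\<lambda>_. 0)"
proof (rule der_ext[OF aut_der[OF D(1)] der_zero])
  note dD = aut_der[OF D(1)]
  have one: "D (xv 1) = 0" using aut_cj[OF D(1), of "xv 0"] D(2) by (simp add: cj_xv)
  have U: "D (xv (Suc i)) = 0" if "1 \<le> i" "i \<le> k" for i
    using that
  proof (induction "w i" arbitrary: i rule: less_induct)
    case less
    have "D (\<Phi> i) = 0"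
      unfolding Phi_expand[OF dD less(2,3)] using one D(2) less(1) by (auto intro!: sum.neutral)
    then have e: "D (W i) = D (xv (Suc i))" using der_W[OF dD less(2,3)] by simp
    have Lb0: "Lb (D (xv (Suc i))) = 0" using D(1) less(3) e by (auto simp: aut_def)
    have r: "cj (D (xv (Suc i))) = D (xv (Suc i))" using aut_cj[OF D(1), of "xv (Suc i)"] less by (simp add: cj_xv)
    have L0: "L (D (xv (Suc i))) = 0" using Lb0 r by (simp add: L_def cjd_def)
    have rw: "D (xv (Suc i)) \<in> RW (int (w i) + j)" using wd_RW[OF aut_wd[OF D(1)] RW_xv[of "Suc i"]] less by auto
    consider "int (w i) + j < 0" | "int (w i) + j = 0" | "int (w i) + j > 0" by linarith
    then show ?case
    proof cases
      case 1 then show ?thesis using RW_neg[OF rw] by simp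
    next
      case 2 then show ?thesis using u less by simp
    next
      case 3 then show ?thesis using CR_antiCR_const[of _ "nat (int (w i) + j)"] rw Lb0 L0 by auto
    qed
  qed
  fix g assume "g \<le> k + 1"
  then show "D (xv g) = 0" by (rule gens_cases) (use U one D in auto)
qed

text \<open>The values on the real variables are found weight by weight: given those of smaller
  weight, \<open>D (\<Phi> i)\<close> is a known real polynomial of weight
  \<open>w i - m < \<rho>\<close>, hence the imaginary part of a CR polynomial, whose real part is
  the next value. In weight 0 the value may be any real constant. A nonzero \<open>c0\<close> fits
  the weight only for \<open>m = 1\<close>.\<close>

lemma aut_extend:
  assumes m: "m \<ge> 1" and c0: "m \<noteq> 1 \<Longrightarrow> c0 = 0"
  shows "\<exists>D. aut (- int m) D \<and> D (xv 0) = cst c0 \<and>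
    (\<forall>i\<in>{1..k}. w i = m \<longrightarrow> D (xv (Suc i)) = cst (complex_of_real (a i)))"
proof -
  \<comment> \<open>\<open>F V i\<close> is what \<open>D (\<Phi> i)\<close> will be when
    \<open>D\<close> takes the values \<open>V\<close> on the real variables.\<close>
  define F where "F V i = cst c0 * pd 0 (\<Phi> i) + (cst (cnj c0) * pd 1 (\<Phi> i) +
      (\<Sum>j\<in>{j\<in>{1..k}. w j < w i}. V (Suc j) * pd (Suc j) (\<Phi> i)))" for V i
  define good where "good V i \<longleftrightarrow> V (Suc i) \<in> RW (int (w i) - int m) \<and> cj (V (Suc i)) = V (Suc i) \<and>
    (w i = m \<longrightarrow> V (Suc i) = cst (complex_of_real (a i))) \<and>
    (\<exists>h. h \<in> RW (int (w i) - int m) \<and> Lb h = 0 \<and> h = V (Suc i) + cst \<i> * F V i)" for V i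
  have F_cong: "F V i = F V' i" if "\<And>j. 1 \<le> j \<Longrightarrow> j \<le> k \<Longrightarrow> w j < w i \<Longrightarrow> V (Suc j) = V' (Suc j)" for V V' i
    unfolding F_def using that by (auto intro!: arg_cong2[where f = "(+)"] sum.cong)
  have step: "\<exists>v. v \<in> RW (int l - int m) \<and> cj v = v \<and> (l = m \<longrightarrow> v = cst (complex_of_real b)) \<and>
      v + cst \<i> * f \<in> RW (int l - int m) \<and> Lb (v + cst \<i> * f) = 0"
    if f: "f \<in> RW (int l - int m)" "cj f = f" and l: "l \<le> \<rho>" for l f b
  proof -
    consider "l < m" | "l = m" | "l > m" by linarith
    then show ?thesis
    proof cases
      case 1 then have "f = 0" using RW_neg[OF f(1)] by auto
      then show ?thesis using 1 by (intro exI[of _ 0]) (auto simp: RW_0 der_0[OF der_Lb])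
    next
      case 2 then obtain c where c: "f = cst c" using RW_zero f(1) by auto
      show ?thesis using 2 unfolding c cst_mult[symmetric] cst_add[symmetric]
        by (intro exI[of _ "cst (complex_of_real b)"])
          (auto simp: RW_cst der_cst[OF der_Lb] cst_mult[symmetric] cst_add[symmetric])
    next
      case 3
      have "f \<in> RW (int (l - m))" using f 3 by (simp add: of_nat_diff)
      from real_is_Im[OF this f(2)] obtain h where h: "h \<in> RW (int (l - m))" "Lb h = 0" "\<And>p. Im (h p) = Re (f p)"
        using l 3 m by force
      have fr: "Im (f p) = 0" for p using fun_cong[OF f(2), of p] by (simp add: cj_apply complex_eq_iff)
      \<comment> \<open>Since \<open>f\<close> is the imaginary part of \<open>h\<close>, this is
        the real part of \<open>h\<close>, written so that its weight is visible.\<close>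
      define v where "v = h - cst \<i> * f"
      have "cj v = v" unfolding v_def
        by (rule ext) (use h(3) fr in \<open>auto simp: fun_apply complex_eq_iff\<close>)
      moreover have "v + cst \<i> * f = h" by (simp add: v_def)
      moreover have "v \<in> RW (int (l - m))" unfolding v_def using h f 3 by (auto intro!: RW_diff RW_smult simp: of_nat_diff)
      ultimately show ?thesis using h 3 by (intro exI[of _ v]) (auto simp: of_nat_diff)
    qed
  qed
  have Fgood: "F V i \<in> RW (int (w i) - int m) \<and> cj (F V i) = F V i"
    if i: "1 \<le> i" "i \<le> k" and V: "\<And>j. 1 \<le> j \<Longrightarrow> j \<le> k \<Longrightarrow> w j < w i \<Longrightarrow> good V j" for V i
  proof
    have c: "cst c0 * pd 0 (\<Phi> i) \<in> RW (int (w i) - int m)" "cst (cnj c0) * pd 1 (\<Phi> i) \<in> RW (int (w i) - int m)"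
      using c0 pd_RW[OF Phi_RW[OF i], of 0] pd_RW[OF Phi_RW[OF i], of 1]
      by (cases "m = 1"; auto intro: RW_smult RW_0)+
    have "V (Suc j) * pd (Suc j) (\<Phi> i) \<in> RW (int (w i) - int m)" if j: "j \<in> {j\<in>{1..k}. w j < w i}" for j
      using RW_mult[OF _ pd_RW[OF Phi_RW[OF i], of "Suc j"], of "V (Suc j)" "int (w j) - int m"] V[of j] j
      by (auto simp: good_def)
    then show "F V i \<in> RW (int (w i) - int m)" unfolding F_def by (intro RW_add c RW_sum)
    have "cj (V (Suc j) * pd (Suc j) (\<Phi> i)) = V (Suc j) * pd (Suc j) (\<Phi> i)" if j: "j \<in> {j\<in>{1..k}. w j < w i}" for j
      using pd_cj[OF _ Phi_R[OF i], of "Suc j"] V[of j] j Phi_real[OF i] by (auto simp: good_def cj_mult)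
    then have "cj (\<Sum>j\<in>{j\<in>{1..k}. w j < w i}. V (Suc j) * pd (Suc j) (\<Phi> i)) = (\<Sum>j\<in>{j\<in>{1..k}. w j < w i}. V (Suc j) * pd (Suc j) (\<Phi> i))"
      unfolding cj_sum by (rule sum.cong[OF refl])
    then show "cj (F V i) = F V i"
      using pd_cj[OF _ Phi_R[OF i], of 0] pd_cj[OF _ Phi_R[OF i], of 1] Phi_real[OF i]
      unfolding F_def by (simp add: cj_add cj_mult add_ac)
  qed
  \<comment> \<open>The values of one weight are chosen at a time, because the next ones depend on
    them through \<open>F\<close>.\<close>
  have "\<exists>V. \<forall>i\<in>{1..k}. w i \<le> n \<longrightarrow> good V i" for n
  proof (induction n)
    case 0
    have "\<not> w i \<le> 0" if "i \<in> {1..k}" for i using w_ge2[of i] that by auto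
    then show ?case by blast
  next
    case (Suc n)
    then obtain V where V: "\<And>i. i \<in> {1..k} \<Longrightarrow> w i \<le> n \<Longrightarrow> good V i" by blast
    have "\<exists>v. v \<in> RW (int (w i) - int m) \<and> cj v = v \<and> (w i = m \<longrightarrow> v = cst (complex_of_real (a i))) \<and>
      v + cst \<i> * F V i \<in> RW (int (w i) - int m) \<and> Lb (v + cst \<i> * F V i) = 0" if i: "i \<in> {1..k}" "w i = Suc n" for i
    proof (rule step)
      have "F V i \<in> RW (int (w i) - int m) \<and> cj (F V i) = F V i" using i V by (intro Fgood) auto
      then show "F V i \<in> RW (int (w i) - int m)" "cj (F V i) = F V i" by auto
    qed (use w_le[of i] i in auto)
    then obtain v where v: "\<And>i. i \<in> {1..k} \<Longrightarrow> w i = Suc n \<Longrightarrow> v i \<in> RW (int (w i) - int m) \<and> cj (v i) = v i \<and>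
      (w i = m \<longrightarrow> v i = cst (complex_of_real (a i))) \<and>
      v i + cst \<i> * F V i \<in> RW (int (w i) - int m) \<and> Lb (v i + cst \<i> * F V i) = 0" by metis
    \<comment> \<open>\<open>V\<close> is indexed by generators, so the variable of index
      \<open>i\<close> sits at \<open>Suc i\<close>. The entries 0 and 1, belonging to
      \<open>z\<close> and \<open>cnj z\<close>, are overwritten in \<open>U\<close>.\<close>
    define V' where "V' g = (if w (g - 1) = Suc n then v (g - 1) else V g)" for g
    have FV: "F V' i = F V i" if "w i \<le> Suc n" for i using that by (intro F_cong) (auto simp: V'_def)
    have "good V' i" if i: "i \<in> {1..k}" "w i \<le> Suc n" for i
    proof (cases "w i = Suc n")
      case True then show ?thesis using v[OF i(1)] FV[of i] by (auto simp: good_def V'_def)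
    next
      case False then show ?thesis using V[OF i(1)] FV[of i] i by (auto simp: good_def V'_def)
    qed
    then show ?case by blast
  qed
  from this[of \<rho>] obtain V where "\<forall>i\<in>{1..k}. w i \<le> \<rho> \<longrightarrow> good V i" by blast
  then have V: "\<And>i. i \<in> {1..k} \<Longrightarrow> good V i" using w_le by auto
  define U where "U g = (if g = 0 then cst c0 else if g = 1 then cst (cnj c0) else V g)" for g
  have U: "mk U (xv g) = U g" if "g \<le> k + 1" for g by (rule mk_xv[OF that])
  have dU: "der (mk U)"
  proof (rule der_mk)
    fix g assume "g \<le> k + 1" then show "U g \<in> R"
      by (rule gens_cases) (use V in \<open>auto simp: U_def good_def intro: RW_imp_R\<close>)
  qed
  have Usuc: "U (Suc i) = V (Suc i)" if "1 \<le> i" for i using that by (auto simp: U_def)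
  have dP: "mk U (\<Phi> i) = F V i" if i: "1 \<le> i" "i \<le> k" for i
    unfolding Phi_expand[OF dU i] F_def U[OF le0] U[OF le_add2]
    by (auto simp: U Usuc intro!: arg_cong2[where f = "(+)"] sum.cong) (auto simp: U_def)
  have "aut (- int m) (mk U)"
    unfolding aut_def
  proof (intro conjI allI impI)
    show "wd (- int m) (mk U)"
    proof (rule wdI[OF dU])
      fix g assume g: "g \<le> k + 1"
      show "mk U (xv g) \<in> RW (int (gw g) + - int m)"
        unfolding U[OF g] using g
        by (rule gens_cases) (use V c0 m in \<open>cases "m = 1"; auto simp: U_def good_def RW_cst RW_0\<close>)+
    qed
    show "cjd (mk U) = mk U"
      by (rule real_der[OF dU]) (use V in \<open>auto simp: U Usuc good_def\<close>, simp add: U_def)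
    fix i assume i: "i \<le> k"
    show "Lb (mk U (W i)) = 0"
    proof (cases "i = 0")
      case True then show ?thesis by (simp add: W_0 U) (simp add: U_def der_cst[OF der_Lb])
    next
      case False
      then have i': "1 \<le> i" "i \<le> k" using i by auto
      then show ?thesis using V[of i] der_W[OF dU i'] dP[OF i'] by (auto simp: U Usuc good_def)
    qed
  qed
  moreover have "mk U (xv 0) = cst c0" by (simp add: U) (simp add: U_def)
  moreover have "\<forall>i\<in>{1..k}. w i = m \<longrightarrow> mk U (xv (Suc i)) = cst (complex_of_real (a i))"
    using V by (auto simp: U Usuc good_def)
  ultimately show ?thesis by blast
qed

text \<open>\<open>P\<close> and \<open>Q\<close> commute with \<open>L\<close> and
  \<open>Lb\<close>, so \<open>L f\<close> and \<open>Lb f\<close> satisfy the same hypotheses in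
  weight \<open>n - 1\<close>; by induction they vanish and finite type applies. Weight 1 is done by
  hand, since in weight 0 constants are annihilated too.\<close>

lemma transitive_const:
  assumes P: "aut (-1) P" "P (xv 0) = 1" and Q: "aut (-1) Q" "Q (xv 0) = cst \<i>"
  shows "f \<in> RW (int n) \<Longrightarrow> n > 0 \<Longrightarrow> P f = 0 \<Longrightarrow> Q f = 0 \<Longrightarrow> f = 0"
proof (induction n arbitrary: f rule: less_induct)
  case (less n)
  note f = less.prems
  have P': "P (xv 0) = cst 1" using P by simp
  show ?case
  proof (cases "n = 1")
    case True
    then have "f \<in> RW 1" using f(1) by simp
    then obtain a b where ab: "f = cst a * xv 0 + cst b * xv 1" using RW_1_linear by blast
    have 1: "P (xv 1) = 1" "Q (xv 1) = cst (-\<i>)"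
      using aut_cj[OF P(1), of "xv 0"] aut_cj[OF Q(1), of "xv 0"] P Q by (simp_all add: cj_xv)
    have R: "xv 0 \<in> R" "xv 1 \<in> R" by (auto intro: R_xv)
    have "P f = cst (a + b)" "Q f = cst (\<i> * a - \<i> * b)"
      unfolding ab using P Q 1 R aut_der[OF P(1)] aut_der[OF Q(1)]
      by (simp_all add: der_add der_smult R_mult cst_add cst_diff cst_minus cst_mult algebra_simps)
    then have "a + b = 0" "a - b = 0" using f(3,4) by (auto simp: right_diff_distrib[symmetric] simp flip: cst_diff)
    then have "a = 0" "b = 0" by (auto simp: add_eq_0_iff)
    then show ?thesis using ab by simp
  next
    case False
    then have n: "n - 1 < n" "n - 1 > 0" using f(2) by auto
    have w: "Lb f \<in> RW (int (n - 1))" "L f \<in> RW (int (n - 1))"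
      using wd_RW[OF wd_Lb f(1)] wd_RW[OF wd_L f(1)] f(2) by (simp_all add: of_nat_diff)
    have "P (Lb f) = 0" "Q (Lb f) = 0" "P (L f) = 0" "Q (L f) = 0"
      using aut_comm[OF P(1) P', of f] aut_comm[OF Q, of f] f by (simp_all add: der_0[OF der_Lb] der_0[OF der_L])
    then have "Lb f = 0" "L f = 0" using less.IH[OF n(1) w(1) n(2)] less.IH[OF n(1) w(2) n(2)] by auto
    then show ?thesis using CR_antiCR_const[OF f(1,2)] by simp
  qed
qed

end

section \<open>Linearity and Jacobi identity for brackets\<close>

context wcoords
begin

lemma br_lin_right: assumes "der H" "der D1" "der D2"
  shows "br H (\<lambda>f. cst a * D1 f + cst b * D2 f) f = cst a * br H D1 f + cst b * br H D2 f"
proof (cases "f \<in> R")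
  case True
  then have "D1 f \<in> R" "D2 f \<in> R" using der_R assms by blast+
  then show ?thesis using assms(1)
    by (simp add: br_def der_add R_mult der_smult) (simp add: algebra_simps)
qed (use assms in \<open>simp add: br_def der_out der_0\<close>)

lemma br_anti: "br X Y f = - br Y X f" by (simp add: br_def)

lemma br_lin_left: assumes "der H" "der D1" "der D2"
  shows "br (\<lambda>f. cst a * D1 f + cst b * D2 f) H f = cst a * br D1 H f + cst b * br D2 H f"
  using br_lin_right[OF assms, of a b f] br_anti[of _ H f] by (simp add: algebra_simps)

lemma br_smult_right: assumes "der H" shows "br H (\<lambda>f. cst a * D f) f = cst a * br H D f"
  using assms by (simp add: br_def der_smult right_diff_distrib)

lemma br_smult_left: assumes "der H" shows "br (\<lambda>f. cst a * D f) H f = cst a * br D H f"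
  using assms by (simp add: br_def der_smult right_diff_distrib)

lemma br_jacobi: assumes "der X" "der Y" "der Z"
  shows "br X (br Y Z) f = br (br X Y) Z f + br Y (br X Z) f"
proof (cases "f \<in> R")
  case True
  have "X f \<in> R" "Y f \<in> R" "Z f \<in> R" using der_R assms True by blast+
  moreover from this have "X (Y f) \<in> R" "X (Z f) \<in> R" "Y (X f) \<in> R" "Y (Z f) \<in> R" "Z (X f) \<in> R" "Z (Y f) \<in> R"
    using der_R assms by blast+
  ultimately show ?thesis using assms by (simp add: br_def der_diff)
qed (use assms in \<open>simp add: br_def der_out der_0\<close>)

section \<open>Vanishing of the positive part\<close>

text \<open>As in the representation theory of \<open>sl\<^sub>2\<close>: bracketing with \<open>X\<close> moves down the string \<open>S n = (ad e)\<^sup>n (S 0)\<close> of eigenvectors of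
  \<open>[X, e]\<close>. Since long strings vanish for weight reasons, some coefficient has to be \<open>0\<close>.\<close>

lemma br_string:
  assumes d: "der X" "der e" "\<And>n. der (S n)"
    and S: "\<And>n. S (Suc n) = br e (S n)"
    and He: "\<And>f. br (br X e) e f = cst a * e f" and HS: "\<And>f. br (br X e) (S 0) f = cst b * S 0 f"
    and c: "\<And>f. br X (S 1) f = cst c * S 0 f"
  shows "br X (S (Suc n)) f = cst (c + of_nat n * b + a * (of_nat n * (of_nat n + 1) / 2)) * S n f"
proof -
  have dH: "der (br X e)" by (rule der_br[OF d(1,2)])
  have HSn: "br (br X e) (S n) f = cst (b + of_nat n * a) * S n f" for n f
  proof (induction n arbitrary: f)
    case (Suc n)
    have e1: "br (br X e) e = (\<lambda>f. cst a * e f)" "br (br X e) (S n) = (\<lambda>f. cst (b + of_nat n * a) * S n f)"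
      by (auto intro!: ext He Suc)
    have "br (br X e) (S (Suc n)) f = cst a * br e (S n) f + cst (b + of_nat n * a) * br e (S n) f"
      unfolding S br_jacobi[OF dH d(2,3)] e1 br_smult_left[OF d(3)] br_smult_right[OF d(2)] ..
    then show ?case by (simp add: S cst_add cst_mult algebra_simps)
  qed (simp add: HS)
  show ?thesis
  proof (induction n arbitrary: f)
    case (Suc n)
    let ?c = "\<lambda>n. c + of_nat n * b + a * (of_nat n * (of_nat n + 1) / 2)"
    have e1: "br X (S (Suc n)) = (\<lambda>f. cst (?c n) * S n f)" by (rule ext) (rule Suc)
    have "br X (S (Suc (Suc n))) f = br X (br e (S (Suc n))) f" by (simp add: S)
    also have "\<dots> = cst (b + of_nat (Suc n) * a) * S (Suc n) f + cst (?c n) * br e (S n) f"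
      unfolding br_jacobi[OF d] HSn e1 br_smult_right[OF d(2)] ..
    also have "\<dots> = cst (b + of_nat (Suc n) * a + ?c n) * S (Suc n) f" by (simp add: S cst_add algebra_simps)
    also have "b + of_nat (Suc n) * a + ?c n = ?c (Suc n)" by (simp add: field_simps)
    finally show ?case .
  qed (use c in \<open>simp add: One_nat_def\<close>)
qed

text \<open>If \<open>S l\<close> is the last nonzero term from \<open>m\<close> on, bracketing
  \<open>X\<close> with \<open>S (Suc l) = 0\<close> gives \<open>c l * S l = 0\<close>.\<close>

lemma br_string_stops:
  assumes str: "\<And>n f. br X (S (Suc n)) f = cst (c n) * S n f" and d: "der X"
    and N: "S N = (\<lambda>_. 0)" and m: "S m \<noteq> (\<lambda>_. 0)" "m \<le> N"
  shows "\<exists>n\<ge>m. c n = 0"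
proof -
  define n where "n = (LEAST n. n > m \<and> S n = (\<lambda>_. 0))"
  have "N > m" using N m by (cases "N = m") auto
  then have n: "n > m" "S n = (\<lambda>_. 0)" using LeastI[of "\<lambda>n. n > m \<and> S n = (\<lambda>_. 0)" N] N by (auto simp: n_def)
  obtain l where l: "n = Suc l" using n(1) by (cases n) auto
  have "S l \<noteq> (\<lambda>_. 0)"
  proof
    assume "S l = (\<lambda>_. 0)"
    moreover have "\<not> (l > m \<and> S l = (\<lambda>_. 0))"
      by (rule not_less_Least) (use l in \<open>simp add: n_def[symmetric]\<close>)
    ultimately show False using n l m by (cases "l = m") auto
  qed
  then obtain f where f: "S l f \<noteq> 0" by auto
  have "cst (c l) * S l f = 0" using str[of l f] n l by (simp add: br_def der_0[OF d])
  then have "c l = 0" using f by (auto simp: fun_eq_iff fun_apply)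
  then show ?thesis using n l by (intro exI[of _ l]) auto
qed

end

section \<open>The algebra generated in weight -1\<close>

text \<open>\<open>P\<close> and \<open>Q\<close> are to be the extensions of the real translations
  in \<open>z\<close>. The weights 2 and 3 of the first two variables are how length at least 3
  enters.\<close>

locale cr_rigid = cr_model +
  fixes P Q :: "pfun \<Rightarrow> pfun"
  assumes P: "aut (-1) P" "P (xv 0) = 1" and Q: "aut (-1) Q" "Q (xv 0) = cst \<i>"
    and k2: "k \<ge> 2" and w12: "w 1 = 2" "w 2 = 3" and w3: "\<And>j. 2 \<le> j \<Longrightarrow> j \<le> k \<Longrightarrow> w j \<ge> 3"
begin

lemma xv01_R: "xv 0 \<in> R" "xv 1 \<in> R" by (auto intro: R_xv)

lemma P1: "P (xv 1) = 1" and Q1: "Q (xv 1) = cst (-\<i>)"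
  using aut_cj[OF P(1), of "xv 0"] aut_cj[OF Q(1), of "xv 0"] P Q by (simp_all add: cj_xv)

lemma holomorphic_RW1: assumes "f \<in> RW 1" "Lb f = 0" shows "\<exists>a. f = cst a * xv 0"
proof -
  obtain a b where ab: "f = cst a * xv 0 + cst b * xv 1" using RW_1_linear[OF assms(1)] by blast
  have "Lb f = cst b" unfolding ab using xv01_R by (simp add: der_add[OF der_Lb] der_smult[OF der_Lb] R_mult Lb_xv)
  then have "b = 0" using assms(2) by simp
  then show ?thesis using ab by auto
qed

text \<open>After subtracting a multiple of \<open>W 1\<close>, no real variable is left. The
  antiholomorphic field then acts as the derivative along \<open>cnj z\<close>, and only the square
  of \<open>z\<close> survives.\<close>

lemma holomorphic_RW2: assumes f: "f \<in> RW 2" "Lb f = 0" shows "\<exists>a b. f = cst a * W 1 + cst b * (xv 0 * xv 0)"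
proof -
  have "pd (Suc 1) f \<in> RW 0" using pd_RW[OF f(1), of "Suc 1"] k2 w12 gw_simps(4)[of 1] by simp
  then obtain a where a: "pd (Suc 1) f = cst a" using RW_zero by blast
  define g where "g = f - cst a * W 1"
  have W1: "W 1 \<in> RW 2" "W 1 \<in> R" using W_RW[of 1] W_R[of 1] k2 w12 by auto
  have fR: "f \<in> R" using f RW_imp_R by blast
  have g: "g \<in> RW 2" "g \<in> R" unfolding g_def using f W1 fR by (auto intro!: RW_diff RW_smult R_diff R_mult)
  have Lg: "Lb g = 0" unfolding g_def using fR W1 f Lb_W[of 1] k2 by (simp add: der_diff[OF der_Lb] der_smult[OF der_Lb] R_mult)
  have u: "pd (Suc j) g = 0" if j: "j \<in> {1..k}" for j
  proof (cases "j = 1")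
    case True
    then show ?thesis unfolding g_def using a fR W1 pd_W[of 1 1] k2 by (simp add: pd_diff pd_smult R_mult)
  next
    case False
    then show ?thesis using RW_neg[OF pd_RW[OF g(1), of "Suc j"]] w3[of j] j by auto
  qed
  have p1: "pd 1 g = 0" using der_expand[OF der_Lb g(2)] Lg by (simp add: sum_gens u Lb_xv)
  have "pd 0 g \<in> RW 1" using pd_RW[OF g(1), of 0] by simp
  then obtain c d where cd: "pd 0 g = cst c * xv 0 + cst d * xv 1" using RW_1_linear by blast
  have g2: "cst 2 * g = xv 0 * (cst c * xv 0 + cst d * xv 1)"
    using euler_formula[OF g(1)] by (simp add: sum_gens u p1 cd)
  then have "Lb (cst 2 * g) = cst d * xv 0"
    using xv01_R by (simp add: der_mult[OF der_Lb] der_add[OF der_Lb] der_smult[OF der_Lb] R_mult R_add Lb_xv)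
  then have "cst d * xv 0 = 0" using Lg by (simp add: der_smult[OF der_Lb])
  then have "P (cst d * xv 0) = 0" using der_0[OF aut_der[OF P(1)]] by simp
  then have "d = 0" using P by (simp add: der_smult[OF aut_der[OF P(1)]])
  then have "g = cst (c / 2) * (xv 0 * xv 0)" using g2 by (auto simp: fun_eq_iff fun_apply field_simps)
  then have "f = cst a * W 1 + cst (c / 2) * (xv 0 * xv 0)" by (simp add: g_def algebra_simps)
  then show ?thesis by blast
qed

text \<open>Complex combinations that act on \<open>z\<close> and \<open>cnj z\<close> like the two
  Wirtinger derivatives. They are no longer real but still preserve CR functions, and they are
  common eigenvectors of the fields of weight 0.\<close>

definition E :: "pfun \<Rightarrow> pfun" where "E = (\<lambda>f. cst (1/2) * P f + cst (-\<i>/2) * Q f)"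
definition Eb :: "pfun \<Rightarrow> pfun" where "Eb = (\<lambda>f. cst (1/2) * P f + cst (\<i>/2) * Q f)"

lemma wd_E: "wd (-1) E" unfolding E_def by (rule wd_comb[OF aut_wd[OF P(1)] aut_wd[OF Q(1)]])
lemma wd_Eb: "wd (-1) Eb" unfolding Eb_def by (rule wd_comb[OF aut_wd[OF P(1)] aut_wd[OF Q(1)]])
lemmas der_E = wd_der[OF wd_E] and der_Eb = wd_der[OF wd_Eb]

lemma E_xv: "E (xv 0) = 1" "E (xv 1) = 0" "Eb (xv 0) = 0" "Eb (xv 1) = 1"
  unfolding E_def Eb_def P P1 Q Q1 by (auto simp: fun_eq_iff fun_apply)

lemma P_E: "P f = E f + Eb f" and Q_E: "Q f = cst \<i> * (E f - Eb f)"
  unfolding E_def Eb_def by (auto simp: fun_eq_iff fun_apply field_simps)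

lemma E_H: assumes "f \<in> R" "Lb f = 0" shows "Lb (E f) = 0" "Lb (Eb f) = 0"
  unfolding E_def Eb_def using assms der_R[OF aut_der[OF P(1)] assms(1)] der_R[OF aut_der[OF Q(1)] assms(1)]
    aut_H[OF P(1)] aut_H[OF Q(1)]
  by (simp_all add: der_add[OF der_Lb] der_smult[OF der_Lb] R_mult)

definition F :: "pfun \<Rightarrow> pfun" where "F = br E Eb"

lemma wd_F: "wd (-2) F" unfolding F_def using wd_br[OF wd_E wd_Eb] by simp
lemmas der_F = wd_der[OF wd_F]

lemma E_const: assumes "f \<in> RW (int n)" "n > 0" "E f = 0" "Eb f = 0" shows "f = 0"
  using transitive_const[OF P Q assms(1,2)] assms(3,4) by (simp add: P_E Q_E)

lemma W12_R: "W 1 \<in> R" "W 2 \<in> R" "W 1 \<in> RW 2" "W 2 \<in> RW 3"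
  using W_R[of 1] W_R[of 2] W_RW[of 1] W_RW[of 2] k2 w12 by auto

text \<open>Otherwise \<open>Eb (W 1) = 0\<close>, and subtracting a multiple of
  \<open>z * z\<close> from \<open>W 1\<close> gives a polynomial annihilated by \<open>E\<close>
  and \<open>Eb\<close>. It vanishes by transitivity, yet its derivative along the first real
  variable is 1.\<close>

lemma F_W1: "F (W 1) \<noteq> 0"
proof
  assume F0: "F (W 1) = 0"
  have Lb1: "Lb (W 1) = 0" using Lb_W[of 1] k2 by simp
  obtain p where p: "E (W 1) = cst p * xv 0"
    using holomorphic_RW1[of "E (W 1)"] wd_RW[OF wd_E W12_R(3)] E_H[OF W12_R(1) Lb1] by auto
  obtain q where q: "Eb (W 1) = cst q * xv 0"
    using holomorphic_RW1[of "Eb (W 1)"] wd_RW[OF wd_Eb W12_R(3)] E_H[OF W12_R(1) Lb1] by auto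
  have "q = 0" using F0 by (simp add: F_def br_def p q der_smult[OF der_E] der_smult[OF der_Eb] E_xv)
  define g where "g = W 1 - cst (p/2) * (xv 0 * xv 0)"
  have x2: "xv 0 * xv 0 \<in> RW 2" "xv 0 * xv 0 \<in> R" using RW_mult[OF RW_xv[of 0] RW_xv[of 0]] xv01_R by (auto intro: R_mult)
  have "g = 0"
  proof (rule E_const[of g 2])
    show "g \<in> RW (int 2)" unfolding g_def using W12_R x2 by (auto intro!: RW_diff RW_smult)
    have "cst p * xv 0 - cst (p/2) * (xv 0 + xv 0) = 0" by (auto simp: fun_eq_iff fun_apply)
    then show "E g = 0" unfolding g_def using W12_R x2 xv01_R
      by (simp add: der_diff[OF der_E] der_smult[OF der_E] der_mult[OF der_E] R_mult p E_xv)
    show "Eb g = 0" unfolding g_def using W12_R x2 xv01_R \<open>q = 0\<close>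
      by (simp add: der_diff[OF der_Eb] der_smult[OF der_Eb] der_mult[OF der_Eb] R_mult q E_xv)
  qed simp
  have "pd (Suc 1) g = 1" unfolding g_def using W12_R x2 xv01_R k2 pd_W[of 1 1]
    by (simp add: pd_diff pd_smult R_mult pd_mult pd_xv pd_cst)
  then show False using \<open>g = 0\<close> pd_0[of "Suc 1"] k2 by (simp add: fun_eq_iff fun_apply)
qed

lemma cjd_E: "cj (E f) = Eb (cj f)" "cj (Eb f) = E (cj f)"
  unfolding E_def Eb_def by (simp_all add: cj_add cj_mult aut_cj[OF P(1)] aut_cj[OF Q(1)])

text \<open>If \<open>E\<close> commutes with \<open>F\<close>, so does \<open>Eb\<close>, by
  conjugation. Then \<open>W 2\<close> can be corrected by multiples of \<open>z * W 1\<close> and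
  of the cube of \<open>z\<close> until \<open>E\<close> and \<open>Eb\<close> annihilate it: the
  first correction kills the value under \<open>F\<close>, after which \<open>E\<close> and
  \<open>Eb\<close> can only produce multiples of \<open>z * z\<close>. Transitivity makes the
  result 0, although its derivative along the second real variable is 1.\<close>

lemma br_E_F: "br E F \<noteq> (\<lambda>_. 0)"
proof
  assume EF: "br E F = (\<lambda>_. 0)"
  have cF: "cj (F f) = - F (cj f)" for f by (simp add: F_def br_def cj_diff cjd_E)
  have EbF: "F (Eb f) = Eb (F f)" for f
  proof -
    have "br Eb F f = - cj (br E F (cj f))" by (simp add: br_def cj_diff cjd_E cF der_uminus[OF der_Eb])
    also have "br E F (cj f) = 0" by (simp add: EF)
    finally show ?thesis by (simp add: br_def)
  qed
  have EF': "F (E f) = E (F f)" for f using fun_cong[OF EF, of f] by (simp add: br_def)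
  have Lb12: "Lb (W 1) = 0" "Lb (W 2) = 0" using Lb_W[of 1] Lb_W[of 2] k2 by auto
  have F_H: "Lb (F f) = 0" if "f \<in> R" "Lb f = 0" for f
    unfolding F_def br_def using that E_H[OF that] der_R[OF der_E that(1)] der_R[OF der_Eb that(1)]
      der_R[OF der_E der_R[OF der_Eb that(1)]] der_R[OF der_Eb der_R[OF der_E that(1)]]
    by (simp add: der_diff[OF der_Lb] E_H)
  obtain \<phi> where \<phi>: "F (W 1) = cst \<phi>" using RW_zero[of "F (W 1)"] wd_RW[OF wd_F W12_R(3)] by auto
  have "\<phi> \<noteq> 0" using F_W1 \<phi> by auto
  obtain \<psi> where \<psi>: "F (W 2) = cst \<psi> * xv 0"
    using holomorphic_RW1[of "F (W 2)"] wd_RW[OF wd_F W12_R(4)] F_H[OF W12_R(2) Lb12(2)] by auto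
  have Fz: "F (xv 0) = 0" by (simp add: F_def br_def E_xv der_0[OF der_E] der_1[OF der_Eb])
  define g where "g = W 2 - cst (\<psi> / \<phi>) * (xv 0 * W 1)"
  have x: "xv 0 * W 1 \<in> RW 3" "xv 0 * W 1 \<in> R" using RW_mult[OF RW_xv[of 0] W12_R(3)] xv01_R W12_R by (auto intro: R_mult)
  have g: "g \<in> RW 3" "g \<in> R" unfolding g_def using W12_R x by (auto intro!: RW_diff RW_smult R_diff R_mult)
  have Lg: "Lb g = 0" unfolding g_def using W12_R x xv01_R
    by (simp add: der_diff[OF der_Lb] der_smult[OF der_Lb] der_mult[OF der_Lb] R_mult Lb12 Lb_xv)
  have "cst \<psi> * xv 0 - cst (\<psi> / \<phi>) * (xv 0 * cst \<phi>) = 0" using \<open>\<phi> \<noteq> 0\<close> by (auto simp: fun_eq_iff fun_apply)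
  then have Fg: "F g = 0" unfolding g_def using W12_R x xv01_R
    by (simp add: der_diff[OF der_F] der_smult[OF der_F] der_mult[OF der_F] R_mult \<phi> \<psi> Fz)
  have sq: "\<exists>b. D g = cst b * (xv 0 * xv 0)" if D: "wd (-1) D" "Lb (D g) = 0" "F (D g) = 0" for D
  proof -
    obtain a b where ab: "D g = cst a * W 1 + cst b * (xv 0 * xv 0)"
      using holomorphic_RW2[of "D g"] wd_RW[OF D(1) g(1)] D by auto
    have "F (D g) = cst (a * \<phi>)" unfolding ab using W12_R xv01_R
      by (simp add: der_add[OF der_F] der_smult[OF der_F] der_mult[OF der_F] R_mult \<phi> Fz cst_mult)
    then have "a = 0" using D(3) \<open>\<phi> \<noteq> 0\<close> by simp
    then show ?thesis using ab by auto
  qed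
  obtain b where b: "E g = cst b * (xv 0 * xv 0)" using sq[OF wd_E] E_H[OF g(2) Lg] EF' Fg by (auto simp: der_0[OF der_E])
  obtain b' where b': "Eb g = cst b' * (xv 0 * xv 0)" using sq[OF wd_Eb] E_H[OF g(2) Lg] EbF Fg by (auto simp: der_0[OF der_Eb])
  have "cst 2 * cst b' * xv 0 = E (Eb g) - Eb (E g)" unfolding b b' using xv01_R
    by (simp add: der_smult[OF der_E] der_smult[OF der_Eb] der_mult[OF der_E] der_mult[OF der_Eb] R_mult E_xv)
       (auto simp: fun_eq_iff fun_apply)
  also have "\<dots> = 0" using Fg by (simp add: F_def br_def)
  finally have "E (cst (2 * b') * xv 0) = 0" by (simp add: cst_mult der_0[OF der_E])
  then have "b' = 0" by (simp add: der_smult[OF der_E] E_xv)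
  define h where "h = g - cst (b/3) * (xv 0 * (xv 0 * xv 0))"
  have x3: "xv 0 * (xv 0 * xv 0) \<in> RW 3" "xv 0 * (xv 0 * xv 0) \<in> R" "xv 0 * xv 0 \<in> R"
    using RW_mult[OF RW_xv[of 0] RW_mult[OF RW_xv[of 0] RW_xv[of 0]]] xv01_R by (auto intro!: R_mult)
  have "h = 0"
  proof (rule E_const[of h 3])
    show "h \<in> RW (int 3)" unfolding h_def using g x3 by (auto intro!: RW_diff RW_smult)
    have "cst b * (xv 0 * xv 0) - cst (b/3) * (xv 0 * xv 0 + xv 0 * (xv 0 + xv 0)) = 0" by (auto simp: fun_eq_iff fun_apply field_simps)
    then show "E h = 0" unfolding h_def using g x3 xv01_R
      by (simp add: der_diff[OF der_E] der_smult[OF der_E] der_mult[OF der_E] R_mult b E_xv)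
    show "Eb h = 0" unfolding h_def using g x3 xv01_R \<open>b' = 0\<close>
      by (simp add: der_diff[OF der_Eb] der_smult[OF der_Eb] der_mult[OF der_Eb] R_mult b' E_xv)
  qed simp
  have "pd (Suc 2) h = 1"
    unfolding h_def g_def using W12_R x x3 xv01_R k2 w12 pd_W[of 2 1] pd_W[of 2 2]
    by (simp add: pd_diff pd_smult R_mult R_diff pd_mult pd_xv pd_cst)
  then show False using \<open>h = 0\<close> pd_0[of "Suc 2"] k2 by (simp add: fun_eq_iff fun_apply)
qed

section \<open>Fields of weight 0 and 1\<close>

text \<open>Such an operator pushes every generator into negative weight. This is the nilpotency
  that makes strings stop.\<close>

lemma wd_low: assumes "wd j D" "j < - int \<rho>" "j < -1" shows "D = (\<lambda>_. 0)"
proof (rule der_ext[OF wd_der[OF assms(1)] der_zero])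
  fix g assume g: "g \<le> k + 1"
  have "int (gw g) + j < 0" using g by (rule gens_cases) (use assms w_le in fastforce)+
  then show "D (xv g) = 0" using RW_neg[OF wd_RW[OF assms(1) RW_xv[OF g]]] by simp
qed

text \<open>The real combination of \<open>P\<close> and \<open>Q\<close> with the same value on
  \<open>z\<close> differs from \<open>D\<close> by an automorphism vanishing on \<open>z\<close>;
  no \<open>w\<close> has weight 1, so \<open>aut_eqI0\<close> makes the difference 0.\<close>

lemma aut_minus1: assumes D: "aut (-1) D" "D (xv 0) = cst c" shows "D f = cst c * E f + cst (cnj c) * Eb f"
proof -
  define D1 where "D1 = (\<lambda>f. cst (complex_of_real (Re c)) * P f + cst (complex_of_real (Im c)) * Q f)"
  have D1: "aut (-1) D1" unfolding D1_def by (rule aut_comb[OF P(1) Q(1)])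
  have "aut (-1) (\<lambda>f. cst (complex_of_real 1) * D f + cst (complex_of_real (-1)) * D1 f)"
    by (rule aut_comb[OF D(1) D1])
  then have "(\<lambda>f. cst (complex_of_real 1) * D f + cst (complex_of_real (-1)) * D1 f) = (\<lambda>_. 0)"
  proof (rule aut_eqI0)
    show "cst (complex_of_real 1) * D (xv 0) + cst (complex_of_real (-1)) * D1 (xv 0) = 0"
      by (simp add: D D1_def P Q fun_eq_iff fun_apply complex_eq_iff)
    fix i assume "1 \<le> i" "i \<le> k" "int (w i) + -1 = 0"
    then show "cst (complex_of_real 1) * D (xv (Suc i)) + cst (complex_of_real (-1)) * D1 (xv (Suc i)) = 0"
      using w_ge2[of i] by auto
  qed
  then have "cst (complex_of_real 1) * D f + cst (complex_of_real (-1)) * D1 f = 0" by (rule fun_cong)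
  then have "D f = D1 f" by (simp add: cst_minus)
  also have "\<dots> = cst (complex_of_real (Re c)) * (E f + Eb f) + cst (complex_of_real (Im c)) * (cst \<i> * (E f - Eb f))"
    by (simp only: D1_def P_E[symmetric] Q_E[symmetric])
  also have "\<dots> = cst (complex_of_real (Re c) + complex_of_real (Im c) * \<i>) * E f
      + cst (complex_of_real (Re c) - complex_of_real (Im c) * \<i>) * Eb f"
    by (simp add: cst_add cst_diff cst_mult algebra_simps)
  also have "complex_of_real (Re c) + complex_of_real (Im c) * \<i> = c" by (simp add: complex_eq_iff)
  also have "complex_of_real (Re c) - complex_of_real (Im c) * \<i> = cnj c" by (simp add: complex_eq_iff)
  finally show ?thesis .
qed

text \<open>The brackets of \<open>A\<close> with \<open>P\<close> and \<open>Q\<close> are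
  automorphisms of weight -1, hence known from their values \<open>- a\<close> and
  \<open>- \<i> * a\<close> on \<open>z\<close>.\<close>

lemma aut_0_act: assumes A: "aut 0 A" "A (xv 0) = cst a * xv 0"
  shows "br A E f = cst (-a) * E f" "br A Eb f = cst (- cnj a) * Eb f"
proof -
  note dA = aut_der[OF A(1)]
  note dP = aut_der[OF P(1)] and dQ = aut_der[OF Q(1)]
  have 1: "br A P f = cst (-a) * E f + cst (cnj (-a)) * Eb f"
    by (rule aut_minus1) (use aut_br[OF A(1) P(1)] in \<open>auto simp: br_def A P der_1[OF dA] der_smult[OF dP] cst_minus\<close>)
  have 2: "br A Q f = cst (-\<i> * a) * E f + cst (cnj (-\<i> * a)) * Eb f"
    by (rule aut_minus1) (use aut_br[OF A(1) Q(1)] in \<open>auto simp: br_def A Q der_cst[OF dA] der_smult[OF dQ] cst_minus cst_mult\<close>)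
  show "br A E f = cst (-a) * E f"
    unfolding E_def[abs_def] br_lin_right[OF dA dP dQ] 1 2 by (auto simp: E_def Eb_def fun_eq_iff fun_apply algebra_simps)
  show "br A Eb f = cst (- cnj a) * Eb f"
    unfolding Eb_def[abs_def] br_lin_right[OF dA dP dQ] 1 2 by (auto simp: E_def Eb_def fun_eq_iff fun_apply algebra_simps)
qed

text \<open>The value of \<open>X\<close> on \<open>z\<close> has positive weight and is annihilated
  by \<open>P\<close> and \<open>Q\<close>, so it is 0 by transitivity, and \<open>aut_eqI0\<close>
  gives the rest.\<close>

lemma aut_pos_commuting: assumes X: "aut j X" "j \<ge> 0" and c: "br X P = (\<lambda>_. 0)" "br X Q = (\<lambda>_. 0)"
  shows "X = (\<lambda>_. 0)"
proof (rule aut_eqI0[OF X(1)])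
  show "X (xv 0) = 0"
  proof (rule transitive_const[OF P Q, of _ "nat (j + 1)"])
    show "X (xv 0) \<in> RW (int (nat (j + 1)))"
      using wd_RW[OF aut_wd[OF X(1)] RW_xv[of 0]] X(2) by (simp add: add.commute)
    show "P (X (xv 0)) = 0" using fun_cong[OF c(1), of "xv 0"] by (simp add: br_def P der_1[OF aut_der[OF X(1)]])
    show "Q (X (xv 0)) = 0" using fun_cong[OF c(2), of "xv 0"] by (simp add: br_def Q der_cst[OF aut_der[OF X(1)]])
  qed (use X in auto)
  fix i assume "1 \<le> i" "i \<le> k" "int (w i) + j = 0"
  then show "X (xv (Suc i)) = 0" using X(2) w_ge2[of i] by auto
qed

text \<open>With \<open>[X, E]\<close> acting on \<open>E, Eb\<close> by \<open>\<alpha>, \<beta>\<close>, the string of \<open>F\<close> under \<open>E\<close> gives \<open>\<beta> = - r \<alpha>\<close> with \<open>r \<ge> 1\<close>; here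
  \<open>[E, F] \<noteq> 0\<close> is used, that is, length at least \<open>3\<close>. Then all coefficients of the string of \<open>y\<close> under
  \<open>x = cnj \<alpha> E + \<alpha> Eb\<close> are negative, which is impossible.\<close>

lemma aut_1_zero: assumes X: "aut 1 X" shows "X = (\<lambda>_. 0)"
proof -
  define A where "A = br X P"
  define B where "B = br X Q"
  have AB: "aut 0 A" "aut 0 B" using aut_br[OF X P(1)] aut_br[OF X Q(1)] by (simp_all add: A_def B_def)
  note dX = aut_der[OF X] and dA = aut_der[OF AB(1)] and dB = aut_der[OF AB(2)]
  note dP = aut_der[OF P(1)] and dQ = aut_der[OF Q(1)]
  have z: "\<exists>a. A' (xv 0) = cst a * xv 0" if "aut 0 A'" for A'
    using holomorphic_RW1[of "A' (xv 0)"] wd_RW[OF aut_wd[OF that] RW_xv[of 0]] that by (auto simp: aut_def W_0[symmetric])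
  obtain a where a: "A (xv 0) = cst a * xv 0" using z[OF AB(1)] by blast
  obtain b where b: "B (xv 0) = cst b * xv 0" using z[OF AB(2)] by blast
  \<comment> \<open>\<open>A\<close> and \<open>B\<close> multiply \<open>E\<close> by
    \<open>- a\<close> and \<open>- b\<close>, and \<open>Eb\<close> by the conjugates. So \<alpha>
    and \<beta> are the eigenvalues of \<open>br X E\<close>, which is
    \<open>(A - \<i> B) / 2\<close>, on \<open>E\<close> and on \<open>Eb\<close>; for
    \<open>br X Eb\<close> they become \<open>cnj \<beta>\<close> and
    \<open>cnj \<alpha>\<close>.\<close>
  define \<alpha> where "\<alpha> = - (a - \<i> * b) / 2"
  define \<beta> where "\<beta> = - (cnj a - \<i> * cnj b) / 2"
  have cab: "cnj \<alpha> = - (cnj a + \<i> * cnj b) / 2" "cnj \<beta> = - (a + \<i> * b) / 2" by (simp_all add: \<alpha>_def \<beta>_def)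
  have XE: "br X E = (\<lambda>f. cst (1/2) * A f + cst (-\<i>/2) * B f)" "br X Eb = (\<lambda>f. cst (1/2) * A f + cst (\<i>/2) * B f)"
    by (rule ext; simp only: E_def[abs_def] Eb_def[abs_def] br_lin_right[OF dX dP dQ] A_def B_def)+
  note dE1 = der_br[OF dX der_E] and dE2 = der_br[OF dX der_Eb]
  have E1: "br (br X E) E = (\<lambda>f. cst \<alpha> * E f)" "br (br X E) Eb = (\<lambda>f. cst \<beta> * Eb f)"
    and E2: "br (br X Eb) E = (\<lambda>f. cst (cnj \<beta>) * E f)" "br (br X Eb) Eb = (\<lambda>f. cst (cnj \<alpha>) * Eb f)"
    unfolding XE cab
    by (rule ext; simp only: br_lin_left[OF der_E dA dB] br_lin_left[OF der_Eb dA dB] aut_0_act[OF AB(1) a] aut_0_act[OF AB(2) b];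
       auto simp: \<alpha>_def \<beta>_def fun_eq_iff fun_apply field_simps)+
  define S where "S n = ((br E) ^^ n) F" for n
  have S: "S 0 = F" "S (Suc n) = br E (S n)" for n by (simp_all add: S_def)
  have wS: "wd (- int n - 2) (S n)" for n
  proof (induction n)
    case 0 then show ?case using wd_F by (simp add: S)
  next
    case (Suc n) then show ?case using wd_br[OF wd_E Suc] by (simp add: S algebra_simps)
  qed
  have BF: "br (br X E) F = (\<lambda>f. cst (\<alpha> + \<beta>) * F f)"
    unfolding F_def by (rule ext)
      (simp only: br_jacobi[OF dE1 der_E der_Eb] E1 br_smult_left[OF der_Eb] br_smult_right[OF der_E] cst_add distrib_right)
  have XF: "br X F = (\<lambda>f. cst \<beta> * Eb f + cst (- cnj \<beta>) * E f)"
    unfolding F_def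
    by (rule ext) (simp add: br_jacobi[OF dX der_E der_Eb] E1 br_anti[of E "br X Eb"] E2 cst_minus)
  have XS1: "br X (S 1) f = cst (\<alpha> + 2 * \<beta>) * F f" for f
  proof -
    have EE: "br E E f = 0" by (simp add: br_def)
    have "br X (S 1) f = br X (br E F) f" using S(2)[of 0] by (simp add: S(1) One_nat_def)
    also have "\<dots> = cst (\<alpha> + \<beta>) * F f + cst \<beta> * F f"
      unfolding br_jacobi[OF dX der_E der_F] BF XF br_lin_right[OF der_E der_Eb der_E] EE by (simp add: F_def)
    finally show ?thesis by (auto simp: fun_eq_iff fun_apply algebra_simps)
  qed
  have str1: "br X (S (Suc n)) f = cst ((\<alpha> + 2 * \<beta>) + of_nat n * (\<alpha> + \<beta>) + \<alpha> * (of_nat n * (of_nat n + 1) / 2)) * S n f" for n f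
    by (rule br_string[OF dX der_E]) (use wS wd_der E1 BF XS1 S in auto)
  have SN: "S (\<rho> + 1) = (\<lambda>_. 0)" by (rule wd_low[OF wS]) auto
  have S1: "S 1 \<noteq> (\<lambda>_. 0)" using br_E_F S(2)[of 0] S(1) by (simp add: One_nat_def)
  obtain n where n: "n \<ge> 1" "(\<alpha> + 2 * \<beta>) + of_nat n * (\<alpha> + \<beta>) + \<alpha> * (of_nat n * (of_nat n + 1) / 2) = 0"
    using br_string_stops[of X S "\<lambda>n. (\<alpha> + 2 * \<beta>) + of_nat n * (\<alpha> + \<beta>) + \<alpha> * (of_nat n * (of_nat n + 1) / 2)", OF str1 dX SN S1] by auto
  \<comment> \<open>The left-hand side of the equation for \<open>n\<close> factors as
    \<open>(n + 2) * (\<beta> + r * \<alpha>)\<close>. A string stopping already at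
    \<open>n = 0\<close> would give \<open>r = 1/2\<close>.\<close>
  define r where "r = (real n + 1) / 2"
  have "(of_nat n + 2) * (\<beta> + complex_of_real r * \<alpha>) = 0" using n(2) by (simp add: r_def field_simps)
  moreover have "(of_nat n + 2 :: complex) \<noteq> 0" by (metis of_nat_add of_nat_numeral of_nat_eq_0_iff add_is_0 zero_neq_numeral)
  ultimately have \<beta>: "\<beta> = - (complex_of_real r * \<alpha>)" by (simp add: add_eq_0_iff)
  have r: "r \<ge> 1" using n(1) by (simp add: r_def)
  have "\<alpha> = 0"
  proof (rule ccontr)
    assume nz: "\<alpha> \<noteq> 0"
    define N2 where "N2 = (norm \<alpha>)\<^sup>2"
    have N2: "N2 > 0" using nz by (simp add: N2_def)
    have aa: "\<alpha> * cnj \<alpha> = complex_of_real N2" unfolding N2_def by (rule complex_norm_square[symmetric])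
    \<comment> \<open>With \<open>\<beta> = - r * \<alpha>\<close> these coefficients make
      \<open>br X x\<close> act on \<open>E\<close> and \<open>Eb\<close> by one and the same real
      number \<open>h\<close>, which is at most 0. The field \<open>y\<close> is the complementary
      real one: \<open>br X y\<close> sends \<open>x\<close> to \<open>g * y\<close> with
      \<open>g > 0\<close>.\<close>
    define x where "x = (\<lambda>f. cst (cnj \<alpha>) * E f + cst \<alpha> * Eb f)"
    define y where "y = (\<lambda>f. cst (\<i> * cnj \<alpha>) * E f + cst (- \<i> * \<alpha>) * Eb f)"
    have wx: "wd (-1) x" "wd (-1) y" unfolding x_def y_def by (intro wd_comb wd_E wd_Eb)+
    note dx = wd_der[OF wx(1)] and dy = wd_der[OF wx(2)]
    define h where "h = N2 * (1 - r)"
    define g where "g = N2 * (1 + r)"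
    have Xx: "br X x = (\<lambda>f. cst (cnj \<alpha>) * br X E f + cst \<alpha> * br X Eb f)"
      unfolding x_def by (rule ext) (rule br_lin_right[OF dX der_E der_Eb])
    have Xy: "br X y = (\<lambda>f. cst (\<i> * cnj \<alpha>) * br X E f + cst (- \<i> * \<alpha>) * br X Eb f)"
      unfolding y_def by (rule ext) (rule br_lin_right[OF dX der_E der_Eb])
    have dXx: "der (br X x)" "der (br X y)" by (intro der_br dX dx dy)+
    have c1: "cnj \<alpha> * \<alpha> + \<alpha> * cnj \<beta> = complex_of_real h" "cnj \<alpha> * \<beta> + \<alpha> * cnj \<alpha> = complex_of_real h"
      using aa unfolding \<beta> h_def by (simp_all add: algebra_simps)
    have c2: "\<i> * cnj \<alpha> * \<alpha> + - \<i> * \<alpha> * cnj \<beta> = \<i> * complex_of_real g" "\<i> * cnj \<alpha> * \<beta> + - \<i> * \<alpha> * cnj \<alpha> = - \<i> * complex_of_real g"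
      using aa unfolding \<beta> g_def by (simp_all add: algebra_simps)
    have HE: "br (br X x) E f = cst (complex_of_real h) * E f" for f
      unfolding Xx br_lin_left[OF der_E dE1 dE2] E1 E2 c1(1)[symmetric]
      by (auto simp: fun_eq_iff fun_apply algebra_simps)
    have HEb: "br (br X x) Eb f = cst (complex_of_real h) * Eb f" for f
      unfolding Xx br_lin_left[OF der_Eb dE1 dE2] E1 E2 c1(2)[symmetric]
      by (auto simp: fun_eq_iff fun_apply algebra_simps)
    have KE: "br (br X y) E f = cst (\<i> * complex_of_real g) * E f" for f
      unfolding Xy br_lin_left[OF der_E dE1 dE2] E1 E2 c2(1)[symmetric]
      by (auto simp: fun_eq_iff fun_apply algebra_simps)
    have KEb: "br (br X y) Eb f = cst (- \<i> * complex_of_real g) * Eb f" for f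
      unfolding Xy br_lin_left[OF der_Eb dE1 dE2] E1 E2 c2(2)[symmetric]
      by (auto simp: fun_eq_iff fun_apply algebra_simps)
    have Hx: "br (br X x) x f = cst (complex_of_real h) * x f" and Hy: "br (br X x) y f = cst (complex_of_real h) * y f" for f
      using br_lin_right[OF dXx(1) der_E der_Eb, of "cnj \<alpha>" \<alpha> f] br_lin_right[OF dXx(1) der_E der_Eb, of "\<i> * cnj \<alpha>" "- \<i> * \<alpha>" f]
      by (simp_all add: x_def[symmetric] y_def[symmetric] HE HEb) (simp_all add: x_def y_def algebra_simps)
    have Kx: "br (br X y) x f = cst (complex_of_real g) * y f" for f
      using br_lin_right[OF dXx(2) der_E der_Eb, of "cnj \<alpha>" \<alpha> f]
      by (simp add: x_def[symmetric] KE KEb) (simp add: y_def cst_mult cst_minus algebra_simps)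
    define T where "T n = ((br x) ^^ n) y" for n
    have T: "T 0 = y" "T (Suc n) = br x (T n)" for n by (simp_all add: T_def)
    have wT: "wd (- int n - 1) (T n)" for n
    proof (induction n)
      case 0 then show ?case using wx by (simp add: T)
    next
      case (Suc n) then show ?case using wd_br[OF wx(1) Suc] by (simp add: T algebra_simps)
    qed
    have XT: "br X (T 1) f = cst (complex_of_real (h - g)) * y f" for f
    proof -
      have "br X (T 1) f = br X (br x y) f" using T(2)[of 0] by (simp add: T(1) One_nat_def)
      also have "\<dots> = cst (complex_of_real h) * y f - cst (complex_of_real g) * y f"
        unfolding br_jacobi[OF dX dx dy] Hy br_anti[of x "br X y"] Kx by simp
      finally show ?thesis by (simp add: cst_diff algebra_simps)
    qed
    have str2: "br X (T (Suc n)) f = cst (complex_of_real (h - g) + of_nat n * complex_of_real h + complex_of_real h * (of_nat n * (of_nat n + 1) / 2)) * T n f" for n f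
      by (rule br_string[OF dX dx]) (use wT wd_der Hx Hy XT T in auto)
    have TN: "T (\<rho> + 2) = (\<lambda>_. 0)" by (rule wd_low[OF wT]) auto
    have T0: "T 0 \<noteq> (\<lambda>_. 0)"
    proof
      assume "T 0 = (\<lambda>_. 0)"
      then have "y (xv 0) = 0" by (simp add: T)
      then show False using nz by (simp add: y_def E_xv)
    qed
    obtain m where "complex_of_real (h - g) + of_nat m * complex_of_real h + complex_of_real h * (of_nat m * (of_nat m + 1) / 2) = 0"
      using br_string_stops[of X T "\<lambda>m. complex_of_real (h - g) + of_nat m * complex_of_real h + complex_of_real h * (of_nat m * (of_nat m + 1) / 2)", OF str2 dX TN T0] by auto
    then have "complex_of_real (h - g + real m * h + h * (real m * (real m + 1) / 2)) = complex_of_real 0" by simp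
    then have "h - g + real m * h + h * (real m * (real m + 1) / 2) = 0" unfolding of_real_eq_iff .
    moreover have "h \<le> 0" "g > 0" using N2 r by (auto simp: h_def g_def mult_le_0_iff)
    moreover have "real m * h \<le> 0" "h * (real m * (real m + 1) / 2) \<le> 0" using \<open>h \<le> 0\<close> by (auto simp: mult_le_0_iff)
    ultimately show False by linarith
  qed
  then have "a - \<i> * b = 0" "cnj (cnj a - \<i> * cnj b) = 0" using \<beta> by (auto simp: \<alpha>_def \<beta>_def)
  then have "a - \<i> * b = 0" "a + \<i> * b = 0" by auto
  then have "a = 0" "b = 0" by (auto simp: add_eq_0_iff)
  have w0: "int (w i) + 0 \<noteq> 0" if "1 \<le> i" "i \<le> k" for i using w_ge2[OF that] by auto
  have "A = (\<lambda>_. 0)" by (rule aut_eqI0[OF AB(1)]) (use a \<open>a = 0\<close> in simp, use w0 in blast)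
  moreover have "B = (\<lambda>_. 0)" by (rule aut_eqI0[OF AB(2)]) (use b \<open>b = 0\<close> in simp, use w0 in blast)
  ultimately
  show ?thesis using aut_pos_commuting[OF X] by (simp add: A_def B_def)
qed

theorem aut_pos_zero: "aut (int n) X \<Longrightarrow> n \<ge> 1 \<Longrightarrow> X = (\<lambda>_. 0)"
proof (induction n arbitrary: X)
  case (Suc n)
  show ?case
  proof (cases "n = 0")
    case True then show ?thesis using aut_1_zero Suc.prems by simp
  next
    case False
    have "br X P = (\<lambda>_. 0)" "br X Q = (\<lambda>_. 0)"
      using Suc.IH[of "br X P"] Suc.IH[of "br X Q"] aut_br[OF Suc.prems(1) P(1)] aut_br[OF Suc.prems(1) Q(1)] False by auto
    then show ?thesis using aut_pos_commuting[OF Suc.prems(1)] by simp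
  qed
qed simp

end

section \<open>Beloshapka models\<close>

text \<open>Full row rank provides \<open>m\<close> independent columns, that is, an invertible
  square submatrix \<open>B\<close>; the vector \<open>c\<close> lies in the kernel of its
  transpose.\<close>

lemma sum_left_kernel_full_row_rank:
  fixes A :: "real mat"
  assumes A: "A \<in> carrier_mat m n" and A_last_rank: "vec_space.rank m A = m"
    and c: "\<And>j. j < n \<Longrightarrow> (\<Sum>i<m. c i * A $$ (i, j)) = 0" and i: "i < m"
  shows "c i = 0"
proof -
  interpret vec_space "TYPE(real)" m .
  obtain S where S: "maximal S (\<lambda>T. T \<subseteq> set (cols A) \<and> lin_indpt T)"
    using maximal_exists_superset[of "set (cols A)" "\<lambda>T. T \<subseteq> set (cols A) \<and> lin_indpt T" "{}"]
    by (meson List.finite_set empty_subsetI finite_lin_indpt2 finite.emptyI empty_iff)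
  then have SA: "S \<subseteq> set (cols A)" "lin_indpt S" by (auto simp: maximal_def)
  have "finite S" using SA finite_subset by blast
  have "card S = m" using rank_card_indpt[OF A S] A_last_rank by simp
  obtain xs where xs: "set xs = S" "distinct xs" using finite_distinct_list[OF \<open>finite S\<close>] by blast
  have len: "length xs = m" using xs \<open>card S = m\<close> distinct_card by fastforce
  have xc: "set xs \<subseteq> carrier_vec m" using SA xs cols_dim[of A] A by auto
  define B where "B = mat_of_cols m xs"
  have B: "B \<in> carrier_mat m m" using len by (auto simp: B_def)
  have cB: "cols B = xs" unfolding B_def by (rule cols_mat_of_cols[OF xc])
  have "det B \<noteq> 0" using lin_indpt_full_rank[OF B] cB xs SA det_rank_iff[OF B] by simp
  then have dT: "det (transpose_mat B) \<noteq> 0" using det_transpose[OF B] by simp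
  have "transpose_mat B *\<^sub>v Matrix.vec m c = 0\<^sub>v m"
  proof (rule eq_vecI)
    fix j assume "j < dim_vec (0\<^sub>v m :: real Matrix.vec)"
    then have j: "j < m" by simp
    have "xs ! j \<in> set (cols A)" using j len xs SA by (metis nth_mem subsetD)
    then obtain l where l: "l < n" "xs ! j = col A l" using A by (auto simp: cols_def)
    have "(transpose_mat B *\<^sub>v Matrix.vec m c) $ j = col B j \<bullet> Matrix.vec m c" using j B by simp
    also have "col B j = col A l"
    proof -
      have "xs ! j \<in> carrier_vec m" using xc j len nth_mem by blast
      then show ?thesis using j len l(2) by (simp add: B_def)
    qed
    also have "col A l \<bullet> Matrix.vec m c = (\<Sum>i<m. c i * A $$ (i, l))"
      using A l by (auto simp: scalar_prod_def atLeast0LessThan mult.commute intro!: sum.cong)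
    finally show "(transpose_mat B *\<^sub>v Matrix.vec m c) $ j = 0\<^sub>v m $ j" using c[OF l(1)] j by simp
  qed (use B in auto)
  moreover have "Matrix.vec m c \<in> carrier_vec m" "transpose_mat B \<in> carrier_mat m m" using B by auto
  ultimately have "Matrix.vec m c = 0\<^sub>v m"
    using dT det_0_iff_vec_prod_zero_field[of "transpose_mat B" m] by blast
  then show ?thesis using i by (metis index_vec index_zero_vec(1))
qed

text \<open>For the weights below the top one: the first part expresses any combination of the
  \<open>t\<close> through the defining functions, the second gives the independence of the
  latter.\<close>

lemma invertible_solve_left:
  fixes A :: "real mat"
  assumes A: "A \<in> carrier_mat n n" and inv: "invertible_mat A"
  shows "\<exists>x. \<forall>b<n. (\<Sum>i<n. x i * A $$ (i, b)) = e b"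
    and "(\<And>j. j < n \<Longrightarrow> (\<Sum>i<n. c i * A $$ (i, j)) = 0) \<Longrightarrow> i < n \<Longrightarrow> c i = 0"
proof -
  obtain B where B: "A * B = 1\<^sub>m n" "B * A = 1\<^sub>m (dim_row B)"
    using inv A unfolding invertible_mat_def inverts_mat_def by auto
  have dB: "dim_row B = n" "dim_col B = n"
    using arg_cong[OF B(2), of dim_col] arg_cong[OF B(1), of dim_col] A by auto
  have BA: "(\<Sum>i<n. B $$ (l, i) * A $$ (i, b)) = (if l = b then 1 else 0)" if "l < n" "b < n" for l b
  proof -
    have "(B * A) $$ (l, b) = (\<Sum>i<n. B $$ (l, i) * A $$ (i, b))"
      using that A dB by (simp add: scalar_prod_def atLeast0LessThan)
    then show ?thesis using B(2) that dB by simp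
  qed
  have AB: "(\<Sum>i<n. A $$ (l, i) * B $$ (i, b)) = (if l = b then 1 else 0)" if "l < n" "b < n" for l b
  proof -
    have "(A * B) $$ (l, b) = (\<Sum>i<n. A $$ (l, i) * B $$ (i, b))"
      using that A dB by (simp add: scalar_prod_def atLeast0LessThan)
    then show ?thesis using B(1) that dB by simp
  qed
  show "\<exists>x. \<forall>b<n. (\<Sum>i<n. x i * A $$ (i, b)) = e b"
  proof (intro exI[of _ "\<lambda>i. \<Sum>l<n. e l * B $$ (l, i)"] allI impI)
    fix b assume b: "b < n"
    have "(\<Sum>i<n. (\<Sum>l<n. e l * B $$ (l, i)) * A $$ (i, b)) = (\<Sum>l<n. e l * (\<Sum>i<n. B $$ (l, i) * A $$ (i, b)))"
      unfolding sum_distrib_right sum_distrib_left by (subst sum.swap) (simp add: mult.assoc)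
    also have "\<dots> = (\<Sum>l<n. if l = b then e l else 0)" by (rule sum.cong) (use BA b in auto)
    finally show "(\<Sum>i<n. (\<Sum>l<n. e l * B $$ (l, i)) * A $$ (i, b)) = e b" using b by simp
  qed
  assume c: "\<And>j. j < n \<Longrightarrow> (\<Sum>i<n. c i * A $$ (i, j)) = 0" and i: "i < n"
  have "(\<Sum>l<n. c l * (\<Sum>j<n. A $$ (l, j) * B $$ (j, i))) = (\<Sum>j<n. (\<Sum>l<n. c l * A $$ (l, j)) * B $$ (j, i))"
    unfolding sum_distrib_right sum_distrib_left by (subst sum.swap) (simp add: mult.assoc)
  also have "\<dots> = 0" using c by simp
  also have "(\<Sum>l<n. c l * (\<Sum>j<n. A $$ (l, j) * B $$ (j, i))) = (\<Sum>l<n. if l = i then c l else 0)"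
    by (rule sum.cong) (use AB i in auto)
  finally show "c i = 0" using i by simp
qed

section \<open>Monomials and their weights\<close>

text \<open>The weight function is arbitrary, so that a slot for \<open>cnj z\<close> of weight 1
  can be added to the holomorphic variables.\<close>

definition mwt :: "(nat \<Rightarrow> nat) \<Rightarrow> (nat \<Rightarrow>\<^sub>0 nat) \<Rightarrow> nat" where
  "mwt v \<alpha> = (\<Sum>i\<in>Poly_Mapping.keys \<alpha>. Poly_Mapping.lookup \<alpha> i * v i)"

lemma monomial_wt_mwt: "monomial_wt t = mwt (wt t)" by (simp add: fun_eq_iff monomial_wt_def mwt_def)

lemma lookup_not_keys: "i \<notin> Poly_Mapping.keys \<alpha> \<Longrightarrow> Poly_Mapping.lookup \<alpha> i = 0"
  by (simp add: in_keys_iff)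

lemma monomial_at_superset: "finite I \<Longrightarrow> Poly_Mapping.keys \<alpha> \<subseteq> I \<Longrightarrow> monomial_at \<alpha> p = (\<Prod>i\<in>I. p i ^ Poly_Mapping.lookup \<alpha> i)"
  unfolding monomial_at_def by (rule prod.mono_neutral_left) (auto simp: lookup_not_keys)

lemma mwt_superset: "finite I \<Longrightarrow> Poly_Mapping.keys \<alpha> \<subseteq> I \<Longrightarrow> mwt v \<alpha> = (\<Sum>i\<in>I. Poly_Mapping.lookup \<alpha> i * v i)"
  unfolding mwt_def by (rule sum.mono_neutral_left) (auto simp: lookup_not_keys)

lemma keys_add_nat: "Poly_Mapping.keys (\<alpha> + \<beta> :: nat \<Rightarrow>\<^sub>0 nat) = Poly_Mapping.keys \<alpha> \<union> Poly_Mapping.keys \<beta>"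
  by (auto simp: in_keys_iff lookup_add)

lemma monomial_at_add: "monomial_at (\<alpha> + \<beta>) p = monomial_at \<alpha> p * monomial_at \<beta> p"
proof -
  let ?I = "Poly_Mapping.keys \<alpha> \<union> Poly_Mapping.keys \<beta>"
  have "monomial_at \<gamma> p = (\<Prod>i\<in>?I. p i ^ Poly_Mapping.lookup \<gamma> i)" if "\<gamma> \<in> {\<alpha>, \<beta>, \<alpha> + \<beta>}" for \<gamma>
    by (rule monomial_at_superset) (use that in \<open>auto simp: keys_add_nat\<close>)
  then show ?thesis by (simp add: lookup_add power_add prod.distrib)
qed

lemma mwt_add: "mwt v (\<alpha> + \<beta>) = mwt v \<alpha> + mwt v \<beta>"
proof -
  let ?I = "Poly_Mapping.keys \<alpha> \<union> Poly_Mapping.keys \<beta>"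
  have "mwt v \<gamma> = (\<Sum>i\<in>?I. Poly_Mapping.lookup \<gamma> i * v i)" if "\<gamma> \<in> {\<alpha>, \<beta>, \<alpha> + \<beta>}" for \<gamma>
    by (rule mwt_superset) (use that in \<open>auto simp: keys_add_nat\<close>)
  then show ?thesis by (simp add: lookup_add distrib_right sum.distrib)
qed

lemma monomial_at_single [simp]: "monomial_at (Poly_Mapping.single i n) p = p i ^ n"
  by (simp add: monomial_at_def)
lemma monomial_at_0 [simp]: "monomial_at 0 p = 1" by (simp add: monomial_at_def)
lemma mwt_0 [simp]: "mwt v 0 = 0" by (simp add: mwt_def)
lemma mwt_single [simp]: "mwt v (Poly_Mapping.single i n) = n * v i" by (simp add: mwt_def)

lemma mwt_ge: assumes "i \<in> Poly_Mapping.keys \<alpha>" shows "v i \<le> mwt v \<alpha>"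
proof -
  have "v i \<le> Poly_Mapping.lookup \<alpha> i * v i" using assms by (simp add: in_keys_iff)
  also have "\<dots> \<le> mwt v \<alpha>" unfolding mwt_def by (rule member_le_sum) (use assms in auto)
  finally show ?thesis .
qed

text \<open>All weights being positive, a variable that already carries the total weight leaves no
  room for another factor.\<close>

lemma mwt_linear:
  assumes i: "i \<in> Poly_Mapping.keys \<alpha>" "v i \<ge> mwt v \<alpha>" and v: "\<And>j. j \<in> Poly_Mapping.keys \<alpha> \<Longrightarrow> v j \<ge> 1"
  shows "\<alpha> = Poly_Mapping.single i 1"
proof (rule poly_mapping_eqI)
  fix j
  have eq: "mwt v \<alpha> = Poly_Mapping.lookup \<alpha> i * v i + (\<Sum>j\<in>Poly_Mapping.keys \<alpha> - {i}. Poly_Mapping.lookup \<alpha> j * v j)"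
    unfolding mwt_def by (rule sum.remove) (use i in auto)
  have l: "Poly_Mapping.lookup \<alpha> i \<ge> 1" using i(1) by (simp add: in_keys_iff)
  have vi: "v i \<ge> 1" using v[OF i(1)] .
  have "Poly_Mapping.lookup \<alpha> i * v i \<le> 1 * v i" using eq i(2) by linarith
  then have 1: "Poly_Mapping.lookup \<alpha> i = 1" using l vi by (simp del: One_nat_def)
  then have "(\<Sum>j\<in>Poly_Mapping.keys \<alpha> - {i}. Poly_Mapping.lookup \<alpha> j * v j) = 0" using eq i(2) by simp
  then have 0: "Poly_Mapping.lookup \<alpha> j * v j = 0" if "j \<in> Poly_Mapping.keys \<alpha>" "j \<noteq> i" for j using that by (auto simp: sum_eq_0_iff)
  show "Poly_Mapping.lookup \<alpha> j = Poly_Mapping.lookup (Poly_Mapping.single i 1) j"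
  proof (cases "j = i")
    case True then show ?thesis using 1 by (simp add: lookup_single)
  next
    case False
    have "j \<notin> Poly_Mapping.keys \<alpha>" using 0[of j] v[of j] False by (auto simp: in_keys_iff)
    then show ?thesis using False by (simp add: lookup_single lookup_not_keys)
  qed
qed

section \<open>Homogeneous polynomials in given functions\<close>

text \<open>\<open>Sp X G v d\<close>: the polynomials in the functions \<open>X g\<close>, \<open>g \<in> G\<close>, that are homogeneous of weight \<open>d\<close>
  when \<open>X g\<close> has weight \<open>v g\<close>.\<close>

inductive isSp :: "(nat \<Rightarrow> pfun) \<Rightarrow> nat set \<Rightarrow> (nat \<Rightarrow> nat) \<Rightarrow> nat \<Rightarrow> pfun \<Rightarrow> bool" for X G v d where
  "h = 0 \<Longrightarrow> isSp X G v d h"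
| "Poly_Mapping.keys \<alpha> \<subseteq> G \<Longrightarrow> mwt v \<alpha> = d \<Longrightarrow> h = (\<lambda>p. c * monomial_at \<alpha> (\<lambda>g. X g p)) \<Longrightarrow> isSp X G v d h"
| "isSp X G v d f \<Longrightarrow> isSp X G v d g \<Longrightarrow> h = f + g \<Longrightarrow> isSp X G v d h"

definition Sp where "Sp X G v d = {f. isSp X G v d f}"

lemma Sp_0: "0 \<in> Sp X G v d"
  and Sp_mono: "Poly_Mapping.keys \<alpha> \<subseteq> G \<Longrightarrow> mwt v \<alpha> = d \<Longrightarrow> (\<lambda>p. c * monomial_at \<alpha> (\<lambda>g. X g p)) \<in> Sp X G v d"
  and Sp_add: "f \<in> Sp X G v d \<Longrightarrow> g \<in> Sp X G v d \<Longrightarrow> f + g \<in> Sp X G v d"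
  unfolding Sp_def mem_Collect_eq by (rule isSp.intros; (assumption | rule refl))+

lemma Sp_induct [consumes 1, case_names zero mono add]:
  assumes "f \<in> Sp X G v d" and "P 0"
    and "\<And>\<alpha> c. Poly_Mapping.keys \<alpha> \<subseteq> G \<Longrightarrow> mwt v \<alpha> = d \<Longrightarrow> P (\<lambda>p. c * monomial_at \<alpha> (\<lambda>g. X g p))"
    and "\<And>f g. f \<in> Sp X G v d \<Longrightarrow> P f \<Longrightarrow> g \<in> Sp X G v d \<Longrightarrow> P g \<Longrightarrow> P (f + g)"
  shows "P f"
proof -
  have "isSp X G v d f" using assms(1) by (simp add: Sp_def)
  then show ?thesis by (induction rule: isSp.induct) (use assms(2-) in \<open>unfold Sp_def mem_Collect_eq, blast\<close>)+
qed

lemma Sp_mult: assumes "f \<in> Sp X G v d" "g \<in> Sp X G v e" shows "f * g \<in> Sp X G v (d + e)"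
  using assms(1)
proof (induction rule: Sp_induct)
  case zero then show ?case using Sp_0 by simp
next
  case (mono \<alpha> c)
  show ?case using assms(2)
  proof (induction rule: Sp_induct)
    case zero then show ?case using Sp_0 by simp
  next
    case (mono \<beta> b)
    have "(\<lambda>p. c * monomial_at \<alpha> (\<lambda>g. X g p)) * (\<lambda>p. b * monomial_at \<beta> (\<lambda>g. X g p)) =
      (\<lambda>p. (c * b) * monomial_at (\<alpha> + \<beta>) (\<lambda>g. X g p))"
      by (auto simp: fun_eq_iff fun_apply monomial_at_add)
    then show ?case using mono \<open>Poly_Mapping.keys \<alpha> \<subseteq> G\<close> \<open>mwt v \<alpha> = d\<close> Sp_mono[of "\<alpha> + \<beta>" G v "d + e" "c * b" X]
      by (simp add: mwt_add keys_add_nat)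
  next
    case (add f g) then show ?case using Sp_add by (simp add: distrib_left)
  qed
next
  case (add f g) then show ?case using Sp_add by (simp add: distrib_right)
qed

lemma Sp_cst: "cst c \<in> Sp X G v 0" using Sp_mono[of 0 G v 0 c X] by (simp add: cst_def)
lemma Sp_gen: "g \<in> G \<Longrightarrow> X g \<in> Sp X G v (v g)"
  using Sp_mono[of "Poly_Mapping.single g 1" G v "v g" 1 X] by (simp add: One_nat_def)
lemma Sp_smult: "f \<in> Sp X G v d \<Longrightarrow> cst c * f \<in> Sp X G v d" using Sp_mult[OF Sp_cst] by force
lemma Sp_sum: "(\<And>i. i \<in> I \<Longrightarrow> f i \<in> Sp X G v d) \<Longrightarrow> (\<Sum>i\<in>I. f i) \<in> Sp X G v d"
  by (induction I rule: infinite_finite_induct) (auto intro: Sp_add Sp_0)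

text \<open>Serves to show that real polynomials, and with them the defining functions, have a
  property as soon as the coordinates have it. Instances are \<open>RW\<close>, \<open>Sp\<close>,
  and constant families such as the kernel of a partial derivative or the functions of a few
  variables.\<close>

locale graded_family =
  fixes S :: "nat \<Rightarrow> pfun set"
  assumes S0: "0 \<in> S d" and S_cst: "cst c \<in> S 0" and S_add: "f \<in> S d \<Longrightarrow> g \<in> S d \<Longrightarrow> f + g \<in> S d"
    and S_mult: "f \<in> S d \<Longrightarrow> g \<in> S e \<Longrightarrow> f * g \<in> S (d + e)"
begin

lemma S_power: "f \<in> S d \<Longrightarrow> (\<lambda>p. f p ^ n) \<in> S (n * d)"
proof (induction n)
  case 0 then show ?case using S_cst[of 1] by (simp add: cst_def del: cst_1)
next
  case (Suc n) then show ?case using S_mult[OF Suc(2) Suc(1)] by (simp add: times_fun_def)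
qed

lemma S_monomial:
  assumes "\<And>g. g \<in> Poly_Mapping.keys \<alpha> \<Longrightarrow> X g \<in> S (v g)"
  shows "(\<lambda>p. monomial_at \<alpha> (\<lambda>g. X g p)) \<in> S (mwt v \<alpha>)"
proof -
  have "finite I \<Longrightarrow> (\<And>g. g \<in> I \<Longrightarrow> X g \<in> S (v g)) \<Longrightarrow> (\<lambda>p. \<Prod>g\<in>I. X g p ^ n g) \<in> S (\<Sum>g\<in>I. n g * v g)" for I n
  proof (induction I rule: finite_induct)
    case empty then show ?case using S_cst[of 1] by (simp add: cst_def del: cst_1)
  next
    case (insert g I)
    have "(\<lambda>p. X g p ^ n g) * (\<lambda>p. \<Prod>g\<in>I. X g p ^ n g) \<in> S (n g * v g + (\<Sum>g\<in>I. n g * v g))"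
      using insert by (intro S_mult S_power) auto
    then show ?case using insert by (simp add: times_fun_def)
  qed
  from this[of "Poly_Mapping.keys \<alpha>" "Poly_Mapping.lookup \<alpha>"] assms show ?thesis by (simp add: monomial_at_def mwt_def)
qed

lemma S_scale: "f \<in> S d \<Longrightarrow> cst c * f \<in> S d" using S_mult[OF S_cst] by force

lemma S_scale': "f \<in> S d \<Longrightarrow> (\<lambda>p. c * f p) \<in> S d" using S_scale[of f d c] by (simp add: times_fun_def cst_def)

lemma Sp_closed: assumes "f \<in> Sp X G v d" and "\<And>g. g \<in> G \<Longrightarrow> X g \<in> S (v g)" shows "f \<in> S d"
  using assms(1)
proof (induction rule: Sp_induct)
  case (mono \<alpha> c)
  have "(\<lambda>p. monomial_at \<alpha> (\<lambda>g. X g p)) \<in> S (mwt v \<alpha>)" by (rule S_monomial) (use mono assms(2) in auto)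
  from S_scale'[OF this] show ?case using mono(2) by simp
qed (auto intro: S0 S_add)

lemma real_polys_closed:
  assumes f: "f \<in> real_polys t j" and x: "xv 0 \<in> S 1" "xv 1 \<in> S 1"
    and u: "\<And>i. 1 \<le> i \<Longrightarrow> i \<le> num_w t (j - 1) \<Longrightarrow> xv (Suc i) \<in> S (wt t i)"
  shows "(\<lambda>p. complex_of_real (f p)) \<in> S j"
proof -
  obtain T c where T1: "finite T" "\<forall>(a, b, \<alpha>)\<in>T. Poly_Mapping.keys \<alpha> \<subseteq> {1..num_w t (j - 1)} \<and> a + b + monomial_wt t \<alpha> = j"
    and fT: "\<forall>p. complex_of_real (f p) = (\<Sum>(a, b, \<alpha>)\<in>T. c (a, b, \<alpha>) * p 0 ^ a * cnj (p 0) ^ b *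
           monomial_at \<alpha> (\<lambda>i. complex_of_real (Re (p i))))"
    using f unfolding real_polys_def mem_Collect_eq by (elim exE conjE) (rule that)
  have T: "finite T" "\<And>a b \<alpha>. (a, b, \<alpha>) \<in> T \<Longrightarrow> Poly_Mapping.keys \<alpha> \<subseteq> {1..num_w t (j - 1)} \<and> a + b + monomial_wt t \<alpha> = j"
    using T1 by auto
  have mono: "(\<lambda>p. c (a, b, \<alpha>) * p 0 ^ a * cnj (p 0) ^ b * monomial_at \<alpha> (\<lambda>i. complex_of_real (Re (p i)))) \<in> S j"
    if ab: "(a, b, \<alpha>) \<in> T" for a b \<alpha>
  proof -
    have k: "Poly_Mapping.keys \<alpha> \<subseteq> {1..num_w t (j - 1)}" "a + b + mwt (wt t) \<alpha> = j" using T(2)[OF ab] by (auto simp: monomial_wt_mwt)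
    have "(\<lambda>p. monomial_at \<alpha> (\<lambda>g. xv (Suc g) p)) \<in> S (mwt (wt t) \<alpha>)"
      by (rule S_monomial) (use u k in auto)
    moreover have "monomial_at \<alpha> (\<lambda>g. xv (Suc g) p) = monomial_at \<alpha> (\<lambda>i. complex_of_real (Re (p i)))" for p
      unfolding monomial_at_def by (rule prod.cong) (use k in \<open>auto simp: xv_def\<close>)
    ultimately have "(\<lambda>p. monomial_at \<alpha> (\<lambda>i. complex_of_real (Re (p i)))) \<in> S (mwt (wt t) \<alpha>)" by simp
    from S_scale[OF S_mult[OF S_mult[OF S_power[OF x(1), of a] S_power[OF x(2), of b]] this], of "c (a, b, \<alpha>)"] k
    have "cst (c (a, b, \<alpha>)) * ((\<lambda>p. xv 0 p ^ a) * (\<lambda>p. xv 1 p ^ b) * (\<lambda>p. monomial_at \<alpha> (\<lambda>i. complex_of_real (Re (p i))))) \<in> S j"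
      by simp
    also have "cst (c (a, b, \<alpha>)) * ((\<lambda>p. xv 0 p ^ a) * (\<lambda>p. xv 1 p ^ b) * (\<lambda>p. monomial_at \<alpha> (\<lambda>i. complex_of_real (Re (p i))))) =
      (\<lambda>p. c (a, b, \<alpha>) * p 0 ^ a * cnj (p 0) ^ b * monomial_at \<alpha> (\<lambda>i. complex_of_real (Re (p i))))"
      by (auto simp: fun_eq_iff fun_apply xv_def mult.assoc)
    finally show ?thesis .
  qed
  have "T' \<subseteq> T \<Longrightarrow> (\<lambda>p. \<Sum>(a, b, \<alpha>)\<in>T'. c (a, b, \<alpha>) * p 0 ^ a * cnj (p 0) ^ b * monomial_at \<alpha> (\<lambda>i. complex_of_real (Re (p i)))) \<in> S j"
    if "finite T'" for T' using that
  proof (induction T' rule: finite_induct)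
    case empty then show ?case using S0[of j] by (simp add: zero_fun_def)
  next
    case (insert x T')
    obtain a b \<alpha> where x: "x = (a, b, \<alpha>)" by (cases x) auto
    show ?case using S_add[OF mono[of a b \<alpha>] insert(3)] insert x by (simp add: plus_fun_def)
  qed
  from this[OF T(1)] show ?thesis using fT by simp
qed

end

lemma graded_family_Sp: "graded_family (Sp X G v)"
  by standard (auto intro: Sp_0 Sp_cst Sp_add Sp_mult)

lemma graded_family_const: assumes "0 \<in> S" "\<And>c. cst c \<in> S" "\<And>f g. f \<in> S \<Longrightarrow> g \<in> S \<Longrightarrow> f + g \<in> S" "\<And>f g. f \<in> S \<Longrightarrow> g \<in> S \<Longrightarrow> f * g \<in> S"
  shows "graded_family (\<lambda>_. S)"
  by standard (use assms in auto)

text \<open>By \<open>mwt_linear\<close> a monomial of weight \<open>d\<close> that contains a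
  variable of weight at least \<open>d\<close> is that variable; every other monomial uses smaller
  weights only.\<close>

lemma Sp_linear_part:
  assumes f: "f \<in> Sp X G v d" and G: "finite G" "\<And>g. g \<in> G \<Longrightarrow> v g \<ge> 1"
  shows "\<exists>f1 c. f1 \<in> Sp X {g\<in>G. v g < d} v d \<and> f = f1 + (\<Sum>g\<in>{g\<in>G. v g = d}. cst (c g) * X g)"
  using f
proof (induction rule: Sp_induct)
  case zero
  show ?case by (rule exI[of _ 0], rule exI[of _ "\<lambda>_. 0"]) (simp add: Sp_0)
next
  case (mono \<alpha> c)
  show ?case
  proof (cases "\<forall>g\<in>Poly_Mapping.keys \<alpha>. v g < d")
    case True
    then have "(\<lambda>p. c * monomial_at \<alpha> (\<lambda>g. X g p)) \<in> Sp X {g\<in>G. v g < d} v d" using mono by (intro Sp_mono) auto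
    then show ?thesis by (intro exI[of _ "\<lambda>p. c * monomial_at \<alpha> (\<lambda>g. X g p)"] exI[of _ "\<lambda>_. 0"]) simp
  next
    case False
    then obtain i where i: "i \<in> Poly_Mapping.keys \<alpha>" "v i \<ge> d" by auto
    have \<alpha>: "\<alpha> = Poly_Mapping.single i 1" by (rule mwt_linear[of i \<alpha> v]) (use i mono G in auto)
    then have vi: "v i = d" using mono(2) by simp
    have "(\<Sum>g\<in>{g\<in>G. v g = d}. cst (if g = i then c else 0) * X g) = (\<Sum>g\<in>{g\<in>G. v g = d}. if g = i then cst c * X i else 0)"
      by (rule sum.cong) auto
    also have "\<dots> = cst c * X i" using G i mono vi by (subst sum.delta) auto
    also have "\<dots> = (\<lambda>p. c * monomial_at \<alpha> (\<lambda>g. X g p))" by (auto simp: \<alpha> fun_eq_iff fun_apply)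
    finally show ?thesis by (intro exI[of _ 0] exI[of _ "\<lambda>g. if g = i then c else 0"]) (simp add: Sp_0)
  qed
next
  case (add f g)
  then obtain f1 c g1 c' where "f1 \<in> Sp X {g\<in>G. v g < d} v d" "f = f1 + (\<Sum>g\<in>{g\<in>G. v g = d}. cst (c g) * X g)"
    "g1 \<in> Sp X {g\<in>G. v g < d} v d" "g = g1 + (\<Sum>g\<in>{g\<in>G. v g = d}. cst (c' g) * X g)" by auto
  then show ?case
    by (intro exI[of _ "f1 + g1"] exI[of _ "\<lambda>g. c g + c' g"])
      (auto simp: cst_add distrib_right sum.distrib intro: Sp_add)
qed

lemma Sp_coeffs:
  assumes "f \<in> Sp X G v d"
  shows "\<exists>c. finite {\<alpha>. c \<alpha> \<noteq> 0} \<and> (\<forall>\<alpha>. c \<alpha> \<noteq> 0 \<longrightarrow> Poly_Mapping.keys \<alpha> \<subseteq> G \<and> mwt v \<alpha> = d) \<and>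
    (\<forall>p. f p = (\<Sum>\<alpha>\<in>{\<alpha>. c \<alpha> \<noteq> 0}. c \<alpha> * monomial_at \<alpha> (\<lambda>g. X g p)))"
  using assms
proof (induction rule: Sp_induct)
  case zero show ?case by (rule exI[of _ "\<lambda>_. 0"]) (simp add: zero_fun_apply)
next
  case (mono \<alpha> c)
  have "{\<beta>. (if \<beta> = \<alpha> then c else 0) \<noteq> 0} = (if c = 0 then {} else {\<alpha>})" by auto
  then show ?case using mono by (intro exI[of _ "\<lambda>\<beta>. if \<beta> = \<alpha> then c else 0"]) auto
next
  case (add f g)
  then obtain c c' where c: "finite {\<alpha>. c \<alpha> \<noteq> 0}" "(\<forall>\<alpha>. c \<alpha> \<noteq> 0 \<longrightarrow> Poly_Mapping.keys \<alpha> \<subseteq> G \<and> mwt v \<alpha> = d)"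
      "(\<forall>p. f p = (\<Sum>\<alpha>\<in>{\<alpha>. c \<alpha> \<noteq> 0}. c \<alpha> * monomial_at \<alpha> (\<lambda>g. X g p)))"
    and c': "finite {\<alpha>. c' \<alpha> \<noteq> 0}" "(\<forall>\<alpha>. c' \<alpha> \<noteq> 0 \<longrightarrow> Poly_Mapping.keys \<alpha> \<subseteq> G \<and> mwt v \<alpha> = d)"
      "(\<forall>p. g p = (\<Sum>\<alpha>\<in>{\<alpha>. c' \<alpha> \<noteq> 0}. c' \<alpha> * monomial_at \<alpha> (\<lambda>g. X g p)))" by auto
  let ?U = "{\<alpha>. c \<alpha> \<noteq> 0} \<union> {\<alpha>. c' \<alpha> \<noteq> 0}"
  have U: "(\<Sum>\<alpha>\<in>{\<alpha>. b \<alpha> \<noteq> 0}. b \<alpha> * M \<alpha>) = (\<Sum>\<alpha>\<in>?U. b \<alpha> * M \<alpha>)"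
    if "{\<alpha>. b \<alpha> \<noteq> 0} \<subseteq> ?U" for b M :: "(nat \<Rightarrow>\<^sub>0 nat) \<Rightarrow> complex"
    by (rule sum.mono_neutral_left) (use that c(1) c'(1) in auto)
  have sub: "{\<alpha>. c \<alpha> + c' \<alpha> \<noteq> 0} \<subseteq> ?U" by auto
  show ?case
  proof (intro exI[of _ "\<lambda>\<alpha>. c \<alpha> + c' \<alpha>"] conjI allI)
    show "finite {\<alpha>. c \<alpha> + c' \<alpha> \<noteq> 0}" using finite_subset[OF sub] c(1) c'(1) by auto
    fix p
    show "(f + g) p = (\<Sum>\<alpha>\<in>{\<alpha>. c \<alpha> + c' \<alpha> \<noteq> 0}. (c \<alpha> + c' \<alpha>) * monomial_at \<alpha> (\<lambda>g. X g p))"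
      using U[of c "\<lambda>\<alpha>. monomial_at \<alpha> (\<lambda>g. X g p)"] U[of c' "\<lambda>\<alpha>. monomial_at \<alpha> (\<lambda>g. X g p)"] U[OF sub] c(3) c'(3)
      by (simp add: plus_fun_apply distrib_right sum.distrib)
  next
    fix \<alpha> show "c \<alpha> + c' \<alpha> \<noteq> 0 \<longrightarrow> Poly_Mapping.keys \<alpha> \<subseteq> G \<and> mwt v \<alpha> = d" using c(2) c'(2) by (cases "c \<alpha> = 0") auto
  qed
qed

text \<open>Index \<open>n\<close> is a slot for \<open>cnj z\<close>, chosen beyond all variables
  in use. The span \<open>CP\<close> of the admissible monomials is closed under conjugation, which
  swaps the exponents of \<open>z\<close> and \<open>cnj z\<close>, so it contains the real part as
  half of \<open>f + cj f\<close>.\<close>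

lemma real_polysI:
  assumes "f \<in> Sp X G v j" and X: "\<And>g p. g \<in> G \<Longrightarrow> X g p = (if g = n then cnj (p 0) else if g = 0 then p 0 else complex_of_real (Re (p g)))"
    and G: "G \<subseteq> {0, n} \<union> {1..num_w t (j - 1)}" "n > num_w t (j - 1)" "n > 0"
    and v: "\<And>g. g \<in> G \<Longrightarrow> v g = (if g = n then 1 else wt t g)"
  shows "(\<lambda>p. Re (f p)) \<in> real_polys t j"
proof -
  define M where "M p = (\<lambda>(a, b, \<alpha>). p 0 ^ a * cnj (p 0) ^ b * monomial_at \<alpha> (\<lambda>i. complex_of_real (Re (p i))))" for p :: "nat \<Rightarrow> complex"
  define ok where "ok = (\<lambda>(a, b, \<alpha>). Poly_Mapping.keys \<alpha> \<subseteq> {1..num_w t (j - 1)} \<and> a + b + monomial_wt t \<alpha> = j)"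
  define CP where "CP f \<longleftrightarrow> (\<exists>S c. finite S \<and> (\<forall>x\<in>S. ok x) \<and> (\<forall>p. f p = (\<Sum>x\<in>S. c x * M p x)))" for f :: pfun
  have CP_add: "CP (f + g)" if fg: "CP f" "CP g" for f g
  proof -
    obtain S c where 1: "finite S" "\<forall>x\<in>S. ok x" "\<forall>p. f p = (\<Sum>x\<in>S. c x * M p x)"
      using fg(1) unfolding CP_def by (elim exE conjE) (rule that; assumption)
    obtain S' c' where 2: "finite S'" "\<forall>x\<in>S'. ok x" "\<forall>p. g p = (\<Sum>x\<in>S'. c' x * M p x)"
      using fg(2) unfolding CP_def by (elim exE conjE) (rule that; assumption)
    define C where "C x = (if x \<in> S then c x else 0) + (if x \<in> S' then c' x else 0)" for x
    have e1: "(\<Sum>x\<in>S. c x * M p x) = (\<Sum>x\<in>S \<union> S'. (if x \<in> S then c x else 0) * M p x)" for p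
      by (rule sum.mono_neutral_cong_left) (use 1(1) 2(1) in auto)
    have e2: "(\<Sum>x\<in>S'. c' x * M p x) = (\<Sum>x\<in>S \<union> S'. (if x \<in> S' then c' x else 0) * M p x)" for p
      by (rule sum.mono_neutral_cong_left) (use 1(1) 2(1) in auto)
    have "(f + g) p = (\<Sum>x\<in>S \<union> S'. C x * M p x)" for p
      by (simp only: plus_fun_apply 1(3)[rule_format] 2(3)[rule_format] e1 e2 C_def distrib_right sum.distrib)
    moreover have "finite (S \<union> S')" "\<forall>x\<in>S \<union> S'. ok x" using 1(1,2) 2(1,2) by auto
    ultimately show ?thesis unfolding CP_def by blast
  qed
  have CP_mono: "CP (\<lambda>p. c * M p x)" if "ok x" for c x
    unfolding CP_def by (rule exI[of _ "{x}"]) (use that in auto)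
  have CP_cj: "CP (cj f)" if "CP f" for f
  proof -
    obtain S c where 1: "finite S" "\<forall>x\<in>S. ok x" "\<forall>p. f p = (\<Sum>x\<in>S. c x * M p x)" using \<open>CP f\<close> unfolding CP_def by (elim exE conjE) (rule that; assumption)
    define sw where "sw = (\<lambda>(a, b, \<alpha>). (b, a, \<alpha>) :: nat \<times> nat \<times> (nat \<Rightarrow>\<^sub>0 nat))"
    have sw: "sw (sw x) = x" "ok (sw x) = ok x" "cnj (M p x) = M p (sw x)" for x p
      by (auto simp: sw_def ok_def M_def monomial_at_def split: prod.splits)
    have "inj_on sw S" by (rule inj_on_inverseI[of _ sw]) (rule sw)
    then have "cj f p = (\<Sum>x\<in>sw ` S. cnj (c (sw x)) * M p x)" for p
      by (simp add: cj_apply sum.reindex sw 1(3)[rule_format])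
    moreover have "finite (sw ` S)" "\<forall>x\<in>sw ` S. ok x" using 1(1,2) sw by auto
    ultimately show ?thesis unfolding CP_def by (intro exI[of _ "sw ` S"] exI[of _ "\<lambda>x. cnj (c (sw x))"]) blast
  qed
  have "CP f" using assms(1)
  proof (induction rule: Sp_induct)
    case zero show ?case unfolding CP_def by (rule exI[of _ "{}"]) (simp add: zero_fun_apply)
  next
    case (mono \<alpha> c)
    let ?a = "Poly_Mapping.lookup \<alpha> 0" and ?b = "Poly_Mapping.lookup \<alpha> n"
    \<comment> \<open>The monomial with its powers of \<open>z\<close> and \<open>cnj z\<close>
      erased; what remains are powers of the real parts.\<close>
    define \<beta> where "\<beta> = Poly_Mapping.update 0 0 (Poly_Mapping.update n 0 \<alpha>)"
    have lb: "Poly_Mapping.lookup \<beta> i = (if i = 0 \<or> i = n then 0 else Poly_Mapping.lookup \<alpha> i)" for i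
      by (simp add: \<beta>_def lookup_update)
    have dec: "\<alpha> = Poly_Mapping.single 0 ?a + Poly_Mapping.single n ?b + \<beta>"
      by (rule poly_mapping_eqI) (use G(3) in \<open>auto simp: lookup_add lookup_single lb when_def\<close>)
    have kx: "x \<in> G \<and> x \<noteq> n \<and> x \<in> {1..num_w t (j - 1)}" if "x \<in> Poly_Mapping.keys \<beta>" for x
    proof -
      have "x \<noteq> 0" "x \<noteq> n" "x \<in> Poly_Mapping.keys \<alpha>" using that by (auto simp: in_keys_iff lb split: if_splits)
      then show ?thesis using mono(1) G by blast
    qed
    then have kb: "Poly_Mapping.keys \<beta> \<subseteq> {1..num_w t (j - 1)}" "Poly_Mapping.keys \<beta> \<subseteq> G" by blast+
    have wb: "mwt v \<beta> = monomial_wt t \<beta>" unfolding mwt_def monomial_wt_def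
      by (rule sum.cong) (use kx v in auto)
    have v0: "?a * v 0 = ?a" using v[of 0] mono(1) G(3) by (cases "0 \<in> Poly_Mapping.keys \<alpha>") (auto simp: wt_def lookup_not_keys)
    have vn: "?b * v n = ?b" using v[of n] mono(1) G(3) by (cases "n \<in> Poly_Mapping.keys \<alpha>") (auto simp: lookup_not_keys)
    have "mwt v \<alpha> = ?a + ?b + monomial_wt t \<beta>" by (subst dec) (simp add: mwt_add v0 vn wb)
    then have okx: "ok (?a, ?b, \<beta>)" using mono kb by (auto simp: ok_def)
    have X0: "X 0 p ^ ?a = p 0 ^ ?a" for p using X[of 0 p] mono(1) G(3) by (cases "0 \<in> Poly_Mapping.keys \<alpha>") (auto simp: lookup_not_keys)
    have Xn: "X n p ^ ?b = cnj (p 0) ^ ?b" for p using X[of n p] mono(1) by (cases "n \<in> Poly_Mapping.keys \<alpha>") (auto simp: lookup_not_keys)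
    have Xb: "monomial_at \<beta> (\<lambda>g. X g p) = monomial_at \<beta> (\<lambda>i. complex_of_real (Re (p i)))" for p
      unfolding monomial_at_def by (rule prod.cong) (use kb X G in \<open>auto simp: subset_iff\<close>)
    have "monomial_at \<alpha> (\<lambda>g. X g p) = M p (?a, ?b, \<beta>)" for p
      by (subst dec) (simp add: monomial_at_add X0 Xn Xb M_def)
    then show ?case using CP_mono[OF okx] by simp
  qed (rule CP_add)
  have half: "CP (\<lambda>p. c * f p)" if "CP f" for f c
  proof -
    obtain S d where 1: "finite S" "\<forall>x\<in>S. ok x" "\<forall>p. f p = (\<Sum>x\<in>S. d x * M p x)" using \<open>CP f\<close> unfolding CP_def by (elim exE conjE) (rule that; assumption)
    have "c * f p = (\<Sum>x\<in>S. (c * d x) * M p x)" for p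
      by (simp add: 1(3)[rule_format] sum_distrib_left mult.assoc)
    then show ?thesis unfolding CP_def using 1(1,2) by (intro exI[of _ S] exI[of _ "\<lambda>x. c * d x"]) blast
  qed
  have "CP (\<lambda>p. (1/2) * (f + cj f) p)" by (rule half[OF CP_add[OF \<open>CP f\<close> CP_cj[OF \<open>CP f\<close>]]])
  also have "(\<lambda>p. (1/2) * (f + cj f) p) = (\<lambda>p. complex_of_real (Re (f p)))"
    by (auto simp: fun_eq_iff fun_apply complex_eq_iff)
  finally obtain S c where 1: "finite S" "\<forall>x\<in>S. ok x" "\<forall>p. complex_of_real (Re (f p)) = (\<Sum>x\<in>S. c x * M p x)"
    unfolding CP_def by (elim exE conjE) (rule that; assumption)
  show ?thesis unfolding real_polys_def mem_Collect_eq
  proof (intro exI[of _ S] exI[of _ c] conjI)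
    show "\<forall>(a, b, \<alpha>)\<in>S. Poly_Mapping.keys \<alpha> \<subseteq> {1..num_w t (j - 1)} \<and> a + b + monomial_wt t \<alpha> = j"
      using 1(2) by (auto simp: ok_def)
    show "\<forall>p. complex_of_real (Re (f p)) = (\<Sum>(a, b, \<alpha>)\<in>S. c (a, b, \<alpha>) * p 0 ^ a * cnj (p 0) ^ b *
           monomial_at \<alpha> (\<lambda>i. complex_of_real (Re (p i))))"
      using 1(3) by (simp add: M_def case_prod_unfold mult.assoc)
  qed (rule 1(1))
qed

section \<open>The model as a graph over intrinsic coordinates\<close>

locale model =
  fixes k \<rho> :: nat and t :: basis_family and A :: "nat \<Rightarrow> real mat"
  assumes data: "model_data k \<rho> t A"
begin

lemma k_ge_1: "k \<ge> 1" and k_le: "k \<le> num_w t \<rho>" and num_w_less: "j < \<rho> \<Longrightarrow> num_w t j < k"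
  and complement_basis_t: "2 \<le> j \<Longrightarrow> j \<le> \<rho> \<Longrightarrow> complement_basis t A j"
  and A_invertible: "2 \<le> j \<Longrightarrow> j < \<rho> \<Longrightarrow> A j \<in> carrier_mat (length (t j)) (length (t j)) \<and> invertible_mat (A j)"
  and A_last_carrier: "A \<rho> \<in> carrier_mat (k - num_w t (\<rho> - 1)) (length (t \<rho>))"
  and A_last_rank: "vec_space.rank (k - num_w t (\<rho> - 1)) (A \<rho>) = k - num_w t (\<rho> - 1)"
  using data by (auto simp: model_data_def Let_def not_le)

lemma num_w_Suc: "j \<ge> 1 \<Longrightarrow> num_w t (Suc j) = num_w t j + length (t (Suc j))"
  by (simp add: num_w_def)

lemma num_w_pred: "l \<ge> 2 \<Longrightarrow> num_w t l = num_w t (l - 1) + length (t l)"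
  using num_w_Suc[of "l - 1"] by simp

lemma num_w_small: "j \<le> 1 \<Longrightarrow> num_w t j = 0" by (simp add: num_w_def)

lemma num_w_mono: "i \<le> j \<Longrightarrow> num_w t i \<le> num_w t j"
  unfolding num_w_def by (rule sum_mono2) auto

lemma wt_0: "wt t 0 = 1" by (simp add: wt_def)

text \<open>The weight is a least index and \<open>num_w\<close> is monotone. Comparisons of weights
  and of indices are translated into each other by this equivalence.\<close>

lemma wt_le_iff: assumes "1 \<le> i" "i \<le> k" shows "wt t i \<le> j \<longleftrightarrow> i \<le> num_w t j"
proof -
  have w: "wt t i = (LEAST j. i \<le> num_w t j)" using assms by (simp add: wt_def)
  have "i \<le> num_w t \<rho>" using assms k_le by simp
  then have "i \<le> num_w t (wt t i)" unfolding w by (rule LeastI)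
  then show ?thesis using num_w_mono[of "wt t i" j] Least_le[of "\<lambda>j. i \<le> num_w t j" j] w by auto
qed

lemma wt_ge2: assumes "1 \<le> i" "i \<le> k" shows "2 \<le> wt t i"
  using wt_le_iff[OF assms, of 1] num_w_small[of 1] assms by linarith

lemma wt_le_rho: assumes "1 \<le> i" "i \<le> k" shows "wt t i \<le> \<rho>"
  using wt_le_iff[OF assms] assms k_le by simp

lemma rho2: "2 \<le> \<rho>" using num_w_small[of \<rho>] k_le k_ge_1 by linarith

sublocale wcoords k "wt t" by standard (rule wt_ge2)

definition Phi :: "nat \<Rightarrow> pfun" where
  "Phi i = (\<lambda>p. complex_of_real (\<Sum>b<length (t (wt t i)).
     A (wt t i) $$ (i - num_w t (wt t i - 1) - 1, b) * (t (wt t i) ! b) p))"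

lemma dim_A: "2 \<le> l \<Longrightarrow> l \<le> \<rho> \<Longrightarrow> dim_row (A l) = (if l < \<rho> then length (t l) else k - num_w t (\<rho> - 1))"
  "2 \<le> l \<Longrightarrow> l \<le> \<rho> \<Longrightarrow> dim_col (A l) = length (t l)"
  using A_invertible[of l] A_last_carrier by (cases "l = \<rho>"; auto)+

text \<open>Rows of \<open>A l\<close> are counted from 0 and variables from 1, which accounts for
  the shift. For \<open>l < \<rho>\<close> the rows exhaust the variables of weight
  \<open>l\<close>; at the top weight only those up to \<open>k\<close> occur.\<close>

lemma row_index: assumes l: "2 \<le> l" "l \<le> \<rho>"
  shows "i < dim_row (A l) \<Longrightarrow> 1 \<le> num_w t (l - 1) + i + 1 \<and> num_w t (l - 1) + i + 1 \<le> k \<and> wt t (num_w t (l - 1) + i + 1) = l"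
    and "1 \<le> n \<Longrightarrow> n \<le> k \<Longrightarrow> wt t n = l \<Longrightarrow> num_w t (l - 1) < n \<and> n - num_w t (l - 1) - 1 < dim_row (A l)"
proof -
  assume i: "i < dim_row (A l)"
  let ?n = "num_w t (l - 1) + i + 1"
  have n: "?n \<le> k"
  proof (cases "l < \<rho>")
    case True then show ?thesis using i dim_A[OF l] num_w_pred[OF l(1)] num_w_less[of l] by simp
  next
    case False then show ?thesis using i dim_A[OF l] l by simp
  qed
  have "?n \<le> num_w t l"
  proof (cases "l < \<rho>")
    case True then show ?thesis using i dim_A[OF l] num_w_pred[OF l(1)] by simp
  next
    case False then show ?thesis using n k_le l by simp
  qed
  then have "wt t ?n \<le> l" "\<not> wt t ?n \<le> l - 1" using wt_le_iff[of ?n] n by auto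
  then show "1 \<le> ?n \<and> ?n \<le> k \<and> wt t ?n = l" using n by simp
next
  assume n: "1 \<le> n" "n \<le> k" "wt t n = l"
  have "n \<le> num_w t l" "\<not> n \<le> num_w t (l - 1)" using wt_le_iff[OF n(1,2), of l] wt_le_iff[OF n(1,2), of "l - 1"] n l by auto
  then show "num_w t (l - 1) < n \<and> n - num_w t (l - 1) - 1 < dim_row (A l)"
    using dim_A[OF l] num_w_pred[OF l(1)] n l by (cases "l < \<rho>") auto
qed

lemma mult_A: assumes l: "2 \<le> l" "l \<le> \<rho>" and i: "i < dim_row (A l)"
  shows "(A l *\<^sub>v vec_of_list (map (\<lambda>f. f p) (t l))) $ i = (\<Sum>b<length (t l). A l $$ (i, b) * (t l ! b) p)"
proof -
  have "dim_vec (vec_of_list (map (\<lambda>f. f p) (t l))) = length (t l)" by simp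
  then have "(A l *\<^sub>v vec_of_list (map (\<lambda>f. f p) (t l))) $ i = (\<Sum>b = 0..<length (t l). Matrix.row (A l) i $ b * vec_of_list (map (\<lambda>f. f p) (t l)) $ b)"
    using i by (simp add: scalar_prod_def)
  also have "\<dots> = (\<Sum>b<length (t l). A l $$ (i, b) * (t l ! b) p)"
    unfolding atLeast0LessThan by (rule sum.cong) (use dim_A[OF l] i in \<open>auto simp: vec_of_list_index\<close>)
  finally show ?thesis .
qed

lemma defining_fun_Phi: assumes l: "2 \<le> l" "l \<le> \<rho>" and i: "i < dim_row (A l)" and n: "n = num_w t (l - 1) + i + 1"
  shows "defining_fun t A l i p = Im (p n) - Re (Phi n p)"
proof -
  have "wt t n = l" "n - num_w t (l - 1) - 1 = i" using row_index(1)[OF l i] n by auto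
  then show ?thesis unfolding defining_fun_def mult_A[OF l i] Phi_def n by simp
qed

lemma t_real_polys: "2 \<le> l \<Longrightarrow> l \<le> \<rho> \<Longrightarrow> b < length (t l) \<Longrightarrow> t l ! b \<in> real_polys t l"
  using complement_basis_t[of l] nth_mem[of b "t l"] by (auto simp: complement_basis_def)

lemma low_index: assumes "l \<le> \<rho>" "i \<le> num_w t (l - 1)" "1 \<le> l" shows "i < k"
  using num_w_mono[of "l - 1" "\<rho> - 1"] num_w_less[of "\<rho> - 1"] rho2 assms by linarith

lemma low_wt: assumes "l \<le> \<rho>" "1 \<le> i" "i \<le> num_w t (l - 1)" "1 \<le> l" shows "wt t i < l"
  using wt_le_iff[of i "l - 1"] low_index[of l i] assms by auto

lemma real_polys_in: assumes "graded_family S" "l \<le> \<rho>" "1 \<le> l" "f \<in> real_polys t l" "xv 0 \<in> S 1" "xv 1 \<in> S 1"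
    "\<And>i. 1 \<le> i \<Longrightarrow> i \<le> k \<Longrightarrow> wt t i < l \<Longrightarrow> xv (Suc i) \<in> S (wt t i)"
  shows "(\<lambda>p. complex_of_real (f p)) \<in> S l"
proof (rule graded_family.real_polys_closed[OF assms(1,4,5,6)])
  fix i assume "1 \<le> i" "i \<le> num_w t (l - 1)"
  then show "xv (Suc i) \<in> S (wt t i)" using assms(7)[of i] low_wt[OF assms(2), of i] low_index[OF assms(2), of i] assms(3) by simp
qed

lemma graded_RW: "graded_family (\<lambda>d. RW (int d))"
  by standard (use RW_mult in \<open>auto intro: RW_0 RW_cst RW_add simp: of_nat_add\<close>)

lemma xv_RW: "xv 0 \<in> RW (int 1)" "xv 1 \<in> RW (int 1)" "1 \<le> i \<Longrightarrow> i \<le> k \<Longrightarrow> xv (Suc i) \<in> RW (int (wt t i))"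
  using RW_xv[of 0] RW_xv[of 1] RW_xv[of "Suc i"] by auto

lemma real_polys_RW: assumes "l \<le> \<rho>" "1 \<le> l" "f \<in> real_polys t l" shows "(\<lambda>p. complex_of_real (f p)) \<in> RW (int l)"
  by (rule real_polys_in[OF graded_RW assms]) (use xv_RW in auto)

text \<open>The kernel of a partial derivative is a subalgebra, and it contains every coordinate of
  weight below \<open>l\<close>.\<close>

lemma real_polys_pd: assumes "l \<le> \<rho>" "1 \<le> l" "f \<in> real_polys t l" and j: "1 \<le> j" "j \<le> k" "l \<le> wt t j"
  shows "pd (Suc j) (\<lambda>p. complex_of_real (f p)) = 0"
proof -
  have "(\<lambda>p. complex_of_real (f p)) \<in> {f \<in> R. pd (Suc j) f = 0}"
    by (rule real_polys_in[OF graded_family_const assms(1-3)])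
      (use j in \<open>auto simp: pd_0 pd_cst pd_add pd_mult pd_xv R_add R_mult R_xv\<close>)
  then show ?thesis by simp
qed

lemma Phi_eq: assumes "1 \<le> i" "i \<le> k"
  shows "Phi i = (\<Sum>b<length (t (wt t i)). cst (complex_of_real (A (wt t i) $$ (i - num_w t (wt t i - 1) - 1, b))) *
    (\<lambda>p. complex_of_real ((t (wt t i) ! b) p)))"
  by (auto simp: Phi_def fun_eq_iff fun_apply)

lemma Phi_in: assumes i: "1 \<le> i" "i \<le> k" and S: "graded_family S" "xv 0 \<in> S 1" "xv 1 \<in> S 1"
    "\<And>j. 1 \<le> j \<Longrightarrow> j \<le> k \<Longrightarrow> wt t j < wt t i \<Longrightarrow> xv (Suc j) \<in> S (wt t j)"
  shows "Phi i \<in> S (wt t i)"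
proof -
  interpret graded_family S by (rule S)
  have sum: "(\<And>b. b \<in> I \<Longrightarrow> f b \<in> S d) \<Longrightarrow> (\<Sum>b\<in>I. f b) \<in> S d" if "finite I" for I :: "nat set" and f d
    using that by (induction I rule: finite_induct) (auto intro: S0 S_add)
  show ?thesis unfolding Phi_eq[OF i]
  proof (rule sum)
    fix b assume "b \<in> {..<length (t (wt t i))}"
    then have "t (wt t i) ! b \<in> real_polys t (wt t i)" using t_real_polys[OF wt_ge2[OF i] wt_le_rho[OF i]] by simp
    then have "(\<lambda>p. complex_of_real ((t (wt t i) ! b) p)) \<in> S (wt t i)"
      using real_polys_in[OF S(1) wt_le_rho[OF i] _ _ S(2,3,4)] wt_ge2[OF i] by auto
    then show "cst (complex_of_real (A (wt t i) $$ (i - num_w t (wt t i - 1) - 1, b))) * (\<lambda>p. complex_of_real ((t (wt t i) ! b) p)) \<in> S (wt t i)"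
      by (rule S_scale)
  qed simp
qed

sublocale cr_pre k "wt t" Phi \<rho>
proof
  fix i assume i: "1 \<le> i" "i \<le> k"
  show "Phi i \<in> RW (int (wt t i))" by (rule Phi_in[OF i graded_RW]) (use xv_RW in auto)
  show "cj (Phi i) = Phi i" by (auto simp: fun_eq_iff cj_apply Phi_def)
  show "wt t i \<le> \<rho>" by (rule wt_le_rho[OF i])
  fix j assume j: "1 \<le> j" "j \<le> k" "wt t i \<le> wt t j"
  have "Phi i \<in> {f \<in> R. pd (Suc j) f = 0}"
    by (rule Phi_in[OF i graded_family_const])
      (use j in \<open>auto simp: pd_0 pd_cst pd_add pd_mult pd_xv R_add R_mult R_xv\<close>)
  then show "pd (Suc j) (Phi i) = 0" by simp
qed

section \<open>Two systems of generators, and CR polynomials\<close>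

text \<open>\<open>X1\<close> and \<open>X2\<close> generate the same algebra with the same weights
  \<open>v2\<close>: both put \<open>cnj z\<close> at index \<open>k + 1\<close>, and the remaining
  indices carry the real variables in \<open>X1\<close> but the restricted \<open>w\<close> in
  \<open>X2\<close>.\<close>

definition X1 :: "nat \<Rightarrow> pfun" where "X1 g = (if g = k + 1 then xv 1 else if g = 0 then xv 0 else xv (Suc g))"
definition X2 :: "nat \<Rightarrow> pfun" where "X2 g = (if g = k + 1 then xv 1 else W g)"
definition v2 :: "nat \<Rightarrow> nat" where "v2 g = (if g = k + 1 then 1 else wt t g)"

lemma RW_to_Sp:
  assumes x: "xv 0 \<in> Sp X G v2 1" "xv 1 \<in> Sp X G v2 1" "\<And>i. 1 \<le> i \<Longrightarrow> i \<le> k \<Longrightarrow> xv (Suc i) \<in> Sp X G v2 (wt t i)"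
    and f: "f \<in> RW (int d)"
  shows "f \<in> Sp X G v2 d"
proof -
  have "f \<in> RW e \<Longrightarrow> 0 \<le> e \<longrightarrow> f \<in> Sp X G v2 (nat e)" for e f
  proof (induction rule: RW_induct)
    case (RW_xv g)
    show ?case using RW_xv by (rule gens_cases) (use x in \<open>auto simp: One_nat_def\<close>)
  next
    case (RW_mult d f e g)
    show ?case
    proof (cases "d < 0 \<or> e < 0")
      case True
      then have "f = 0 \<or> g = 0" using RW_neg[OF \<open>f \<in> RW d\<close>] RW_neg[OF \<open>g \<in> RW e\<close>] by blast
      then have "f * g = 0" by auto
      then show ?thesis by (simp add: Sp_0)
    next
      case False
      then show ?thesis using Sp_mult[of f X G v2 "nat d" g "nat e"] RW_mult by (auto simp: nat_add_distrib)
    qed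
  qed (auto intro: Sp_0 Sp_cst Sp_add)
  from this[OF f] show ?thesis by simp
qed

lemma RW_Sp1: "f \<in> RW (int d) \<Longrightarrow> f \<in> Sp X1 {..k+1} v2 d"
proof (erule RW_to_Sp[rotated -1])
  show "xv 0 \<in> Sp X1 {..k+1} v2 1" using Sp_gen[of 0 "{..k+1}" X1 v2] by (simp add: X1_def v2_def wt_0)
  show "xv 1 \<in> Sp X1 {..k+1} v2 1" using Sp_gen[of "k+1" "{..k+1}" X1 v2] by (simp add: X1_def v2_def)
  show "xv (Suc i) \<in> Sp X1 {..k+1} v2 (wt t i)" if "1 \<le> i" "i \<le> k" for i
    using Sp_gen[of i "{..k+1}" X1 v2] that by (simp add: X1_def v2_def)
qed

text \<open>The triangular relation \<open>W i = xv (Suc i) + \<i> * Phi i\<close> is solved for the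
  real variable, by induction on weight.\<close>

lemma xv_Sp2: "xv 0 \<in> Sp X2 {..k+1} v2 1" "xv 1 \<in> Sp X2 {..k+1} v2 1"
  "1 \<le> i \<Longrightarrow> i \<le> k \<Longrightarrow> xv (Suc i) \<in> Sp X2 {..k+1} v2 (wt t i)"
proof -
  show z: "xv 0 \<in> Sp X2 {..k+1} v2 1" using Sp_gen[of 0 "{..k+1}" X2 v2] by (simp add: X2_def v2_def wt_0 W_0)
  show zb: "xv 1 \<in> Sp X2 {..k+1} v2 1" using Sp_gen[of "k+1" "{..k+1}" X2 v2] by (simp add: X2_def v2_def)
  assume "1 \<le> i" "i \<le> k"
  then show "xv (Suc i) \<in> Sp X2 {..k+1} v2 (wt t i)"
  proof (induction "wt t i" arbitrary: i rule: less_induct)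
    case less
    have P: "Phi i \<in> Sp X2 {..k+1} v2 (wt t i)"
      by (rule Phi_in[OF less(2,3) graded_family_Sp z zb less(1)])
    have "W i \<in> Sp X2 {..k+1} v2 (wt t i)" using Sp_gen[of i "{..k+1}" X2 v2] less by (simp add: X2_def v2_def)
    from Sp_add[OF this Sp_smult[OF P, of "-\<i>"]] less show ?case by (simp add: W_def cst_minus)
  qed
qed

lemma RW_Sp2: "f \<in> RW (int d) \<Longrightarrow> f \<in> Sp X2 {..k+1} v2 d"
  by (rule RW_to_Sp[OF xv_Sp2])

text \<open>Every polynomial is a polynomial in \<open>cnj z\<close> with coefficients that are polynomials in the \<open>W i\<close>; being
  annihilated by \<open>Lb\<close>, it does not involve \<open>cnj z\<close>.\<close>

definition zpow :: "nat \<Rightarrow> pfun" where "zpow n = (\<lambda>p. cnj (p 0) ^ n)"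

lemma zpow_0: "zpow 0 = 1" and zpow_Suc: "zpow (Suc n) = xv 1 * zpow n"
  by (auto simp: zpow_def fun_eq_iff fun_apply xv_def)

lemma zpow_R: "zpow n \<in> R" by (induction n) (auto simp: zpow_0 zpow_Suc intro!: R_mult R_xv)

lemma Lb_zpow: "Lb (zpow (Suc n)) = cst (of_nat (Suc n)) * zpow n"
proof (induction n)
  case 0
  have "zpow (Suc 0) = xv 1" by (simp add: zpow_Suc zpow_0)
  then show ?case by (simp add: zpow_0 Lb_xv)
next
  case (Suc n)
  have "Lb (zpow (Suc (Suc n))) = zpow (Suc n) + xv 1 * (cst (of_nat (Suc n)) * zpow n)"
    unfolding zpow_Suc[of "Suc n"] using R_xv[of 1] zpow_R Suc by (simp add: der_mult[OF der_Lb] Lb_xv)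
  moreover have "cst (of_nat (Suc (Suc n))) = 1 + cst (of_nat (Suc n))" by (simp only: of_nat_Suc[of "Suc n"] cst_add cst_1)
  ultimately show ?case by (simp only: distrib_right) (simp add: zpow_Suc mult.left_commute del: of_nat_Suc)
qed

text \<open>\<open>Lb\<close> differentiates the powers of \<open>cnj z\<close> and treats the
  coefficients as constants, which lowers the degree; the coefficient of degree 0 is then what is
  left.\<close>

lemma zbar_indep:
  assumes "\<And>n. H n \<in> R" "\<And>n. Lb (H n) = 0" "(\<Sum>n\<le>N. zpow n * H n) = 0" "n \<le> N"
  shows "H n = 0"
  using assms
proof (induction N arbitrary: H n)
  case 0 then show ?case by (simp add: zpow_0)
next
  case (Suc N)
  have e: "Lb (zpow (Suc n) * H (Suc n)) = zpow n * (cst (of_nat (Suc n)) * H (Suc n))" for n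
    using Suc(2,3) zpow_R by (simp add: der_mult[OF der_Lb] Lb_zpow algebra_simps)
  have s: "(\<Sum>n\<le>Suc N. zpow n * H n) = H 0 + (\<Sum>n\<le>N. zpow (Suc n) * H (Suc n))"
    by (subst sum.atMost_Suc_shift) (simp add: zpow_0)
  have R1: "zpow (Suc n) * H (Suc n) \<in> R" for n by (intro R_mult zpow_R Suc(2))
  have "0 = Lb (\<Sum>n\<le>Suc N. zpow n * H n)" using Suc(4) by (simp add: der_0[OF der_Lb])
  also have "\<dots> = (\<Sum>n\<le>N. zpow n * (cst (of_nat (Suc n)) * H (Suc n)))"
    unfolding s using der_add[OF der_Lb Suc(2)[of 0] R_sum[of "{..N}", OF R1]] der_sum[OF der_Lb R1] Suc(3)[of 0]
    by (simp add: e)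
  finally have z: "(\<Sum>n\<le>N. zpow n * (cst (of_nat (Suc n)) * H (Suc n))) = 0" by simp
  have 1: "H (Suc n) = 0" if "n \<le> N" for n
  proof -
    have "cst (of_nat (Suc n)) * H (Suc n) = 0"
      by (rule Suc(1)[of "\<lambda>n. cst (of_nat (Suc n)) * H (Suc n)", OF _ _ z that])
        (use Suc(2,3) in \<open>auto simp: der_smult[OF der_Lb] intro: R_mult\<close>)
    then show ?thesis by (auto simp: fun_eq_iff fun_apply simp del: of_nat_Suc)
  qed
  then have "H 0 = 0" using Suc(4) unfolding s by simp
  then show ?case using 1 Suc(5) by (cases n) auto
qed

lemma W_RW': "g \<le> k \<Longrightarrow> W g \<in> RW (int (wt t g))"
  using W_RW[of g] by (auto simp: wt_0 split: if_splits)

lemma Sp_W_R: assumes "G \<subseteq> {..k}" "h \<in> Sp W G (wt t) d" shows "h \<in> RW (int d)" "h \<in> R" "Lb h = 0"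
proof -
  interpret graded_family "\<lambda>d. RW (int d)" by (rule graded_RW)
  show "h \<in> RW (int d)" by (rule Sp_closed[OF assms(2)]) (use assms(1) W_RW' in auto)
  then show "h \<in> R" by (rule RW_imp_R)
  interpret S: graded_family "\<lambda>_. {f \<in> R. Lb f = 0}"
    by (rule graded_family_const)
      (auto simp: der_0[OF der_Lb] der_cst[OF der_Lb] der_add[OF der_Lb] der_mult[OF der_Lb] R_add R_mult)
  have "h \<in> {f \<in> R. Lb f = 0}" by (rule S.Sp_closed[OF assms(2)]) (use assms(1) W_R Lb_W in auto)
  then show "Lb h = 0" by simp
qed

lemma Sp2_zpow:
  assumes "f \<in> Sp X2 {..k+1} v2 d"
  shows "\<exists>H. (\<forall>n. H n \<in> Sp W {..k} (wt t) (d - n)) \<and> f = (\<Sum>n\<le>d. zpow n * H n)"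
  using assms
proof (induction rule: Sp_induct)
  case zero
  show ?case by (rule exI[of _ "\<lambda>_. 0"]) (simp add: Sp_0)
next
  case (mono \<alpha> c)
  let ?b = "Poly_Mapping.lookup \<alpha> (k+1)"
  define \<beta> where "\<beta> = Poly_Mapping.update (k+1) 0 \<alpha>"
  have lb: "Poly_Mapping.lookup \<beta> i = (if i = k+1 then 0 else Poly_Mapping.lookup \<alpha> i)" for i
    by (simp add: \<beta>_def lookup_update)
  have dec: "\<alpha> = Poly_Mapping.single (k+1) ?b + \<beta>"
    by (rule poly_mapping_eqI) (auto simp: lookup_add lookup_single lb when_def)
  have kx: "x \<le> k" if "x \<in> Poly_Mapping.keys \<beta>" for x
  proof -
    have "x \<noteq> k+1" "x \<in> Poly_Mapping.keys \<alpha>" using that by (auto simp: in_keys_iff lb split: if_splits)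
    then show ?thesis using mono(1) by fastforce
  qed
  have v: "mwt v2 \<beta> = mwt (wt t) \<beta>" unfolding mwt_def by (rule sum.cong) (use kx in \<open>fastforce simp: v2_def\<close>)+
  have d: "d = ?b + mwt (wt t) \<beta>"
    using mono(2) arg_cong[OF dec, of "mwt v2"] by (simp add: mwt_add v) (simp add: v2_def)
  have mb: "monomial_at \<beta> (\<lambda>g. X2 g p) = monomial_at \<beta> (\<lambda>g. W g p)" for p
    unfolding monomial_at_def by (rule prod.cong) (use kx in \<open>fastforce simp: X2_def\<close>)+
  define h where "h = (\<lambda>p. c * monomial_at \<beta> (\<lambda>g. W g p))"
  have h: "h \<in> Sp W {..k} (wt t) (mwt (wt t) \<beta>)" unfolding h_def by (rule Sp_mono) (use kx in auto)
  have "(\<Sum>n\<le>d. zpow n * (if n = ?b then h else 0)) = (\<Sum>n\<le>d. if n = ?b then zpow ?b * h else 0)" by (rule sum.cong) auto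
  also have "\<dots> = zpow ?b * h" using d by (simp add: sum.delta)
  also have "\<dots> = (\<lambda>p. c * monomial_at \<alpha> (\<lambda>g. X2 g p))"
  proof
    fix p
    have "monomial_at \<alpha> (\<lambda>g. X2 g p) = X2 (k+1) p ^ ?b * monomial_at \<beta> (\<lambda>g. W g p)"
      by (subst dec) (simp only: monomial_at_add mb monomial_at_single)
    then show "(zpow ?b * h) p = c * monomial_at \<alpha> (\<lambda>g. X2 g p)" by (simp add: fun_apply h_def zpow_def X2_def xv_def)
  qed
  finally have e: "(\<lambda>p. c * monomial_at \<alpha> (\<lambda>g. X2 g p)) = (\<Sum>n\<le>d. zpow n * (if n = ?b then h else 0))" ..
  show ?case
  proof (intro exI[of _ "\<lambda>n. if n = ?b then h else 0"] conjI allI)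
    show "(if n = ?b then h else 0) \<in> Sp W {..k} (wt t) (d - n)" for n using h d by (auto simp: Sp_0)
  qed (rule e)
next
  case (add f g)
  then obtain H H' where H: "\<And>n. H n \<in> Sp W {..k} (wt t) (d - n)" "f = (\<Sum>n\<le>d. zpow n * H n)"
    "\<And>n. H' n \<in> Sp W {..k} (wt t) (d - n)" "g = (\<Sum>n\<le>d. zpow n * H' n)" by blast
  show ?case
    by (rule exI[of _ "\<lambda>n. H n + H' n"]) (use H in \<open>auto simp: distrib_left sum.distrib intro: Sp_add\<close>)
qed

lemma holomorphic_Sp: assumes f: "f \<in> RW (int d)" "Lb f = 0" shows "f \<in> Sp W {..k} (wt t) d"
proof -
  obtain H where H: "\<And>n. H n \<in> Sp W {..k} (wt t) (d - n)" "f = (\<Sum>n\<le>d. zpow n * H n)"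
    using Sp2_zpow[OF RW_Sp2[OF f(1)]] by blast
  have HR: "H n \<in> R" "Lb (H n) = 0" for n using Sp_W_R[OF subset_refl H(1)] by auto
  have fR: "f \<in> R" using f RW_imp_R by blast
  \<comment> \<open>\<open>f\<close> is itself annihilated by \<open>Lb\<close>, so it may be
    absorbed into the coefficient of the power 0; independence then identifies it with
    \<open>H 0\<close>.\<close>
  define H' where "H' n = (if n = 0 then H 0 - f else H n)" for n
  have "(\<Sum>n\<le>d. zpow n * H' n) = (\<Sum>n\<le>d. zpow n * H n - (if n = 0 then f else 0))"
    by (rule sum.cong) (auto simp: H'_def zpow_0)
  also have "\<dots> = 0" unfolding sum_subtractf H(2)[symmetric] by (simp add: sum.delta)
  finally have z: "(\<Sum>n\<le>d. zpow n * H' n) = 0" .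
  have "H' 0 = 0"
    by (rule zbar_indep[OF _ _ z]) (use HR fR f in \<open>auto simp: H'_def R_diff der_diff[OF der_Lb]\<close>)
  then have "f = H 0" by (simp add: H'_def)
  then show ?thesis using H(1)[of 0] by simp
qed

section \<open>Dilations, points of the model and pluriharmonicity\<close>

definition dil :: "real \<Rightarrow> (nat \<Rightarrow> complex) \<Rightarrow> nat \<Rightarrow> complex" where
  "dil s p = (\<lambda>i. complex_of_real (s ^ wt t i) * p i)"

lemma dil_RW: assumes "f \<in> RW (int d)" shows "f (dil s p) = complex_of_real (s ^ d) * f p"
proof -
  have "f \<in> RW e \<Longrightarrow> 0 \<le> e \<longrightarrow> f (dil s p) = complex_of_real (s ^ nat e) * f p" for e f
  proof (induction rule: RW_induct)
    case (RW_xv g)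
    show ?case using RW_xv by (rule gens_cases) (auto simp: xv_def dil_def wt_0)
  next
    case (RW_mult d f e g)
    show ?case
    proof (cases "d < 0 \<or> e < 0")
      case True
      then have "f = 0 \<or> g = 0" using RW_neg[OF \<open>f \<in> RW d\<close>] RW_neg[OF \<open>g \<in> RW e\<close>] by blast
      then have "f * g = 0" by auto
      then show ?thesis by (simp add: fun_apply)
    next
      case False
      then show ?thesis using RW_mult by (auto simp: nat_add_distrib power_add fun_apply)
    qed
  qed (auto simp: fun_apply distrib_left)
  from this[OF assms] show ?thesis by simp
qed

lemma real_poly_zero: fixes a :: "nat \<Rightarrow> complex"
  assumes "\<And>s::real. (\<Sum>e\<le>N. complex_of_real (s ^ e) * a e) = 0" "e \<le> N" shows "a e = 0"
proof -
  have "(\<Sum>e\<le>N. Re (a e) * s ^ e) = 0" for s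
    using arg_cong[OF assms(1)[of s], of Re] by (simp add: Re_complex_of_real[symmetric] mult.commute flip: of_real_power)
  then have 1: "Re (a e) = 0" using polyfun_eq_0[of "\<lambda>e. Re (a e)" N] assms(2) by auto
  have "(\<Sum>e\<le>N. Im (a e) * s ^ e) = 0" for s
    using arg_cong[OF assms(1)[of s], of Im] by (simp add: mult.commute flip: of_real_power)
  then have 2: "Im (a e) = 0" using polyfun_eq_0[of "\<lambda>e. Im (a e)" N] assms(2) by auto
  show ?thesis using 1 2 by (simp add: complex_eq_iff)
qed

text \<open>On a dilation orbit the sum is a polynomial in the real parameter \<open>s\<close>, with
  the values of the homogeneous parts as coefficients.\<close>

lemma hom_unique: assumes "\<And>e. e \<le> N \<Longrightarrow> f e \<in> RW (int e)" "\<And>p. (\<Sum>e\<le>N. f e p) = 0" "e \<le> N" shows "f e = 0"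
proof
  fix p
  have "(\<Sum>e\<le>N. complex_of_real (s ^ e) * f e p) = (\<Sum>e\<le>N. f e (dil s p))" for s
    by (rule sum.cong) (use dil_RW assms(1) in auto)
  then have "(\<Sum>e\<le>N. complex_of_real (s ^ e) * f e p) = 0" for s using assms(2) by simp
  then have "f e p = 0" by (rule real_poly_zero) (rule assms(3))
  then show "f e p = 0 p" by (simp add: fun_apply)
qed

text \<open>The point of the model with the same \<open>z\<close> and the same real parts as
  \<open>p\<close>. Through this parametrisation, identities on the model become identities of
  functions of an arbitrary \<open>p\<close>.\<close>

definition mpt :: "nat \<Rightarrow> (nat \<Rightarrow> complex) \<Rightarrow> nat \<Rightarrow> complex" where
  "mpt n p = (\<lambda>i. if i \<le> n then W i p else 0)"

definition low_fun :: "nat \<Rightarrow> pfun set" where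
  "low_fun n = {f. \<forall>p q. p 0 = q 0 \<longrightarrow> (\<forall>j. 1 \<le> j \<and> j \<le> n \<longrightarrow> Re (p j) = Re (q j)) \<longrightarrow> f p = f q}"

lemma low_funI: "(\<And>p q. p 0 = q 0 \<Longrightarrow> (\<And>j. 1 \<le> j \<Longrightarrow> j \<le> n \<Longrightarrow> Re (p j) = Re (q j)) \<Longrightarrow> f p = f q) \<Longrightarrow> f \<in> low_fun n"
  and low_funD: "f \<in> low_fun n \<Longrightarrow> p 0 = q 0 \<Longrightarrow> (\<And>j. 1 \<le> j \<Longrightarrow> j \<le> n \<Longrightarrow> Re (p j) = Re (q j)) \<Longrightarrow> f p = f q"
  unfolding low_fun_def by blast+

lemma graded_low_fun: "graded_family (\<lambda>_. low_fun n)"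
proof (rule graded_family_const)
  fix f g :: pfun assume fg: "f \<in> low_fun n" "g \<in> low_fun n"
  have "(f + g) p = (f + g) q \<and> (f * g) p = (f * g) q"
    if "p 0 = q 0" "\<And>j. 1 \<le> j \<Longrightarrow> j \<le> n \<Longrightarrow> Re (p j) = Re (q j)" for p q
  proof -
    have "f p = f q" "g p = g q" by (rule low_funD[OF fg(1)] low_funD[OF fg(2)]; rule that; assumption?)+
    then show ?thesis by (simp add: fun_apply)
  qed
  then show "f + g \<in> low_fun n" "f * g \<in> low_fun n" by (auto intro!: low_funI)
qed (auto intro!: low_funI simp: fun_apply)

lemma xv_low_fun: "xv 0 \<in> low_fun n" "xv 1 \<in> low_fun n" "1 \<le> j \<Longrightarrow> j \<le> n \<Longrightarrow> xv (Suc j) \<in> low_fun n"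
  by (rule low_funI; simp add: xv_def)+

lemma Phi_agree: assumes i: "1 \<le> i" "i \<le> k" and p: "p 0 = q 0" "\<And>j. 1 \<le> j \<Longrightarrow> j \<le> k \<Longrightarrow> wt t j < wt t i \<Longrightarrow> Re (p j) = Re (q j)"
  shows "Phi i p = Phi i q"
proof (rule low_funD[OF Phi_in[OF i graded_low_fun xv_low_fun(1,2)]])
  show "xv (Suc j) \<in> low_fun (num_w t (wt t i - 1))" if j: "1 \<le> j" "j \<le> k" "wt t j < wt t i" for j
    using wt_le_iff[OF j(1,2), of "wt t i - 1"] j(1,3) by (intro xv_low_fun) linarith+
  show "Re (p j) = Re (q j)" if "1 \<le> j" "j \<le> num_w t (wt t i - 1)" for j
    using p(2)[of j] low_wt[OF wt_le_rho[OF i], of j] low_index[OF wt_le_rho[OF i], of j] wt_ge2[OF i] that by auto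
qed (rule p(1))

lemma W_Re: "1 \<le> i \<Longrightarrow> Re (W i p) = Re (p i)" "1 \<le> i \<Longrightarrow> Im (W i p) = Re (Phi i p)"
  by (auto simp: W_def fun_apply xv_def Phi_def)

lemma W_0_apply: "W 0 p = p 0" by (simp add: W_0 xv_def)

lemma mpt_Phi: assumes "1 \<le> i" "i \<le> k" "\<And>j. 1 \<le> j \<Longrightarrow> j \<le> k \<Longrightarrow> wt t j < wt t i \<Longrightarrow> j \<le> n"
  shows "Phi i (mpt n p) = Phi i p"
  by (rule Phi_agree[OF assms(1,2)]) (use assms(3) in \<open>auto simp: mpt_def W_Re W_0_apply\<close>)

lemma mpt_model: assumes l: "l \<le> \<rho>" and n: "\<And>j. 1 \<le> j \<Longrightarrow> j \<le> k \<Longrightarrow> wt t j \<le> l \<Longrightarrow> j \<le> n"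
  shows "mpt n p \<in> model_set n l t A"
  unfolding model_set_def mem_Collect_eq
proof (intro conjI ballI allI impI)
  show "mpt n p \<in> cspace (1 + n)" by (auto simp: cspace_def mpt_def)
  fix l' i assume l': "l' \<in> {2..l}" and i: "i < dim_row (A l')"
  have l'': "2 \<le> l'" "l' \<le> \<rho>" using l' l by auto
  let ?n = "num_w t (l' - 1) + i + 1"
  have nn: "1 \<le> ?n" "?n \<le> k" "wt t ?n = l'" using row_index(1)[OF l'' i] by auto
  have "Phi ?n (mpt n p) = Phi ?n p" by (rule mpt_Phi[OF nn(1,2)]) (use n nn(3) l' in auto)
  moreover have "mpt n p ?n = W ?n p" using n[OF nn(1,2)] nn(3) l' by (auto simp: mpt_def)
  ultimately show "defining_fun t A l' i (mpt n p) = 0"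
    using defining_fun_Phi[OF l'' i refl] nn(1) by (simp add: W_Re)
qed

text \<open>The defining equation of the \<open>i\<close>-th variable says that the imaginary part
  of \<open>p i\<close> is \<open>Phi i p\<close>, and \<open>W i\<close> has the right real part
  anyway.\<close>

lemma model_W: assumes p: "p \<in> model_set n l t A" and l: "l \<le> \<rho>" and i: "1 \<le> i" "i \<le> k" "wt t i \<le> l"
  shows "W i p = p i"
proof -
  let ?l = "wt t i"
  let ?j = "i - num_w t (?l - 1) - 1"
  have l': "2 \<le> ?l" "?l \<le> \<rho>" using wt_ge2 wt_le_rho i by auto
  have j: "num_w t (?l - 1) < i" "?j < dim_row (A ?l)" using row_index(2)[OF l' i(1,2) refl] by auto
  have "defining_fun t A ?l ?j p = 0" using p j l' i(3) by (auto simp: model_set_def)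
  then have "Im (p i) = Re (Phi i p)" using defining_fun_Phi[OF l' j(2), of i p] j(1) by simp
  then show ?thesis using W_Re[OF i(1)] by (simp add: complex_eq_iff)
qed

text \<open>The definition of pluriharmonic admits holomorphic polynomials of mixed weights. Pulled
  back by \<open>mpt\<close> they become polynomials in the \<open>W\<close>, and the part of weight
  \<open>l\<close> already has real part \<open>g\<close>.\<close>

lemma pluriharmonic_homogeneous:
  assumes l: "2 \<le> l" "l \<le> \<rho>" and g: "g \<in> pluriharmonic_polys t A l"
  shows "\<exists>h. h \<in> Sp W {..num_w t (l - 1)} (wt t) l \<and> (\<forall>p. Re (h p) = g p)"
proof -
  let ?n = "num_w t (l - 1)"
  have nk: "?n \<le> k" using low_index[of l ?n] l by simp
  have gr: "g \<in> real_polys t l" using g by (simp add: pluriharmonic_polys_def)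
  obtain h where h: "h \<in> hol_polys (1 + ?n)" "\<forall>p \<in> model_set ?n (l - 1) t A. g p = Re (h p)"
    using g by (auto simp: pluriharmonic_polys_def)
  obtain S c where S: "finite S" "\<forall>\<alpha>\<in>S. Poly_Mapping.keys \<alpha> \<subseteq> {..<1 + ?n}" "h = (\<lambda>p. \<Sum>\<alpha>\<in>S. c \<alpha> * monomial_at \<alpha> p)"
    using h(1) unfolding hol_polys_def mem_Collect_eq by (elim exE conjE) (rule that; assumption)
  have keys: "Poly_Mapping.keys \<alpha> \<subseteq> {..?n}" if "\<alpha> \<in> S" for \<alpha> using S(2) that by fastforce
  have gp: "g p = Re (\<Sum>\<alpha>\<in>S. c \<alpha> * monomial_at \<alpha> (\<lambda>i. W i p))" for p
  proof -
    have m: "mpt ?n p \<in> model_set ?n (l - 1) t A"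
      by (rule mpt_model) (use l wt_le_iff in auto)
    have "complex_of_real (g p) = complex_of_real (g (mpt ?n p))"
    proof (rule low_funD[OF real_polys_in[OF graded_low_fun l(2) _ gr xv_low_fun(1,2)]])
      show "Re (p j) = Re (mpt ?n p j)" if "1 \<le> j" "j \<le> ?n" for j using that by (simp add: mpt_def W_Re)
      show "xv (Suc j) \<in> low_fun ?n" if j: "1 \<le> j" "j \<le> k" "wt t j < l" for j
        using wt_le_iff[OF j(1,2), of "l - 1"] j(1,3) by (intro xv_low_fun) linarith+
    qed (use l in \<open>auto simp: mpt_def W_0_apply\<close>)
    then have "g p = Re (h (mpt ?n p))" using h(2) m by simp
    also have "h (mpt ?n p) = (\<Sum>\<alpha>\<in>S. c \<alpha> * monomial_at \<alpha> (\<lambda>i. W i p))" unfolding S(3)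
    proof (rule sum.cong[OF refl])
      fix \<alpha> assume "\<alpha> \<in> S"
      then show "c \<alpha> * monomial_at \<alpha> (mpt ?n p) = c \<alpha> * monomial_at \<alpha> (\<lambda>i. W i p)"
        unfolding monomial_at_def using keys[of \<alpha>] by (auto simp: mpt_def intro!: prod.cong)
    qed
    finally show ?thesis .
  qed
  define H where "H e = (\<Sum>\<alpha>\<in>{\<alpha>\<in>S. mwt (wt t) \<alpha> = e}. (\<lambda>p. c \<alpha> * monomial_at \<alpha> (\<lambda>i. W i p)))" for e
  have H: "H e \<in> Sp W {..?n} (wt t) e" for e unfolding H_def by (rule Sp_sum) (use keys in \<open>auto intro: Sp_mono\<close>)
  have HRW: "H e \<in> RW (int e)" for e by (rule Sp_W_R[OF _ H]) (use nk in auto)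
  define N where "N = Max (insert l (mwt (wt t) ` S))"
  have N: "l \<le> N" "\<And>\<alpha>. \<alpha> \<in> S \<Longrightarrow> mwt (wt t) \<alpha> \<le> N" using S(1) by (auto simp: N_def)
  have tot: "(\<Sum>e\<le>N. H e p) = (\<Sum>\<alpha>\<in>S. c \<alpha> * monomial_at \<alpha> (\<lambda>i. W i p))" for p
    unfolding H_def sum_fun_apply
    using sum.group[OF S(1), of "{..N}" "mwt (wt t)" "\<lambda>\<alpha>. c \<alpha> * monomial_at \<alpha> (\<lambda>i. W i p)"] N(2) by auto
  \<comment> \<open>The part of weight \<open>e\<close> of \<open>g\<close> minus the real part of
    the holomorphic polynomial; the total vanishes identically, hence each \<open>G e\<close>
    does.\<close>
  define G where "G e = (if e = l then (\<lambda>p. complex_of_real (g p)) else 0) - cst (1/2) * (H e + cj (H e))" for e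
  have Gp: "G e p = (if e = l then complex_of_real (g p) else 0) - (H e p + cnj (H e p)) / 2" for e p
    by (simp add: G_def fun_apply)
  have half: "complex_of_real (Re T) = (T + cnj T) / 2" for T by (simp add: complex_eq_iff)
  have "G l = 0"
  proof (rule hom_unique[of N])
    show "G e \<in> RW (int e)" for e unfolding G_def
      using real_polys_RW[OF l(2) _ gr] l HRW by (auto intro!: RW_diff RW_uminus RW_smult RW_add RW_cj RW_0)
    fix p
    have "(\<Sum>e\<le>N. G e p) = complex_of_real (g p) - ((\<Sum>e\<le>N. H e p) + cnj (\<Sum>e\<le>N. H e p)) / 2"
      using N(1) by (simp add: Gp sum_subtractf sum.distrib sum_divide_distrib[symmetric] sum.delta)
    also have "\<dots> = 0" unfolding tot gp half by simp
    finally show "(\<Sum>e\<le>N. G e p) = 0" .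
  qed (rule N(1))
  then have "Re (H l p) = g p" for p
    using Gp[of l p] half[of "H l p"] by (simp add: fun_apply complex_eq_iff)
  then show ?thesis using H by blast
qed

end

section \<open>Nondegeneracy and pluriharmonicity below the top weight\<close>

lemma sum_list_index: fixes g :: "'a \<Rightarrow> 'b::comm_monoid_add"
  shows "distinct xs \<Longrightarrow> (\<Sum>b<length xs. g (xs ! b)) = (\<Sum>x\<in>set xs. g x)"
  by (rule sum.reindex_bij_betw[OF bij_betw_nth]) auto

lemma independent_list:
  fixes xs :: "'a::real_vector list"
  assumes "distinct xs" "Real_Vector_Spaces.independent (set xs)" "(\<Sum>b<length xs. e b *\<^sub>R xs ! b) = 0" "b < length xs"
  shows "e b = 0"
proof -
  define u where "u x = e (the_inv_into {..<length xs} (nth xs) x)" for x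
  have inj: "inj_on (nth xs) {..<length xs}" using assms(1) by (auto simp: inj_on_def nth_eq_iff_index_eq)
  have u: "u (xs ! b) = e b" if "b < length xs" for b
    unfolding u_def using the_inv_into_f_f[OF inj] that by simp
  have "(\<Sum>x\<in>set xs. u x *\<^sub>R x) = (\<Sum>b<length xs. u (xs ! b) *\<^sub>R xs ! b)"
    using sum_list_index[OF assms(1), of "\<lambda>x. u x *\<^sub>R x"] by simp
  also have "\<dots> = 0" using assms(3) by (simp add: u)
  finally have "(\<Sum>x\<in>set xs. u x *\<^sub>R x) = 0" .
  then have "u (xs ! b) = 0" using assms(2,4) real_vector.independentD[of "set xs" "set xs" u "xs ! b"] by auto
  then show ?thesis using u assms(4) by simp
qed

lemma span_list:
  fixes xs :: "'a::real_vector list"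
  assumes "distinct xs" "f \<in> Real_Vector_Spaces.span (set xs)"
  shows "\<exists>e. f = (\<Sum>b<length xs. e b *\<^sub>R xs ! b)"
proof -
  obtain u where "f = (\<Sum>x\<in>set xs. u x *\<^sub>R x)" using assms(2) by (auto simp: real_vector.span_finite)
  then show ?thesis using sum_list_index[OF assms(1), of "\<lambda>x. u x *\<^sub>R x"] by (intro exI[of _ "\<lambda>b. u (xs ! b)"]) simp
qed

lemma Sp_subset: assumes "f \<in> Sp X G v d" "G \<subseteq> G'" shows "f \<in> Sp X G' v d"
  by (rule graded_family.Sp_closed[OF graded_family_Sp assms(1)]) (use assms(2) Sp_gen in blast)

context model
begin

lemma real_polys_decomp: assumes "2 \<le> l" "l \<le> \<rho>" "f \<in> real_polys t l"
  shows "\<exists>e g. g \<in> pluriharmonic_polys t A l \<and> (\<forall>p. f p = (\<Sum>b<length (t l). e b * (t l ! b) p) + g p)"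
proof -
  obtain f1 g where fg: "f1 \<in> Real_Vector_Spaces.span (set (t l))" "g \<in> pluriharmonic_polys t A l" "f = f1 + g"
    using complement_basis_t[OF assms(1,2)] assms(3) unfolding complement_basis_def by blast
  obtain e where "f1 = (\<Sum>b<length (t l). e b *\<^sub>R (t l ! b))"
    using span_list[OF _ fg(1)] complement_basis_t[OF assms(1,2)] by (auto simp: complement_basis_def)
  then show ?thesis using fg(2,3) by (intro exI[of _ e] exI[of _ g]) (auto simp: fun_apply scaleR_fun_def)
qed

lemma span_pluriharmonic_zero:
  assumes l: "2 \<le> l" "l \<le> \<rho>" and f: "\<And>p. f p = (\<Sum>b<length (t l). e b * (t l ! b) p)"
    and h: "h \<in> hol_polys (1 + num_w t (l - 1))" "\<And>p. p \<in> model_set (num_w t (l - 1)) (l - 1) t A \<Longrightarrow> f p = Re (h p)"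
    and b: "b < length (t l)"
  shows "e b = 0"
proof -
  note c = complement_basis_t[OF l, unfolded complement_basis_def]
  have fs: "f = (\<Sum>b<length (t l). e b *\<^sub>R (t l ! b))" by (rule ext) (simp add: f fun_apply scaleR_fun_def)
  have sp: "f \<in> Real_Vector_Spaces.span (set (t l))" unfolding fs
    by (intro real_vector.span_sum real_vector.span_scale real_vector.span_base) auto
  have "0 \<in> pluriharmonic_polys t A l" using c by blast
  then have "f + 0 \<in> real_polys t l" using c sp by blast
  then have "f \<in> pluriharmonic_polys t A l" using h by (auto simp: pluriharmonic_polys_def)
  then have "f = 0" using sp c by blast
  then show ?thesis using independent_list[of "t l" e b] c b fs by auto
qed

lemma rows_bij: assumes l: "2 \<le> l" "l \<le> \<rho>"
  shows "bij_betw (\<lambda>i. num_w t (l - 1) + i + 1) {..<dim_row (A l)} {j\<in>{1..k}. wt t j = l}"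
  by (rule bij_betw_byWitness[where f' = "\<lambda>j. j - num_w t (l - 1) - 1"])
    (use row_index[OF l] in \<open>auto simp: image_subset_iff\<close>, fastforce)

text \<open>Combinations of the defining functions of weight \<open>l\<close> become combinations of
  the basis of the complement, with coefficients multiplied by \<open>A l\<close> from the
  left.\<close>

lemma sum_Phi: assumes l: "2 \<le> l" "l \<le> \<rho>"
  shows "(\<Sum>j\<in>{j\<in>{1..k}. wt t j = l}. c j * Re (Phi j p)) =
    (\<Sum>b<length (t l). (\<Sum>i<dim_row (A l). c (num_w t (l - 1) + i + 1) * A l $$ (i, b)) * (t l ! b) p)"
proof -
  have "(\<Sum>j\<in>{j\<in>{1..k}. wt t j = l}. c j * Re (Phi j p)) =
    (\<Sum>i<dim_row (A l). c (num_w t (l - 1) + i + 1) * Re (Phi (num_w t (l - 1) + i + 1) p))"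
    using sum.reindex_bij_betw[OF rows_bij[OF l], of "\<lambda>j. c j * Re (Phi j p)"] by simp
  also have "\<dots> = (\<Sum>i<dim_row (A l). \<Sum>b<length (t l). c (num_w t (l - 1) + i + 1) * A l $$ (i, b) * (t l ! b) p)"
    using row_index(1)[OF l] by (intro sum.cong) (auto simp: Phi_def sum_distrib_left mult.assoc)
  also have "\<dots> = (\<Sum>b<length (t l). (\<Sum>i<dim_row (A l). c (num_w t (l - 1) + i + 1) * A l $$ (i, b)) * (t l ! b) p)"
    by (subst sum.swap) (simp add: sum_distrib_right)
  finally show ?thesis .
qed

lemma left_kernel: assumes l: "2 \<le> l" "l \<le> \<rho>" and c: "\<And>b. b < length (t l) \<Longrightarrow> (\<Sum>i<dim_row (A l). c i * A l $$ (i, b)) = 0"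
    and i: "i < dim_row (A l)"
  shows "c i = 0"
proof (cases "l < \<rho>")
  case True
  then show ?thesis using invertible_solve_left(2)[of "A l" "length (t l)" c i] A_invertible[of l] l c i dim_A[OF l] by auto
next
  case False
  then have "l = \<rho>" using l by simp
  then show ?thesis using sum_left_kernel_full_row_rank[OF A_last_carrier A_last_rank, of c i] c i dim_A[OF l] by auto
qed

lemma wt_pos: "g \<le> k \<Longrightarrow> wt t g \<ge> 1" using wt_ge2[of g] wt_0 by (cases "g = 0") auto

text \<open>Being CR, \<open>h\<close> is a polynomial in the \<open>W\<close>, and
  \<open>top\<close> excludes those of weight \<open>l\<close>, so its imaginary part is
  pluriharmonic on the model of lower weight. By hypothesis it also lies in the span of
  \<open>t l\<close>, which meets the pluriharmonic polynomials in 0 only. Thus \<open>c\<close> is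
  in the left kernel of \<open>A l\<close>, which is trivial.\<close>

lemma model_nondegenerate:
  assumes h: "h \<in> RW (int l)" "Lb h = 0"
    and top: "\<And>j. 1 \<le> j \<Longrightarrow> j \<le> k \<Longrightarrow> l \<le> wt t j \<Longrightarrow> pd (Suc j) h = 0"
    and Im: "\<And>p. Im (h p) = (\<Sum>j\<in>{j\<in>{1..k}. wt t j = l}. c j * Re (Phi j p))"
    and i: "1 \<le> i" "i \<le> k" "wt t i = l"
  shows "c i = 0"
proof -
  have l: "2 \<le> l" "l \<le> \<rho>" using wt_ge2 wt_le_rho i by auto
  let ?n = "num_w t (l - 1)"
  obtain h1 d where h1: "h1 \<in> Sp W {g\<in>{..k}. wt t g < l} (wt t) l" and hd: "h = h1 + (\<Sum>g\<in>{g\<in>{..k}. wt t g = l}. cst (d g) * W g)"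
    using Sp_linear_part[OF holomorphic_Sp[OF h], of] wt_pos by auto
  have WR: "W g \<in> R" if "g \<in> {g\<in>{..k}. wt t g = l}" for g using W_R that by auto
  have h1R: "h1 \<in> R" by (rule Sp_W_R[OF _ h1]) auto
  have d0: "d g = 0" if g: "g \<in> {g\<in>{..k}. wt t g = l}" for g
  proof -
    have g1: "1 \<le> g" "g \<le> k" "wt t g = l" using g l wt_0 by (cases "g = 0"; auto)+
    have "h1 \<in> {f \<in> R. pd (Suc g) f = 0}"
    proof (rule graded_family.Sp_closed[OF graded_family_const h1])
      fix j assume j: "j \<in> {g\<in>{..k}. wt t g < l}"
      show "W j \<in> {f \<in> R. pd (Suc g) f = 0}"
        using j g1 W_R[of j] pd_W[of g j] by (cases "j = 0") (auto simp: W_0 pd_xv)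
    qed (use g1 in \<open>auto simp: pd_0 pd_cst pd_add pd_mult R_add R_mult\<close>)
    moreover have "pd (Suc g) (\<Sum>j\<in>{g\<in>{..k}. wt t g = l}. cst (d j) * W j) = (\<Sum>j\<in>{g\<in>{..k}. wt t g = l}. if j = g then cst (d j) else 0)"
    proof -
      have "pd (Suc g) (\<Sum>j\<in>{g\<in>{..k}. wt t g = l}. cst (d j) * W j) = (\<Sum>j\<in>{g\<in>{..k}. wt t g = l}. pd (Suc g) (cst (d j) * W j))"
        using g1 by (intro pd_sum R_mult cst_R WR) auto
      also have "\<dots> = (\<Sum>j\<in>{g\<in>{..k}. wt t g = l}. if j = g then cst (d j) else 0)"
      proof (rule sum.cong[OF refl])
        fix j assume j: "j \<in> {g\<in>{..k}. wt t g = l}"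
        then have "1 \<le> j" using l wt_0 by (cases "j = 0") auto
        then show "pd (Suc g) (cst (d j) * W j) = (if j = g then cst (d j) else 0)"
          using j g1 WR[OF j] pd_W[of g j] by (auto simp: pd_smult)
      qed
      finally show ?thesis .
    qed
    moreover have "(\<Sum>j\<in>{g\<in>{..k}. wt t g = l}. cst (d j) * W j) \<in> R" using WR by (intro R_sum R_mult cst_R)
    ultimately have "pd (Suc g) h = cst (d g)" using g1 h1R unfolding hd by (simp add: pd_add sum.delta)
    then show ?thesis using top[of g] g1 by simp
  qed
  then have "h = h1" unfolding hd by simp
  moreover have "{g\<in>{..k}. wt t g < l} \<subseteq> {..?n}"
  proof
    fix g assume g: "g \<in> {g\<in>{..k}. wt t g < l}"
    then show "g \<in> {..?n}" using wt_le_iff[of g "l - 1"] by (cases "g = 0") auto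
  qed
  ultimately have "h \<in> Sp W {..?n} (wt t) l" using Sp_subset[OF h1] by simp
  from Sp_coeffs[OF this] obtain b where b: "finite {\<alpha>. b \<alpha> \<noteq> 0}" "\<And>\<alpha>. b \<alpha> \<noteq> 0 \<Longrightarrow> Poly_Mapping.keys \<alpha> \<subseteq> {..?n}"
    "\<And>p. h p = (\<Sum>\<alpha>\<in>{\<alpha>. b \<alpha> \<noteq> 0}. b \<alpha> * monomial_at \<alpha> (\<lambda>g. W g p))" by blast
  \<comment> \<open>The factor \<open>- \<i>\<close> turns imaginary parts into real parts, as the
    definition of pluriharmonic requires.\<close>
  define hh where "hh = (\<lambda>p. \<Sum>\<alpha>\<in>{\<alpha>. b \<alpha> \<noteq> 0}. (- \<i> * b \<alpha>) * monomial_at \<alpha> p)"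
  have hol: "hh \<in> hol_polys (1 + ?n)" unfolding hol_polys_def hh_def
    by (intro CollectI exI[of _ "{\<alpha>. b \<alpha> \<noteq> 0}"] exI[of _ "\<lambda>\<alpha>. - \<i> * b \<alpha>"]) (use b(1,2) in fastforce)
  have hp: "Im (h p) = Re (hh p)" if p: "p \<in> model_set ?n (l - 1) t A" for p
  proof -
    have W: "W j p = p j" if j: "j \<le> ?n" for j
    proof (cases "j = 0")
      case False
      have "wt t j < l" "j \<le> k" using low_wt[of l j] low_index[of l j] l j False by auto
      then show ?thesis using False l by (intro model_W[OF p]) auto
    qed (simp add: W_0_apply)
    have "monomial_at \<alpha> (\<lambda>g. W g p) = monomial_at \<alpha> p" if "b \<alpha> \<noteq> 0" for \<alpha>
      unfolding monomial_at_def by (rule prod.cong) (use W b(2)[OF that] in auto)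
    then have "hh p = - \<i> * h p" unfolding hh_def b(3) sum_distrib_left by (intro sum.cong) auto
    then show ?thesis by simp
  qed
  have "(\<Sum>i<dim_row (A l). c (?n + i + 1) * A l $$ (i, b)) = 0" if "b < length (t l)" for b
  proof (rule span_pluriharmonic_zero[OF l _ hol _ that, where f = "\<lambda>p. Im (h p)"])
    show "Im (h p) = (\<Sum>b<length (t l). (\<Sum>i<dim_row (A l). c (?n + i + 1) * A l $$ (i, b)) * (t l ! b) p)" for p
      unfolding Im by (rule sum_Phi[OF l])
  qed (rule hp)
  then have "c (?n + (i - ?n - 1) + 1) = 0"
    using left_kernel[OF l, of "\<lambda>i. c (?n + i + 1)" "i - ?n - 1"] row_index(2)[OF l i] by simp
  then show ?thesis using row_index(2)[OF l i] by simp
qed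

text \<open>The real part of \<open>f\<close> is linear in the variables of weight \<open>d\<close>,
  plus a combination of \<open>t d\<close>, plus a pluriharmonic term. The linear part is the
  imaginary part of \<open>\<i>\<close> times a real combination of the \<open>W\<close>. As
  \<open>d < \<rho>\<close>, the matrix \<open>A d\<close> is invertible, so the combination of
  \<open>t d\<close> is one of the defining functions, that is, of the imaginary parts of the
  \<open>W\<close>. The pluriharmonic term is the real part of some \<open>\<eta>\<close> and so the
  imaginary part of \<open>\<i> * \<eta>\<close>.\<close>

lemma model_real_is_Im:
  assumes f: "f \<in> RW (int d)" and d: "d < \<rho>"
  shows "\<exists>h\<in>RW (int d). Lb h = 0 \<and> (\<forall>p. Im (h p) = Re (f p))"
proof -
  consider "d = 0" | "d = 1" | "d \<ge> 2" by linarith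
  then show ?thesis
  proof cases
    case 1
    then obtain c where "f = cst c" using RW_zero f by auto
    then show ?thesis using 1 RW_cst by (intro bexI[of _ "cst (\<i> * c)"]) (auto simp: der_cst[OF der_Lb] fun_apply)
  next
    case 2
    then have "f \<in> RW 1" using f by simp
    then obtain a b where f: "f = cst a * xv 0 + cst b * xv 1" using RW_1_linear by blast
    show ?thesis
    proof (intro bexI[of _ "cst (\<i> * (a + cnj b)) * xv 0"] conjI allI)
      show "cst (\<i> * (a + cnj b)) * xv 0 \<in> RW (int d)" using xv_RW 2 by (auto intro: RW_smult)
      show "Lb (cst (\<i> * (a + cnj b)) * xv 0) = 0" by (simp add: der_smult[OF der_Lb] Lb_xv)
      fix p show "Im ((cst (\<i> * (a + cnj b)) * xv 0) p) = Re (f p)"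
        by (simp add: f fun_apply xv_def algebra_simps)
    qed
  next
    case 3
    let ?n = "num_w t (d - 1)"
    have l: "2 \<le> d" "d \<le> \<rho>" using 3 d by auto
    have v1: "v2 g \<ge> 1" if "g \<in> {..k+1}" for g using that wt_pos[of g] by (auto simp: v2_def)
    obtain f1 c where f1: "f1 \<in> Sp X1 {g\<in>{..k+1}. v2 g < d} v2 d"
      and fc: "f = f1 + (\<Sum>g\<in>{g\<in>{..k+1}. v2 g = d}. cst (c g) * X1 g)"
      using Sp_linear_part[OF RW_Sp1[OF f] _ v1] by auto
    have g1: "1 \<le> g \<and> g \<le> k \<and> wt t g = d" if "g \<in> {g\<in>{..k+1}. v2 g = d}" for g
      using that l wt_0 by (cases "g = 0") (auto simp: v2_def split: if_splits)
    have nk: "?n < k" using low_index[of d ?n] l by simp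
    have "(\<lambda>p. Re (f1 p)) \<in> real_polys t d"
    proof (rule real_polysI[OF f1, of "k+1"])
      show "{g\<in>{..k+1}. v2 g < d} \<subseteq> {0, k + 1} \<union> {1..?n}"
      proof
        fix g assume g: "g \<in> {g\<in>{..k+1}. v2 g < d}"
        consider "g = 0" | "g = k + 1" | "1 \<le> g" "g \<le> k" using g by fastforce
        then show "g \<in> {0, k + 1} \<union> {1..?n}"
          by cases (use g wt_le_iff[of g "d - 1"] in \<open>auto simp: v2_def\<close>)
      qed
    qed (use nk in \<open>auto simp: X1_def xv_def v2_def\<close>)
    from real_polys_decomp[OF l this] obtain e g where g: "g \<in> pluriharmonic_polys t A d"
      and fe: "\<And>p. Re (f1 p) = (\<Sum>b<length (t d). e b * (t d ! b) p) + g p" by blast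
    obtain \<eta> where \<eta>: "\<eta> \<in> Sp W {..?n} (wt t) d" "\<And>p. Re (\<eta> p) = g p"
      using pluriharmonic_homogeneous[OF l g] by blast
    have dr: "dim_row (A d) = length (t d)" using dim_A[OF l] d by simp
    obtain x where x: "\<And>b. b < length (t d) \<Longrightarrow> (\<Sum>i<length (t d). x i * A d $$ (i, b)) = e b"
      using invertible_solve_left(1)[of "A d" "length (t d)" e] A_invertible[of d] l d by blast
    define y where "y j = x (j - ?n - 1)" for j
    have fy: "(\<Sum>b<length (t d). e b * (t d ! b) p) = (\<Sum>j\<in>{j\<in>{1..k}. wt t j = d}. y j * Re (Phi j p))" for p
      unfolding sum_Phi[OF l] dr by (rule sum.cong) (use x in \<open>auto simp: y_def\<close>)
    define h where "h = (\<Sum>j\<in>{j\<in>{1..k}. wt t j = d}. cst (complex_of_real (y j)) * W j) + cst \<i> * \<eta> +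
      (\<Sum>g\<in>{g\<in>{..k+1}. v2 g = d}. cst (\<i> * complex_of_real (Re (c g))) * W g)"
    have W: "W j \<in> Sp W {..k} (wt t) d" if "j \<le> k" "wt t j = d" for j using Sp_gen[of j "{..k}" W "wt t"] that by simp
    have "h \<in> Sp W {..k} (wt t) d" unfolding h_def
      using Sp_subset[OF \<eta>(1), of "{..k}"] nk g1 by (intro Sp_add Sp_sum Sp_smult W) auto
    from Sp_W_R[OF subset_refl this] have h: "h \<in> RW (int d)" "Lb h = 0" by auto
    have "Im (h p) = Re (f p)" for p
    proof -
      have "(\<Sum>g\<in>{g\<in>{..k+1}. v2 g = d}. Im (\<i> * complex_of_real (Re (c g)) * W g p)) = (\<Sum>g\<in>{g\<in>{..k+1}. v2 g = d}. Re (c g * X1 g p))"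
      proof (rule sum.cong[OF refl])
        fix g assume "g \<in> {g\<in>{..k+1}. v2 g = d}"
        then have "1 \<le> g" "g \<le> k" using g1 by auto
        then show "Im (\<i> * complex_of_real (Re (c g)) * W g p) = Re (c g * X1 g p)"
          by (simp add: X1_def xv_def W_Re)
      qed
      moreover have "(\<Sum>j\<in>{j\<in>{1..k}. wt t j = d}. Im (complex_of_real (y j) * W j p)) = (\<Sum>j\<in>{j\<in>{1..k}. wt t j = d}. y j * Re (Phi j p))"
        by (rule sum.cong) (auto simp: W_Re)
      ultimately show ?thesis
        unfolding h_def fc fun_apply using fe[of p] fy[of p] \<eta>(2)[of p] by simp
    qed
    then show ?thesis using h by blast
  qed
qed

sublocale cr_model k "wt t" Phi \<rho>
proof
  fix f d assume "f \<in> RW (int d)" "d < \<rho>"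
  then show "\<exists>h\<in>RW (int d). Lb h = 0 \<and> (\<forall>p. Im (h p) = Re (f p))" by (rule model_real_is_Im)
next
  fix h l c i
  assume "h \<in> RW (int l)" "Lb h = 0" "\<And>j. 1 \<le> j \<Longrightarrow> j \<le> k \<Longrightarrow> l \<le> wt t j \<Longrightarrow> pd (Suc j) h = 0"
    "\<And>p. Im (h p) = (\<Sum>j\<in>{j \<in> {1..k}. wt t j = l}. c j * Re (Phi j p))" "1 \<le> i" "i \<le> k" "wt t i = l"
  then show "c i = 0" by (rule model_nondegenerate)
qed

section \<open>The variables of weight 2 and 3\<close>

lemma mono0_Sp: assumes "h \<in> Sp W {..0} (wt t) 2" shows "\<exists>C. \<forall>p. h p = C * (p 0)\<^sup>2"
  using assms
proof (induction rule: Sp_induct)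
  case zero then show ?case by (intro exI[of _ 0]) (simp add: fun_apply)
next
  case (mono \<alpha> c)
  have "mwt (wt t) \<alpha> = Poly_Mapping.lookup \<alpha> 0" using mwt_superset[of "{0}" \<alpha> "wt t"] mono(1) wt_0 by auto
  moreover have "monomial_at \<alpha> q = q 0 ^ Poly_Mapping.lookup \<alpha> 0" for q
    using monomial_at_superset[of "{0}" \<alpha> q] mono(1) by auto
  ultimately show ?case using mono(2) by (intro exI[of _ c]) (simp add: W_0_apply)
next
  case (add f g) then show ?case by (metis distrib_right plus_fun_apply)
qed

lemma norm_sq_real_poly: "(\<lambda>p. (norm (p 0))\<^sup>2) \<in> real_polys t 2"
proof -
  have "X1 0 * X1 (k+1) \<in> Sp X1 {0, k+1} v2 (v2 0 + v2 (k+1))" by (intro Sp_mult Sp_gen) auto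
  then have 1: "X1 0 * X1 (k+1) \<in> Sp X1 {0, k+1} v2 2" by (simp add: v2_def wt_0)
  have "(\<lambda>p. Re ((X1 0 * X1 (k+1)) p)) \<in> real_polys t 2"
    by (rule real_polysI[OF 1, of "k+1"]) (use num_w_small in \<open>auto simp: X1_def xv_def v2_def\<close>)
  also have "(\<lambda>p. Re ((X1 0 * X1 (k+1)) p)) = (\<lambda>p. (norm (p 0))\<^sup>2)"
    by (simp add: fun_eq_iff fun_apply X1_def xv_def cmod_power2) (simp add: power2_eq_square)
  finally show ?thesis .
qed

lemma Re_sq_pluriharmonic: "(\<lambda>p. Re (e * (p 0)\<^sup>2)) \<in> pluriharmonic_polys t A 2"
proof -
  have "cst e * (X1 0 * X1 0) \<in> Sp X1 {0, k+1} v2 (v2 0 + v2 0)" by (intro Sp_smult Sp_mult Sp_gen) auto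
  then have 1: "cst e * (X1 0 * X1 0) \<in> Sp X1 {0, k+1} v2 2" by (simp add: v2_def wt_0)
  have "(\<lambda>p. Re ((cst e * (X1 0 * X1 0)) p)) \<in> real_polys t 2"
    by (rule real_polysI[OF 1, of "k+1"]) (use num_w_small in \<open>auto simp: X1_def xv_def v2_def\<close>)
  also have "(\<lambda>p. Re ((cst e * (X1 0 * X1 0)) p)) = (\<lambda>p. Re (e * (p 0)\<^sup>2))"
    by (auto simp: fun_eq_iff fun_apply X1_def xv_def power2_eq_square)
  finally have 2: "(\<lambda>p. Re (e * (p 0)\<^sup>2)) \<in> real_polys t 2" .
  have "(\<lambda>p. \<Sum>\<alpha>\<in>{Poly_Mapping.single (0::nat) (2::nat)}. e * monomial_at \<alpha> p) \<in> hol_polys (1 + num_w t (2 - 1))"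
    unfolding hol_polys_def by (intro CollectI exI[of _ "{Poly_Mapping.single (0::nat) (2::nat)}"] exI[of _ "\<lambda>_. e"]) (auto simp del: single_numeral split: if_splits)
  then have "(\<lambda>p. e * (p 0)\<^sup>2) \<in> hol_polys (1 + num_w t (2 - 1))" by (simp del: single_numeral)
  with 2 show ?thesis unfolding pluriharmonic_polys_def
    by (intro CollectI conjI bexI[of _ "\<lambda>p. e * (p 0)\<^sup>2"]) auto
qed

lemma norm_sq_not_pluriharmonic: "(\<lambda>p. (norm (p 0))\<^sup>2) \<notin> pluriharmonic_polys t A 2"
proof
  assume "(\<lambda>p. (norm (p 0))\<^sup>2) \<in> pluriharmonic_polys t A 2"
  from pluriharmonic_homogeneous[OF _ rho2 this] obtain h where h: "h \<in> Sp W {..0} (wt t) 2" "\<And>p. Re (h p) = (norm (p 0))\<^sup>2"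
    using num_w_small[of "2 - 1"] by auto
  obtain C where "\<And>p. h p = C * (p 0)\<^sup>2" using mono0_Sp[OF h(1)] by blast
  \<comment> \<open>At \<open>z = 1\<close> and \<open>z = \<i>\<close> the real part of
    \<open>C * z * z\<close> has opposite signs, whereas the squared norm is 1 at both.\<close>
  then show False using h(2)[of "\<lambda>_. 1"] h(2)[of "\<lambda>_. \<i>"] by simp
qed

lemma real_polys_2: assumes "f \<in> real_polys t 2" shows "\<exists>e b. f = (\<lambda>p. Re (e * (p 0)\<^sup>2) + b * (norm (p 0))\<^sup>2)"
proof -
  let ?F = "\<lambda>p. complex_of_real (f p)"
  have F: "?F \<in> RW 2" using real_polys_RW[OF rho2 _ assms] by simp
  have u: "pd (Suc j) ?F = 0" if "j \<in> {1..k}" for j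
    using real_polys_pd[OF rho2 _ assms, of j] wt_ge2[of j] that by auto
  obtain a b a' b' where ab: "pd 0 ?F = cst a * xv 0 + cst b * xv 1" "pd 1 ?F = cst a' * xv 0 + cst b' * xv 1"
    using RW_1_linear[of "pd 0 ?F"] RW_1_linear[of "pd 1 ?F"] pd_RW[OF F, of 0] pd_RW[OF F, of 1] by auto
  have "cst 2 * ?F = xv 0 * (cst a * xv 0 + cst b * xv 1) + xv 1 * (cst a' * xv 0 + cst b' * xv 1)"
    using euler_formula[OF F] by (simp add: sum_gens u ab)
  then have e: "2 * ?F p = p 0 * (a * p 0 + b * cnj (p 0)) + cnj (p 0) * (a' * p 0 + b' * cnj (p 0))" for p
    by (auto simp: fun_eq_iff fun_apply xv_def)
  have "f p = Re (((a + cnj b') / 2) * (p 0)\<^sup>2) + (Re (b + a') / 2) * (norm (p 0))\<^sup>2" for p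
  proof -
    have "2 * f p = Re (2 * ?F p)" by simp
    also have "\<dots> = Re ((a + cnj b') * (p 0)\<^sup>2) + Re (b + a') * (norm (p 0))\<^sup>2"
      unfolding e by (simp add: cmod_power2) (simp add: power2_eq_square algebra_simps)
    finally have "2 * f p = Re ((a + cnj b') * (p 0)\<^sup>2) + Re (b + a') * (norm (p 0))\<^sup>2" .
    moreover have "Re (((a + cnj b') / 2) * (p 0)\<^sup>2) = Re ((a + cnj b') * (p 0)\<^sup>2) / 2"
      by (simp only: times_divide_eq_left Re_divide_numeral)
    ultimately show ?thesis by linarith
  qed
  then show ?thesis by blast
qed

text \<open>Real polynomials of weight 2 are a pluriharmonic part plus a multiple of the squared
  norm of \<open>z\<close>. Two distinct basis elements would have a nontrivial combination free of
  the squared norm, hence pluriharmonic.\<close>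

lemma length_t2: "length (t 2) = 1"
proof -
  note c = complement_basis_t[OF _ rho2, unfolded complement_basis_def, OF order_refl]
  let ?T = "set (t 2)"
  have "?T \<noteq> {}"
  proof
    assume "?T = {}"
    then have "real_polys t 2 = {f + g | f g. f \<in> {0} \<and> g \<in> pluriharmonic_polys t A 2}" using c by simp
    then show False using norm_sq_real_poly norm_sq_not_pluriharmonic by auto
  qed
  have "f = g" if fg: "f \<in> ?T" "g \<in> ?T" for f g
  proof (rule ccontr)
    assume ne: "f \<noteq> g"
    have sp: "f \<in> Real_Vector_Spaces.span ?T" "g \<in> Real_Vector_Spaces.span ?T" using fg by (auto intro: real_vector.span_base)
    have rp: "f \<in> real_polys t 2" "g \<in> real_polys t 2" using c fg by blast+
    obtain e b where f: "f = (\<lambda>p. Re (e * (p 0)\<^sup>2) + b * (norm (p 0))\<^sup>2)" using real_polys_2[OF rp(1)] by blast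
    obtain e' b' where g: "g = (\<lambda>p. Re (e' * (p 0)\<^sup>2) + b' * (norm (p 0))\<^sup>2)" using real_polys_2[OF rp(2)] by blast
    have "b' *\<^sub>R f + (- b) *\<^sub>R g = (\<lambda>p. Re ((b' * e - b * e') * (p 0)\<^sup>2))"
    proof
      fix p :: "nat \<Rightarrow> complex"
      have "Re ((b' * e - b * e') * (p 0)\<^sup>2) = b' * Re (e * (p 0)\<^sup>2) - b * Re (e' * (p 0)\<^sup>2)" by (simp add: algebra_simps)
      then show "(b' *\<^sub>R f + (- b) *\<^sub>R g) p = Re ((b' * e - b * e') * (p 0)\<^sup>2)"
        unfolding f g fun_apply scaleR_fun_def by (simp only: real_scaleR_def) (simp only: distrib_left mult_minus_left mult.left_commute)
    qed
    then have "b' *\<^sub>R f + (- b) *\<^sub>R g \<in> pluriharmonic_polys t A 2" by (simp only: Re_sq_pluriharmonic)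
    moreover have "b' *\<^sub>R f + (- b) *\<^sub>R g \<in> Real_Vector_Spaces.span ?T"
      by (intro real_vector.span_add real_vector.span_scale sp)
    ultimately have 0: "b' *\<^sub>R f + (- b) *\<^sub>R g = 0" using c by blast
    have ind: "Real_Vector_Spaces.independent {f, g}"
      using real_vector.independent_mono[of ?T "{f, g}"] c fg by auto
    have "b = 0"
      using real_vector.independentD[OF ind, of "{f, g}" "\<lambda>x. if x = f then b' else - b" g] 0 ne by auto
    then have "f \<in> pluriharmonic_polys t A 2" using Re_sq_pluriharmonic f by simp
    then have "f = 0" using sp c by blast
    then show False using c fg real_vector.dependent_zero[of ?T] by auto
  qed
  then have "card ?T \<le> Suc 0" by (subst card_le_Suc0_iff_eq) auto
  moreover have "card ?T > 0" using \<open>?T \<noteq> {}\<close> by (simp add: card_gt_0_iff)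
  ultimately have "card ?T = 1" by linarith
  then show ?thesis using c by (simp add: distinct_card)
qed

lemma num_w_2: "num_w t 2 = 1" using num_w_pred[of 2] num_w_small[of 1] length_t2 by (simp add: One_nat_def)

lemma rho_k: "3 \<le> \<rho> \<longleftrightarrow> 2 \<le> k"
proof
  assume "3 \<le> \<rho>" then show "2 \<le> k" using num_w_less[of 2] num_w_2 by simp
next
  assume "2 \<le> k" then show "3 \<le> \<rho>" using num_w_mono[of \<rho> 2] num_w_2 k_le by linarith
qed

lemma wt_1: "wt t 1 = 2" using wt_le_iff[of 1 2] wt_ge2[of 1] num_w_2 k_ge_1 by simp

lemma wt_ge3: "2 \<le> j \<Longrightarrow> j \<le> k \<Longrightarrow> 3 \<le> wt t j" using wt_le_iff[of j 2] num_w_2 by simp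

lemma Sp_weight_3: assumes "h \<in> Sp W {..1} (wt t) 3" shows "\<exists>a b. \<forall>p. h p = a * (p 0) ^ 3 + b * (p 0 * W 1 p)"
  using assms
proof (induction rule: Sp_induct)
  case zero then show ?case by (intro exI[of _ 0]) (simp add: fun_apply)
next
  case (mono \<alpha> c)
  let ?a = "Poly_Mapping.lookup \<alpha> 0" and ?b = "Poly_Mapping.lookup \<alpha> 1"
  have 01: "{..1} = {0, 1::nat}" by auto
  have "mwt (wt t) \<alpha> = ?a + ?b * 2" using mwt_superset[of "{0, 1}" \<alpha> "wt t"] mono(1) wt_0 wt_1 unfolding 01 by simp
  then have d: "(?a = 3 \<and> ?b = 0) \<or> (?a = 1 \<and> ?b = 1)" using mono(2) by presburger
  have m: "monomial_at \<alpha> q = q 0 ^ ?a * q 1 ^ ?b" for q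
    using monomial_at_superset[of "{0, 1}" \<alpha> q] mono(1) unfolding 01 by simp
  from d show ?case
  proof
    assume "?a = 3 \<and> ?b = 0"
    then show ?thesis by (intro exI[of _ c] exI[of _ 0]) (simp add: m W_0_apply)
  next
    assume "?a = 1 \<and> ?b = 1"
    then show ?thesis by (intro exI[of _ 0] exI[of _ c]) (simp add: m W_0_apply)
  qed
next
  case (add f g)
  then obtain a b a' b' where "\<forall>p. f p = a * (p 0) ^ 3 + b * (p 0 * W 1 p)" "\<forall>p. g p = a' * (p 0) ^ 3 + b' * (p 0 * W 1 p)" by blast
  then show ?case by (intro exI[of _ "a + a'"] exI[of _ "b + b'"]) (simp add: fun_apply algebra_simps)
qed

text \<open>The real part of \<open>z * z * cnj z\<close> is not pluriharmonic. A CR polynomial of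
  weight 3 is \<open>a * z^3 + b * z * W 1\<close>; moving the real part of the first
  \<open>w\<close> forces \<open>b = 0\<close>, and then \<open>z = 1\<close> and the cube root
  \<open>1 + \<i> * sqrt 3\<close> of -8 require different real parts of \<open>a\<close>.\<close>

lemma length_t3: assumes "3 \<le> \<rho>" shows "length (t 3) \<ge> 1"
proof (rule ccontr)
  assume "\<not> length (t 3) \<ge> 1"
  then have "t 3 = []" by (cases "t 3") auto
  then have pl: "real_polys t 3 = {f + g | f g. f \<in> {0} \<and> g \<in> pluriharmonic_polys t A 3}"
    using complement_basis_t[of 3] assms by (simp add: complement_basis_def)
  have "X1 0 * X1 0 * X1 (k+1) \<in> Sp X1 {0, k+1} v2 (v2 0 + v2 0 + v2 (k+1))" by (intro Sp_mult Sp_gen) auto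
  then have 1: "X1 0 * X1 0 * X1 (k+1) \<in> Sp X1 {0, k+1} v2 3" by (simp add: v2_def wt_0)
  have "num_w t (3 - 1) < k + 1" using num_w_2 k_ge_1 by simp
  then have "(\<lambda>p. Re ((X1 0 * X1 0 * X1 (k+1)) p)) \<in> real_polys t 3"
    by (intro real_polysI[OF 1, of "k+1"]) (auto simp: X1_def xv_def v2_def)
  then have "(\<lambda>p. Re ((X1 0 * X1 0 * X1 (k+1)) p)) \<in> pluriharmonic_polys t A 3" using pl by auto
  from pluriharmonic_homogeneous[OF _ assms this] obtain h where h: "h \<in> Sp W {..1} (wt t) 3"
    "\<And>p. Re (h p) = Re ((X1 0 * X1 0 * X1 (k+1)) p)" using num_w_2 by auto
  obtain a b where ab: "\<And>p. h p = a * (p 0) ^ 3 + b * (p 0 * W 1 p)" using Sp_weight_3[OF h(1)] by blast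
  have eq: "Re (a * (p 0) ^ 3 + b * (p 0 * W 1 p)) = Re (p 0 * p 0 * cnj (p 0))" for p
    using h(2)[of p] ab[of p] by (simp add: fun_apply X1_def xv_def)
  \<comment> \<open>\<open>Phi 1\<close> depends on \<open>z\<close> alone, so raising the real part
    of the first \<open>w\<close> by 1 adds 1 to \<open>W 1\<close>.\<close>
  have W1: "W 1 (\<lambda>i. if i = 0 then z else 1) = 1 + W 1 (\<lambda>i. if i = 0 then z else 0)" for z
  proof -
    have "Phi 1 (\<lambda>i. if i = 0 then z else 1) = Phi 1 (\<lambda>i. if i = 0 then z else 0)"
    proof (rule Phi_agree)
      fix j assume "1 \<le> j" "j \<le> k" "wt t j < wt t 1"
      then show "Re (if j = 0 then z else 1) = Re (if j = 0 then z else 0)" using wt_ge2[of j] wt_1 by simp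
    qed (use k_ge_1 in auto)
    then show ?thesis by (simp add: W_def fun_apply xv_def)
  qed
  have bz: "Re (b * z) = 0" for z
    using eq[of "\<lambda>i. if i = 0 then z else 1"] eq[of "\<lambda>i. if i = 0 then z else 0"] by (simp add: W1 algebra_simps)
  have "b = 0" using bz[of 1] bz[of "\<i>"] by (simp add: complex_eq_iff)
  then have e3: "Re (a * z ^ 3) = Re (z * z * cnj z)" for z using eq[of "\<lambda>_. z"] by simp
  have "Re a = 1" using e3[of 1] by simp
  moreover have "Re a = - 1 / 2"
  proof -
    define z where "z = Complex 1 (sqrt 3)"
    have "z * z = Complex (-2) (2 * sqrt 3)" by (simp add: z_def complex_eq_iff)
    then have z3: "z ^ 3 = -8" by (simp add: power3_eq_cube z_def complex_eq_iff)
    have "z * cnj z = 4" by (simp add: z_def complex_eq_iff)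
    then have "z * z * cnj z = 4 * z" by (simp add: mult.assoc)
    then have "Re (a * (-8)) = Re (4 * z)" using e3[of z] by (simp only: z3)
    then show ?thesis by (simp add: z_def)
  qed
  ultimately show False by simp
qed

lemma wt_2: assumes "2 \<le> k" shows "wt t 2 = 3"
proof -
  have "num_w t 3 \<ge> 2" using num_w_pred[of 3] num_w_2 length_t3 rho_k assms by simp
  then show ?thesis using wt_le_iff[of 2 3] wt_ge3[of 2] assms by simp
qed

end

section \<open>Germs of infinitesimal automorphisms\<close>

lemma poly_line_zero: fixes h :: "nat \<Rightarrow> complex"
  assumes "\<And>x::real. (\<Sum>e\<le>N. h e * (complex_of_real x + y) ^ e) = 0" "e \<le> N" shows "h e = 0"
proof (rule ccontr)
  assume "h e \<noteq> 0"
  then have "finite {z. (\<Sum>e\<le>N. h e * z ^ e) = 0}" using polyfun_finite_roots[of h N] assms(2) by blast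
  moreover have "range (\<lambda>x. complex_of_real x + y) \<subseteq> {z. (\<Sum>e\<le>N. h e * z ^ e) = 0}" using assms(1) by auto
  moreover have "infinite (range (\<lambda>x. complex_of_real x + y))"
    using infinite_UNIV_char_0 by (subst finite_image_iff) (auto intro: injI)
  ultimately show False using finite_subset by blast
qed

text \<open>Once the first \<open>n\<close> coefficients vanish, divide by \<open>s ^ n\<close> and
  let \<open>s\<close> tend to 0 through positive values.\<close>

lemma powser_real_zero: fixes a :: "nat \<Rightarrow> complex"
  assumes \<epsilon>: "\<epsilon> > 0" and a: "\<And>s::real. 0 < s \<Longrightarrow> s < \<epsilon> \<Longrightarrow> (\<lambda>n. a n * complex_of_real s ^ n) sums 0"
  shows "a n = 0"
proof (induction n rule: less_induct)
  case (less n)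
  have sh: "(\<lambda>m. a (m + n) * complex_of_real s ^ m) sums 0" if s: "0 < s" "s < \<epsilon>" for s
  proof -
    have "(\<lambda>m. a (m + n) * complex_of_real s ^ (m + n)) sums 0"
      using a[OF s] sums_iff_shift[of "\<lambda>n. a n * complex_of_real s ^ n" n 0] less by simp
    from sums_mult[OF this, of "inverse (complex_of_real s ^ n)"] show ?thesis
      using s by (simp add: power_add field_simps)
  qed
  define f where "f = (\<lambda>x. suminf (\<lambda>m. a (m + n) * x ^ m))"
  have "(\<lambda>m. a (m + n) * x ^ m) sums f x" if "norm x < \<epsilon> / 2" for x
  proof -
    have "summable (\<lambda>m. a (m + n) * complex_of_real (\<epsilon> / 2) ^ m)"
      using sh[of "\<epsilon> / 2"] \<epsilon> by (auto simp: sums_iff)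
    from powser_inside[OF this, of x] show ?thesis unfolding f_def using that \<epsilon> by (auto intro: summable_sums)
  qed
  then have lim: "(f \<longlongrightarrow> a (0 + n)) (at 0)" using powser_limit_0[of "\<epsilon> / 2" "\<lambda>m. a (m + n)" f] \<epsilon> by auto
  have "filterlim (\<lambda>x. complex_of_real x) (at 0) (at_right 0)"
    unfolding filterlim_at by (auto intro!: tendsto_eq_intros simp: eventually_at_filter)
  from filterlim_compose[OF lim this] have l1: "((\<lambda>x. f (complex_of_real x)) \<longlongrightarrow> a (0 + n)) (at_right 0)" .
  have "eventually (\<lambda>x. f (complex_of_real x) = 0) (at_right (0::real))"
    unfolding eventually_at_right_field
    by (rule exI[of _ \<epsilon>]) (use sh \<epsilon> in \<open>auto simp: f_def sums_iff\<close>)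
  then have "((\<lambda>x. f (complex_of_real x)) \<longlongrightarrow> 0) (at_right 0)" by (rule tendsto_eventually)
  then show ?case using tendsto_unique[OF _ l1] by simp
qed

text \<open>Weights are at least 1, so no exponent exceeds \<open>n\<close>, and a monomial is
  determined by its exponents on the finitely many variables.\<close>

lemma finite_mwt: fixes v :: "nat \<Rightarrow> nat"
  assumes v: "\<And>i. i \<le> k \<Longrightarrow> v i \<ge> 1" shows "finite {\<alpha>. Poly_Mapping.keys \<alpha> \<subseteq> {..k} \<and> mwt v \<alpha> = n}"
proof (rule inj_on_finite)
  let ?f = "\<lambda>\<alpha>. restrict (Poly_Mapping.lookup \<alpha>) {..k}"
  show "inj_on ?f {\<alpha>. Poly_Mapping.keys \<alpha> \<subseteq> {..k} \<and> mwt v \<alpha> = n}"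
  proof (rule inj_onI, rule poly_mapping_eqI)
    fix \<alpha> \<beta> i assume ab: "\<alpha> \<in> {\<alpha>. Poly_Mapping.keys \<alpha> \<subseteq> {..k} \<and> mwt v \<alpha> = n}" "\<beta> \<in> {\<alpha>. Poly_Mapping.keys \<alpha> \<subseteq> {..k} \<and> mwt v \<alpha> = n}" "?f \<alpha> = ?f \<beta>"
    show "Poly_Mapping.lookup \<alpha> i = Poly_Mapping.lookup \<beta> i"
    proof (cases "i \<le> k")
      case True then show ?thesis using fun_cong[OF ab(3), of i] by simp
    next
      case False
      then have "i \<notin> Poly_Mapping.keys \<alpha>" "i \<notin> Poly_Mapping.keys \<beta>" using ab by auto
      then show ?thesis by (simp add: lookup_not_keys)
    qed
  qed
  have "Poly_Mapping.lookup \<alpha> i \<le> n" if "Poly_Mapping.keys \<alpha> \<subseteq> {..k}" "mwt v \<alpha> = n" "i \<le> k" for \<alpha> i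
  proof (cases "i \<in> Poly_Mapping.keys \<alpha>")
    case True
    have "Poly_Mapping.lookup \<alpha> i \<le> Poly_Mapping.lookup \<alpha> i * v i" using v[OF that(3)] by simp
    also have "\<dots> \<le> mwt v \<alpha>" unfolding mwt_def by (rule member_le_sum) (use True in auto)
    finally show ?thesis using that by simp
  qed (simp add: lookup_not_keys)
  then show "?f ` {\<alpha>. Poly_Mapping.keys \<alpha> \<subseteq> {..k} \<and> mwt v \<alpha> = n} \<subseteq> PiE {..k} (\<lambda>_. {..n})"
    unfolding image_subset_iff restrict_PiE_iff by auto
  show "finite (PiE {..k} (\<lambda>_. {..n}))" by (rule finite_PiE) auto
qed

context model
begin

lemma wt_mono: "1 \<le> i \<Longrightarrow> i \<le> j \<Longrightarrow> j \<le> k \<Longrightarrow> wt t i \<le> wt t j"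
  using wt_le_iff[of i "wt t j"] wt_le_iff[of j "wt t j"] by simp

text \<open>Variables are numbered by increasing weight and \<open>Phi j\<close> involves smaller
  weights only, so changing the real part of the \<open>n\<close>-th variable leaves the
  \<open>W\<close> before it alone and translates \<open>W n\<close>.\<close>

lemma W_upd: assumes n: "n \<le> k" and j: "j \<le> n"
  shows "n \<noteq> 0 \<Longrightarrow> W j (q(n := complex_of_real x)) = (if j = n then complex_of_real x + \<i> * Phi n q else W j q)"
    and "W 0 (q(0 := z)) = z"
proof -
  show "W 0 (q(0 := z)) = z" by (simp add: W_0_apply)
  assume n0: "n \<noteq> 0"
  have "Phi j (q(n := complex_of_real x)) = Phi j q" if "j \<noteq> 0"
  proof (rule Phi_agree)
    fix j' assume j': "1 \<le> j'" "j' \<le> k" "wt t j' < wt t j"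
    have "j' \<noteq> n" using wt_mono[of j n] j' n j that by auto
    then show "Re ((q(n := complex_of_real x)) j') = Re (q j')" by simp
  qed (use that j n n0 in auto)
  then show "W j (q(n := complex_of_real x)) = (if j = n then complex_of_real x + \<i> * Phi n q else W j q)"
    using n0 by (auto simp: W_def fun_apply xv_def)
qed

text \<open>For the last variable: \<open>W n\<close> runs through a horizontal line when the others are fixed.\<close>

lemma W_independent:
  assumes "finite S" "\<And>\<alpha>. \<alpha> \<in> S \<Longrightarrow> Poly_Mapping.keys \<alpha> \<subseteq> {..<n}" "n \<le> k + 1"
    "\<And>q. (\<Sum>\<alpha>\<in>S. c \<alpha> * monomial_at \<alpha> (\<lambda>g. W g q)) = 0" "\<alpha> \<in> S"
  shows "c \<alpha> = 0"
  using assms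
proof (induction n arbitrary: S c \<alpha>)
  case 0
  have "\<beta> = 0" if "\<beta> \<in> S" for \<beta> using 0(2)[OF that] by simp
  then have "S = {0}" "\<alpha> = 0" using 0(5) by auto
  then show ?case using 0(4)[of 0] by simp
next
  case (Suc n)
  let ?l = "\<lambda>\<alpha>::nat \<Rightarrow>\<^sub>0 nat. Poly_Mapping.lookup \<alpha> n"
  define r where "r = (\<lambda>\<alpha>::nat \<Rightarrow>\<^sub>0 nat. Poly_Mapping.update n 0 \<alpha>)"
  have lr: "Poly_Mapping.lookup (r \<alpha>) i = (if i = n then 0 else Poly_Mapping.lookup \<alpha> i)" for \<alpha> i
    by (simp add: r_def lookup_update)
  have dec: "r \<alpha> + Poly_Mapping.single n (?l \<alpha>) = \<alpha>" for \<alpha>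
    by (rule poly_mapping_eqI) (auto simp: lookup_add lookup_single lr when_def)
  have kr: "Poly_Mapping.keys (r \<alpha>) \<subseteq> {..<n}" if "\<alpha> \<in> S" for \<alpha>
  proof
    fix x assume "x \<in> Poly_Mapping.keys (r \<alpha>)"
    then have "x \<noteq> n" "x \<in> Poly_Mapping.keys \<alpha>" by (auto simp: in_keys_iff lr split: if_splits)
    then show "x \<in> {..<n}" using Suc(3)[OF that] by fastforce
  qed
  have mon: "monomial_at \<alpha> p = monomial_at (r \<alpha>) p * p n ^ ?l \<alpha>" for \<alpha> p
    using monomial_at_add[of "r \<alpha>" "Poly_Mapping.single n (?l \<alpha>)" p] by (simp add: dec)
  define N where "N = Max (insert 0 (?l ` S))"
  have N: "?l \<alpha> \<le> N" if "\<alpha> \<in> S" for \<alpha> using Suc(2) that by (auto simp: N_def)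
  define h where "h e q = (\<Sum>\<alpha>\<in>{\<alpha>\<in>S. ?l \<alpha> = e}. c \<alpha> * monomial_at (r \<alpha>) (\<lambda>g. W g q))" for e q
  have tot: "(\<Sum>e\<le>N. h e q * W n q ^ e) = 0" for q
  proof -
    have "(\<Sum>e\<le>N. h e q * W n q ^ e) = (\<Sum>e\<le>N. \<Sum>\<alpha>\<in>{\<alpha>\<in>S. ?l \<alpha> = e}. c \<alpha> * monomial_at \<alpha> (\<lambda>g. W g q))"
    proof (rule sum.cong[OF refl])
      fix e
      show "h e q * W n q ^ e = (\<Sum>\<alpha>\<in>{\<alpha>\<in>S. ?l \<alpha> = e}. c \<alpha> * monomial_at \<alpha> (\<lambda>g. W g q))"
        unfolding h_def sum_distrib_right
      proof (rule sum.cong[OF refl])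
        fix \<alpha> assume "\<alpha> \<in> {\<alpha>\<in>S. ?l \<alpha> = e}"
        then show "c \<alpha> * monomial_at (r \<alpha>) (\<lambda>g. W g q) * W n q ^ e = c \<alpha> * monomial_at \<alpha> (\<lambda>g. W g q)"
          using mon[of \<alpha> "\<lambda>g. W g q"] by simp
      qed
    qed
    also have "\<dots> = (\<Sum>\<alpha>\<in>S. c \<alpha> * monomial_at \<alpha> (\<lambda>g. W g q))"
      by (rule sum.group) (use Suc(2) N in auto)
    finally show ?thesis using Suc(5) by simp
  qed
  have h_upd: "h e (q(n := complex_of_real x)) = h e q" for e q x
    unfolding h_def
  proof (rule sum.cong[OF refl])
    fix \<alpha> assume a: "\<alpha> \<in> {\<alpha>\<in>S. ?l \<alpha> = e}"
    have "W g (q(n := complex_of_real x)) = W g q" if "g \<in> Poly_Mapping.keys (r \<alpha>)" for g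
      using kr[of \<alpha>] a that W_upd(1)[of n g q x] Suc(4) by auto
    then show "c \<alpha> * monomial_at (r \<alpha>) (\<lambda>g. W g (q(n := complex_of_real x))) = c \<alpha> * monomial_at (r \<alpha>) (\<lambda>g. W g q)"
      unfolding monomial_at_def by (simp cong: prod.cong)
  qed
  have h0: "h e q = 0" if e: "e \<le> N" for e q
  proof -
    \<comment> \<open>The height of the line: for \<open>n = 0\<close> the coordinate
      \<open>z\<close> itself is moved along the real axis.\<close>
    define y where "y = (if n = 0 then 0 else \<i> * Phi n q)"
    have "(\<Sum>e\<le>N. h e q * (complex_of_real x + y) ^ e) = 0" for x
    proof -
      have "W n (q(n := complex_of_real x)) = complex_of_real x + y"
        using W_upd[of n n q x] W_upd(2)[of n n q "complex_of_real x"] Suc(4) by (cases "n = 0") (auto simp: y_def)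
      then show ?thesis using tot[of "q(n := complex_of_real x)"] by (simp add: h_upd)
    qed
    then show ?thesis by (rule poly_line_zero) (rule e)
  qed
  \<comment> \<open>The induction hypothesis is applied to the monomials with one fixed exponent of
    \<open>W n\<close>, stripped of that factor; by \<open>dec\<close> the stripping is injective on
    them.\<close>
  let ?e = "?l \<alpha>"
  let ?S = "{\<alpha>\<in>S. ?l \<alpha> = ?e}"
  have inj: "inj_on r ?S" by (rule inj_onI) (metis (mono_tags, lifting) dec mem_Collect_eq)
  have "c (r \<alpha> + Poly_Mapping.single n ?e) = 0"
  proof (rule Suc(1)[of "r ` ?S" "\<lambda>\<beta>. c (\<beta> + Poly_Mapping.single n ?e)" "r \<alpha>"])
    show "finite (r ` ?S)" using Suc(2) by simp
    show "Poly_Mapping.keys \<beta> \<subseteq> {..<n}" if "\<beta> \<in> r ` ?S" for \<beta> using that kr by auto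
    show "n \<le> k + 1" using Suc(4) by simp
    show "r \<alpha> \<in> r ` ?S" using Suc(6) by auto
    fix q
    have "(\<Sum>\<beta>\<in>r ` ?S. c (\<beta> + Poly_Mapping.single n ?e) * monomial_at \<beta> (\<lambda>g. W g q)) =
      (\<Sum>\<alpha>'\<in>?S. c (r \<alpha>' + Poly_Mapping.single n ?e) * monomial_at (r \<alpha>') (\<lambda>g. W g q))"
      by (subst sum.reindex[OF inj]) simp
    also have "\<dots> = h ?e q" unfolding h_def
    proof (rule sum.cong[OF refl])
      fix \<beta> assume "\<beta> \<in> ?S"
      then have "r \<beta> + Poly_Mapping.single n ?e = \<beta>" using dec[of \<beta>] by simp
      then show "c (r \<beta> + Poly_Mapping.single n ?e) * monomial_at (r \<beta>) (\<lambda>g. W g q) = c \<beta> * monomial_at (r \<beta>) (\<lambda>g. W g q)" by simp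
    qed
    finally show "(\<Sum>\<beta>\<in>r ` ?S. c (\<beta> + Poly_Mapping.single n ?e) * monomial_at \<beta> (\<lambda>g. W g q)) = 0"
      using h0[OF N[OF Suc(6)]] by simp
  qed
  then show ?case by (simp add: dec)
qed

section \<open>Tangency, and holomorphic fields from derivations\<close>

lemma defining_fun_deriv: assumes l: "2 \<le> l" "l \<le> \<rho>" and i: "i < dim_row (A l)" and n: "n = num_w t (l - 1) + i + 1"
  shows "((\<lambda>s. defining_fun t A l i (\<lambda>j. p j + complex_of_real s * v j)) has_real_derivative
    Im (v n) - Re (\<Sum>g\<in>gens. pd g (Phi n) p * xv g v)) (at 0)"
proof -
  have n': "1 \<le> n" "n \<le> k" using row_index(1)[OF l i] n by auto
  have "((\<lambda>s. Phi n (ray p v s)) has_vector_derivative (\<Sum>g\<in>gens. pd g (Phi n) p * xv g v)) (at 0)"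
    by (rule R_deriv[OF Phi_R[OF n']])
  then have "((\<lambda>s. Re (Phi n (ray p v s))) has_vector_derivative Re (\<Sum>g\<in>gens. pd g (Phi n) p * xv g v)) (at 0)"
    by (rule bounded_linear.has_vector_derivative[OF bounded_linear_Re])
  then have 1: "((\<lambda>s. Re (Phi n (ray p v s))) has_real_derivative Re (\<Sum>g\<in>gens. pd g (Phi n) p * xv g v)) (at 0)"
    by (simp add: has_real_derivative_iff_has_vector_derivative)
  have "((\<lambda>s. Im (p n) + s * Im (v n)) has_real_derivative Im (v n)) (at 0)"
    by (auto intro!: derivative_eq_intros)
  from DERIV_diff[OF this 1] show ?thesis unfolding defining_fun_Phi[OF l i n] ray_def by simp
qed

lemma tangent_iff: "tangent_at \<rho> t A p v \<longleftrightarrow>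
  (\<forall>n\<in>{1..k}. Im (v n) = Re (\<Sum>g\<in>gens. pd g (Phi n) p * xv g v))"
proof
  assume T: "tangent_at \<rho> t A p v"
  show "\<forall>n\<in>{1..k}. Im (v n) = Re (\<Sum>g\<in>gens. pd g (Phi n) p * xv g v)"
  proof
    fix n assume "n \<in> {1..k}"
    then have n: "1 \<le> n" "n \<le> k" by auto
    let ?l = "wt t n" and ?i = "n - num_w t (wt t n - 1) - 1"
    have l: "2 \<le> ?l" "?l \<le> \<rho>" using wt_ge2 wt_le_rho n by auto
    have i: "num_w t (?l - 1) < n" "?i < dim_row (A ?l)" using row_index(2)[OF l n refl] by auto
    have "((\<lambda>s. defining_fun t A ?l ?i (\<lambda>j. p j + complex_of_real s * v j)) has_real_derivative 0) (at 0)"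
      using T l i unfolding tangent_at_def by auto
    moreover have "((\<lambda>s. defining_fun t A ?l ?i (\<lambda>j. p j + complex_of_real s * v j)) has_real_derivative
      Im (v n) - Re (\<Sum>g\<in>gens. pd g (Phi n) p * xv g v)) (at 0)"
      by (rule defining_fun_deriv[OF l i(2)]) (use i(1) in simp)
    ultimately show "Im (v n) = Re (\<Sum>g\<in>gens. pd g (Phi n) p * xv g v)" using DERIV_unique by fastforce
  qed
next
  assume E: "\<forall>n\<in>{1..k}. Im (v n) = Re (\<Sum>g\<in>gens. pd g (Phi n) p * xv g v)"
  show "tangent_at \<rho> t A p v" unfolding tangent_at_def
  proof (intro ballI allI impI)
    fix l i assume "l \<in> {2..\<rho>}" and i: "i < dim_row (A l)"
    then have l: "2 \<le> l" "l \<le> \<rho>" by auto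
    have "num_w t (l - 1) + i + 1 \<in> {1..k}" using row_index(1)[OF l i] by auto
    from bspec[OF E this] show "((\<lambda>s. defining_fun t A l i (\<lambda>j. p j + complex_of_real s * v j)) has_real_derivative 0) (at 0)"
      using defining_fun_deriv[OF l i refl, of p v] by simp
  qed
qed

text \<open>Each \<open>D (W i)\<close> is CR, hence a polynomial in the \<open>W\<close>, and its
  coefficients define a polynomial holomorphic field. At a point \<open>p\<close> of the model
  \<open>W g p = p g\<close>, so this field has the components \<open>D (W i) p\<close>; tangency is
  then the chain rule for \<open>D (Phi n)\<close> together with the reality of
  \<open>D\<close>.\<close>

lemma aut_to_field:
  assumes D: "aut j D"
  shows "\<exists>X\<in>aut_CR k \<rho> t A. (\<forall>i. finite {\<alpha>. X i \<alpha> \<noteq> 0}) \<and>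
    (\<forall>i \<alpha>. X i \<alpha> \<noteq> 0 \<longrightarrow> i \<le> k \<and> Poly_Mapping.keys \<alpha> \<subseteq> {..k} \<and> int (mwt (wt t) \<alpha>) = int (wt t i) + j) \<and>
    (\<forall>i\<le>k. \<forall>q. D (W i) q = (\<Sum>\<alpha>\<in>{\<alpha>. X i \<alpha> \<noteq> 0}. X i \<alpha> * monomial_at \<alpha> (\<lambda>g. W g q)))"
proof -
  note dD = aut_der[OF D]
  define good where "good i c \<longleftrightarrow> finite {\<alpha>. c \<alpha> \<noteq> 0} \<and>
    (\<forall>\<alpha>. c \<alpha> \<noteq> 0 \<longrightarrow> Poly_Mapping.keys \<alpha> \<subseteq> {..k} \<and> int (mwt (wt t) \<alpha>) = int (wt t i) + j) \<and>
    (\<forall>q. D (W i) q = (\<Sum>\<alpha>\<in>{\<alpha>. c \<alpha> \<noteq> 0}. c \<alpha> * monomial_at \<alpha> (\<lambda>g. W g q)))" for i c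
  have "\<exists>c. good i c" if i: "i \<le> k" for i
  proof (cases "int (wt t i) + j < 0")
    case True
    then have "D (W i) = 0" using RW_neg[OF wd_RW[OF aut_wd[OF D] W_RW'[OF i]]] by simp
    then show ?thesis unfolding good_def by (intro exI[of _ "\<lambda>_. 0"]) (simp add: fun_apply)
  next
    case False
    then have "D (W i) \<in> RW (int (nat (int (wt t i) + j)))" using wd_RW[OF aut_wd[OF D] W_RW'[OF i]] by simp
    moreover have "Lb (D (W i)) = 0" using D i by (simp add: aut_def)
    ultimately have "D (W i) \<in> Sp W {..k} (wt t) (nat (int (wt t i) + j))" by (rule holomorphic_Sp)
    from Sp_coeffs[OF this] show ?thesis unfolding good_def using False by (auto 0 3)
  qed
  then obtain c where gc: "\<And>i. i \<le> k \<Longrightarrow> good i (c i)" using bchoice[of "{..k}" good] by auto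
  have c: "\<And>i. i \<le> k \<Longrightarrow> finite {\<alpha>. c i \<alpha> \<noteq> 0}"
    "\<And>i \<alpha>. i \<le> k \<Longrightarrow> c i \<alpha> \<noteq> 0 \<Longrightarrow> Poly_Mapping.keys \<alpha> \<subseteq> {..k} \<and> int (mwt (wt t) \<alpha>) = int (wt t i) + j"
    "\<And>i q. i \<le> k \<Longrightarrow> D (W i) q = (\<Sum>\<alpha>\<in>{\<alpha>. c i \<alpha> \<noteq> 0}. c i \<alpha> * monomial_at \<alpha> (\<lambda>g. W g q))"
    using gc unfolding good_def by blast+
  define X where "X i = (if i \<le> k then c i else 0)" for i
  have X1: "finite {\<alpha>. X i \<alpha> \<noteq> 0}" for i using c(1)[of i] by (auto simp: X_def fun_apply)
  have X2: "i \<le> k \<and> Poly_Mapping.keys \<alpha> \<subseteq> {..k} \<and> int (mwt (wt t) \<alpha>) = int (wt t i) + j" if "X i \<alpha> \<noteq> 0" for i \<alpha>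
    using c(2)[of i \<alpha>] that by (auto simp: X_def fun_apply split: if_splits)
  have X3: "D (W i) q = (\<Sum>\<alpha>\<in>{\<alpha>. X i \<alpha> \<noteq> 0}. X i \<alpha> * monomial_at \<alpha> (\<lambda>g. W g q))" if "i \<le> k" for i q
    using c(3)[OF that, of q] that by (simp add: X_def)
  have ge: "germ_eval (X i) p = (\<Sum>\<alpha>\<in>{\<alpha>. X i \<alpha> \<noteq> 0}. X i \<alpha> * monomial_at \<alpha> p)" for i p
  proof -
    have "germ_eval (X i) p = (\<Sum>\<^sub>\<infinity>\<alpha>\<in>{\<alpha>. X i \<alpha> \<noteq> 0}. X i \<alpha> * monomial_at \<alpha> p)"
      unfolding germ_eval_def by (rule infsum_cong_neutral) auto
    then show ?thesis using X1 by simp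
  qed
  have hv: "X \<in> hol_vfields (1 + k)"
    unfolding hol_vfields_def mem_Collect_eq
  proof (intro conjI allI impI)
    fix i assume "i < 1 + k"
    show "X i \<in> hol_germs (1 + k)" unfolding hol_germs_def mem_Collect_eq
    proof (intro conjI allI impI)
      fix \<alpha> assume "X i \<alpha> \<noteq> 0" then show "Poly_Mapping.keys \<alpha> \<subseteq> {..<1 + k}" using X2[of i \<alpha>] by fastforce
    next
      have "finite {\<alpha> \<in> UNIV. norm (X i \<alpha> * monomial_at \<alpha> (\<lambda>_. complex_of_real 1)) \<noteq> 0}"
        by (rule finite_subset[OF _ X1[of i]]) auto
      then have "(\<lambda>\<alpha>. norm (X i \<alpha> * monomial_at \<alpha> (\<lambda>_. complex_of_real 1))) summable_on UNIV"
        by (rule finite_nonzero_values_imp_summable_on)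
      then show "\<exists>r>0. (\<lambda>\<alpha>. norm (X i \<alpha> * monomial_at \<alpha> (\<lambda>_. complex_of_real r))) summable_on UNIV"
        by (intro exI[of _ 1]) simp
    qed
  qed (auto simp: X_def)
  have tan: "tangent_at \<rho> t A p (\<lambda>i. germ_eval (X i) p)" if p: "p \<in> model_set k \<rho> t A" for p
    unfolding tangent_iff
  proof
    fix n assume "n \<in> {1..k}"
    then have n: "1 \<le> n" "n \<le> k" by auto
    have Wp: "W i p = p i" if "i \<le> k" for i
      using model_W[OF p order_refl, of i] wt_le_rho[of i] that W_0_apply by (cases "i = 0") auto
    have v: "germ_eval (X i) p = D (W i) p" if i: "i \<le> k" for i
    proof -
      have "monomial_at \<alpha> (\<lambda>g. W g p) = monomial_at \<alpha> p" if "X i \<alpha> \<noteq> 0" for \<alpha>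
        unfolding monomial_at_def by (rule prod.cong) (use X2[OF that] Wp in auto)
      then show ?thesis unfolding ge X3[OF i] by (intro sum.cong) auto
    qed
    have real: "Im (D (xv (Suc i)) p) = 0" "Im (D (Phi i) p) = 0" if "1 \<le> i" "i \<le> k" for i
    proof -
      have "cj (D (xv (Suc i))) = D (xv (Suc i))" "cj (D (Phi i)) = D (Phi i)"
        using aut_cj[OF D, of "xv (Suc i)"] aut_cj[OF D, of "Phi i"] Phi_real[OF that] that by (simp_all add: cj_xv)
      from fun_cong[OF this(1), of p] fun_cong[OF this(2), of p]
      show "Im (D (xv (Suc i)) p) = 0" "Im (D (Phi i) p) = 0" by (simp_all add: fun_apply complex_eq_iff)
    qed
    have dW: "D (W i) p = D (xv (Suc i)) p + \<i> * D (Phi i) p" if "1 \<le> i" "i \<le> k" for i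
      using der_W[OF dD that] by (simp add: fun_apply)
    have x: "xv g (\<lambda>i. germ_eval (X i) p) = D (xv g) p" if "g \<le> k + 1" for g
      using that
    proof (rule gens_cases)
      assume "g = 0" then show ?thesis by (simp add: xv_def v) (simp add: W_0 xv_def)
    next
      assume "g = 1"
      moreover have "D (xv 1) = cj (D (xv 0))" using aut_cj[OF D, of "xv 0"] by (simp add: cj_xv)
      ultimately show ?thesis using v[of 0] by (simp add: fun_apply W_0) (simp add: xv_def)
    next
      fix i assume i: "1 \<le> i" "i \<le> k" "g = Suc i"
      have "xv g (\<lambda>i. germ_eval (X i) p) = complex_of_real (Re (D (W i) p))" using i v[of i] by (simp add: xv_def)
      also have "\<dots> = D (xv g) p" using real[OF i(1,2)] dW[OF i(1,2)] i by (simp add: complex_eq_iff)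
      finally show ?thesis .
    qed
    have "(\<Sum>g\<in>gens. pd g (Phi n) p * xv g (\<lambda>i. germ_eval (X i) p)) = D (Phi n) p"
      unfolding der_expand[OF dD Phi_R[OF n]] fun_apply by (rule sum.cong) (auto simp: x mult.commute)
    then show "Im (germ_eval (X n) p) = Re (\<Sum>g\<in>gens. pd g (Phi n) p * xv g (\<lambda>i. germ_eval (X i) p))"
      using v[OF n(2)] dW[OF n] real[OF n] by simp
  qed
  have "X \<in> aut_CR k \<rho> t A" unfolding aut_CR_def using hv tan by (auto intro!: exI[of _ 1])
  then show ?thesis using X1 X2 X3 by (intro bexI[of _ X]) auto
qed

section \<open>Homogeneous parts of a germ\<close>

definition mon_wt :: "nat \<Rightarrow> (nat \<Rightarrow>\<^sub>0 nat) set" where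
  "mon_wt n = {\<alpha>. Poly_Mapping.keys \<alpha> \<subseteq> {..k} \<and> mwt (wt t) \<alpha> = n}"

text \<open>The part of weight \<open>n\<close> of the \<open>i\<close>-th component, already
  restricted to the model through the \<open>W\<close>.\<close>

definition hom_part :: "vfield \<Rightarrow> nat \<Rightarrow> nat \<Rightarrow> pfun" where
  "hom_part X i n = (\<lambda>q. \<Sum>\<alpha>\<in>mon_wt n. X i \<alpha> * monomial_at \<alpha> (\<lambda>g. W g q))"

lemma finite_mon_wt: "finite (mon_wt n)" unfolding mon_wt_def by (rule finite_mwt[OF wt_pos])

lemma hom_part_Sp: "hom_part X i n \<in> Sp W {..k} (wt t) n"
proof -
  have "(\<Sum>\<alpha>\<in>mon_wt n. (\<lambda>q. X i \<alpha> * monomial_at \<alpha> (\<lambda>g. W g q))) \<in> Sp W {..k} (wt t) n"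
    by (intro Sp_sum Sp_mono) (auto simp: mon_wt_def)
  also have "(\<Sum>\<alpha>\<in>mon_wt n. (\<lambda>q. X i \<alpha> * monomial_at \<alpha> (\<lambda>g. W g q))) = hom_part X i n"
    by (auto simp: hom_part_def fun_eq_iff fun_apply)
  finally show ?thesis .
qed

lemma hom_part_zero: assumes "hom_part X i n = 0" "\<alpha> \<in> mon_wt n" shows "X i \<alpha> = 0"
proof (rule W_independent[OF finite_mon_wt[of n], of "k + 1"])
  show "(\<Sum>\<alpha>\<in>mon_wt n. X i \<alpha> * monomial_at \<alpha> (\<lambda>g. W g q)) = 0" for q
    using fun_cong[OF assms(1), of q] by (simp add: hom_part_def fun_apply)
qed (use assms in \<open>auto simp: mon_wt_def\<close>)

text \<open>The power series fields all of whose weighted homogeneous parts are formally tangent to the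
  model; these conditions are linear, so no closure property of \<open>aut_CR\<close> is needed.\<close>

definition formal_aut :: "vfield set" where
  "formal_aut = {X. (\<forall>i \<alpha>. X i \<alpha> \<noteq> 0 \<longrightarrow> i \<le> k \<and> Poly_Mapping.keys \<alpha> \<subseteq> {..k}) \<and>
    (\<forall>i\<in>{1..k}. \<forall>N q. complex_of_real (Im (hom_part X i N q)) = (\<Sum>g\<in>gens. pd g (Phi i) q *
      (if gw g \<le> wt t i \<and> wt t i \<le> N + gw g then xv g (\<lambda>i'. hom_part X i' (N + gw g - wt t i) q) else 0)))}"

lemma W_dil: "i \<le> k \<Longrightarrow> W i (dil s q) = complex_of_real (s ^ wt t i) * W i q"
  by (rule dil_RW[OF W_RW'])

lemma monomial_dil: assumes "Poly_Mapping.keys \<alpha> \<subseteq> {..k}"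
  shows "monomial_at \<alpha> (mpt k (dil s q)) = complex_of_real (s ^ mwt (wt t) \<alpha>) * monomial_at \<alpha> (\<lambda>g. W g q)"
proof -
  have "monomial_at \<alpha> (mpt k (dil s q)) = (\<Prod>i\<in>Poly_Mapping.keys \<alpha>. complex_of_real (s ^ (Poly_Mapping.lookup \<alpha> i * wt t i)) * W i q ^ Poly_Mapping.lookup \<alpha> i)"
    unfolding monomial_at_def
    by (rule prod.cong) (use assms W_dil in \<open>auto simp: mpt_def power_mult_distrib power_mult mult.commute\<close>)
  then show ?thesis by (simp add: prod.distrib monomial_at_def mwt_def power_sum)
qed

text \<open>The Taylor series converges absolutely at the dilated point and may be regrouped by
  weight; a monomial of weight \<open>n\<close> scales by \<open>s ^ n\<close>, and there are
  finitely many of each weight.\<close>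

lemma germ_eval_sums:
  assumes X: "\<And>\<alpha>. X i \<alpha> \<noteq> 0 \<Longrightarrow> Poly_Mapping.keys \<alpha> \<subseteq> {..k}"
    and r: "(\<lambda>\<alpha>. norm (X i \<alpha> * monomial_at \<alpha> (\<lambda>_. complex_of_real r))) summable_on UNIV" "r > 0"
    and p: "\<And>j. norm (mpt k (dil s q) j) \<le> r"
  shows "(\<lambda>n. hom_part X i n q * complex_of_real s ^ n) sums germ_eval (X i) (mpt k (dil s q))"
proof -
  let ?f = "\<lambda>\<alpha>. X i \<alpha> * monomial_at \<alpha> (mpt k (dil s q))"
  have "?f abs_summable_on UNIV"
  proof (rule abs_summable_on_comparison_test'[OF r(1)])
    fix \<alpha>
    have "norm (monomial_at \<alpha> (mpt k (dil s q))) \<le> norm (monomial_at \<alpha> (\<lambda>_. complex_of_real r))"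
      unfolding monomial_at_def prod_norm[symmetric]
      by (intro prod_mono) (use p r(2) in \<open>auto simp: norm_power intro!: power_mono\<close>)
    then show "norm (?f \<alpha>) \<le> norm (X i \<alpha> * monomial_at \<alpha> (\<lambda>_. complex_of_real r))"
      by (simp add: norm_mult mult_left_mono)
  qed
  then have "?f summable_on UNIV" by (rule abs_summable_summable)
  then have hs: "(?f has_sum germ_eval (X i) (mpt k (dil s q))) UNIV" unfolding germ_eval_def by (rule has_sum_infsum)
  have bij: "bij_betw (\<lambda>(n, \<alpha>). \<alpha>) (Sigma UNIV (\<lambda>n. {\<alpha>. mwt (wt t) \<alpha> = n})) (UNIV :: (nat \<Rightarrow>\<^sub>0 nat) set)"
    by (rule bij_betw_byWitness[where f' = "\<lambda>\<alpha>. (mwt (wt t) \<alpha>, \<alpha>)"]) auto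
  have "((\<lambda>x. ?f ((\<lambda>(n, \<alpha>). \<alpha>) x)) has_sum germ_eval (X i) (mpt k (dil s q))) (Sigma UNIV (\<lambda>n. {\<alpha>. mwt (wt t) \<alpha> = n}))"
    by (rule has_sum_reindex_bij_betw[OF bij, THEN iffD2, OF hs])
  then have "((\<lambda>n. hom_part X i n q * complex_of_real s ^ n) has_sum germ_eval (X i) (mpt k (dil s q))) UNIV"
  proof (rule has_sum_SigmaD)
    fix n
    have "hom_part X i n q * complex_of_real s ^ n = (\<Sum>\<alpha>\<in>mon_wt n. ?f \<alpha>)"
      unfolding hom_part_def sum_distrib_right
      by (rule sum.cong) (auto simp: mon_wt_def monomial_dil)
    then have "(?f has_sum (hom_part X i n q * complex_of_real s ^ n)) (mon_wt n)"
      using has_sum_finite[OF finite_mon_wt, of ?f n] by simp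
    then have "(?f has_sum (hom_part X i n q * complex_of_real s ^ n)) {\<alpha>. mwt (wt t) \<alpha> = n}"
      by (subst has_sum_cong_neutral[where T = "mon_wt n" and g = ?f]) (use X in \<open>auto simp: mon_wt_def\<close>)
    then show "((\<lambda>y. ?f ((\<lambda>(n, \<alpha>). \<alpha>) (n, y))) has_sum (hom_part X i n q * complex_of_real s ^ n)) {\<alpha>. mwt (wt t) \<alpha> = n}"
      by simp
  qed
  then show ?thesis by (rule has_sum_imp_sums)
qed

lemma xv_sums: assumes "\<And>i. i \<le> k \<Longrightarrow> (\<lambda>n. a i n * complex_of_real s ^ n) sums v i" "g \<le> k + 1"
  shows "(\<lambda>n. xv g (\<lambda>i. a i n) * complex_of_real s ^ n) sums xv g v"
  using assms(2)
proof (rule gens_cases)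
  assume "g = 0" then show ?thesis using assms(1)[of 0] by (simp add: xv_def)
next
  assume "g = 1" then show ?thesis using assms(1)[of 0] sums_cnj[of "\<lambda>n. a 0 n * complex_of_real s ^ n" "v 0"] by (simp add: xv_def)
next
  fix i assume i: "1 \<le> i" "i \<le> k" "g = Suc i"
  have "(\<lambda>n. Re (a i n * complex_of_real s ^ n)) sums Re (v i)" by (rule sums_Re[OF assms(1)[OF i(2)]])
  then have "(\<lambda>n. complex_of_real (Re (a i n) * s ^ n)) sums complex_of_real (Re (v i))"
    by (intro sums_of_real) (simp flip: of_real_power)
  then show ?thesis using i by (simp add: xv_def)
qed

lemma sums_shift: assumes "(\<lambda>n. b n * x ^ n) sums (B::complex)"
  shows "(\<lambda>n. (if m \<le> n then b (n - m) else 0) * x ^ n) sums (x ^ m * B)"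
proof -
  have "(\<lambda>n. x ^ m * (b n * x ^ n)) sums (x ^ m * B)" by (rule sums_mult[OF assms])
  then have "(\<lambda>n. (if m \<le> n + m then b (n + m - m) else 0) * x ^ (n + m)) sums (x ^ m * B)"
    by (simp add: power_add mult_ac)
  then show ?thesis
    using sums_iff_shift[of "\<lambda>n. (if m \<le> n then b (n - m) else 0) * x ^ n" m "x ^ m * B"] by simp
qed

text \<open>On a dilation orbit tangency is an identity between convergent power series in
  \<open>s > 0\<close>, and its coefficients are compared. The factor \<open>pd g (Phi i)\<close>
  contributes the power \<open>wt t i - gw g\<close>, whence the shifted index in
  \<open>formal_aut\<close>; the conditional there guards against truncated subtraction.\<close>

lemma aut_CR_formal: "aut_CR k \<rho> t A \<subseteq> formal_aut"
proof
  fix X assume X: "X \<in> aut_CR k \<rho> t A"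
  then have hv: "X \<in> hol_vfields (1 + k)" by (simp add: aut_CR_def)
  obtain r0 where r0: "r0 > 0" "\<And>p. p \<in> model_set k \<rho> t A \<Longrightarrow> (\<And>i. i \<le> k \<Longrightarrow> norm (p i) < r0) \<Longrightarrow> tangent_at \<rho> t A p (\<lambda>i. germ_eval (X i) p)"
    using X by (auto simp: aut_CR_def)
  have gi: "X i \<in> hol_germs (1 + k)" if "i \<le> k" for i using hv that by (auto simp: hol_vfields_def)
  have s0: "X i = 0" if "\<not> i \<le> k" for i using hv that by (auto simp: hol_vfields_def)
  have supp: "i \<le> k \<and> Poly_Mapping.keys \<alpha> \<subseteq> {..k}" if "X i \<alpha> \<noteq> 0" for i \<alpha>
  proof -
    have "i \<le> k" by (rule ccontr) (use s0[of i] that in \<open>simp add: zero_fun_apply\<close>)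
    then have "Poly_Mapping.keys \<alpha> \<subseteq> {..<1 + k}" using gi[of i] that by (auto simp: hol_germs_def)
    then show ?thesis using \<open>i \<le> k\<close> by fastforce
  qed
  have "\<exists>r>0. (\<lambda>\<alpha>. norm (X i \<alpha> * monomial_at \<alpha> (\<lambda>_. complex_of_real r))) summable_on UNIV" if "i \<le> k" for i
    using gi[OF that] by (auto simp: hol_germs_def)
  then obtain r where r: "\<And>i. i \<le> k \<Longrightarrow> r i > 0" "\<And>i. i \<le> k \<Longrightarrow> (\<lambda>\<alpha>. norm (X i \<alpha> * monomial_at \<alpha> (\<lambda>_. complex_of_real (r i)))) summable_on UNIV"
    by metis
  define r1 where "r1 = Min (insert r0 (r ` {..k}))"
  have r1: "r1 > 0" "r1 \<le> r0" "\<And>i. i \<le> k \<Longrightarrow> r1 \<le> r i" using r0(1) r(1) unfolding r1_def by (auto intro!: Min_le simp del: Min_insert)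
  show "X \<in> formal_aut" unfolding formal_aut_def mem_Collect_eq
  proof (intro conjI ballI allI)
    show "X i \<alpha> \<noteq> 0 \<longrightarrow> i \<le> k \<and> Poly_Mapping.keys \<alpha> \<subseteq> {..k}" for i \<alpha> using supp by blast
    fix i N q assume "i \<in> {1..k}"
    then have i: "1 \<le> i" "i \<le> k" by auto
    define M where "M = Max (insert 1 ((\<lambda>j. norm (W j q)) ` {..k}))"
    have M: "1 \<le> M" "\<And>j. j \<le> k \<Longrightarrow> norm (W j q) \<le> M" unfolding M_def by (rule Max_ge; simp)+
    \<comment> \<open>Weights are at least 1 and \<open>s < 1\<close>, so every coordinate of the
      dilated point is at most \<open>s * M\<close>. This keeps it inside the polydisc of radius
      \<open>r1\<close>, where all series converge and tangency holds.\<close>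
    define \<epsilon> where "\<epsilon> = min 1 (r1 / (2 * M))"
    have \<epsilon>: "\<epsilon> > 0" using r1 M(1) by (simp add: \<epsilon>_def)
    have small: "norm (mpt k (dil s q) j) < r1" if s: "0 < s" "s < \<epsilon>" for s j
    proof (cases "j \<le> k")
      case True
      have "s ^ wt t j \<le> s ^ 1" by (rule power_decreasing) (use s wt_pos[OF True] in \<open>auto simp: \<epsilon>_def\<close>)
      then have "norm (mpt k (dil s q) j) \<le> s * M"
        using True M(2)[OF True] s by (auto simp: mpt_def W_dil norm_mult norm_power intro!: mult_mono)
      also have "\<dots> < r1"
      proof -
        have "s < r1 / (2 * M)" using s by (simp add: \<epsilon>_def)
        then have "s * (2 * M) < r1" using M(1) by (simp add: pos_less_divide_eq)
        moreover have "s * M > 0" using s M(1) by simp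
        ultimately show ?thesis by simp
      qed
      finally show ?thesis .
    qed (use r1 in \<open>simp add: mpt_def\<close>)
    define C where "C n = complex_of_real (Im (hom_part X i n q)) - (\<Sum>g\<in>gens. pd g (Phi i) q *
      (if gw g \<le> wt t i \<and> wt t i \<le> n + gw g then xv g (\<lambda>i'. hom_part X i' (n + gw g - wt t i) q) else 0))" for n
    have "(\<lambda>n. C n * complex_of_real s ^ n) sums 0" if s: "0 < s" "s < \<epsilon>" for s
    proof -
      let ?p = "mpt k (dil s q)"
      define v where "v j = germ_eval (X j) ?p" for j
      have vs: "(\<lambda>n. hom_part X j n q * complex_of_real s ^ n) sums v j" if j: "j \<le> k" for j unfolding v_def
      proof (rule germ_eval_sums[where X = X and i = j and r = "r j", OF _ r(2)[OF j] r(1)[OF j]])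
        show "norm (mpt k (dil s q) j') \<le> r j" for j'
          using small[OF s, of j'] r1(3)[OF j] by linarith
      qed (use supp in blast)
      have Pp: "?p \<in> model_set k \<rho> t A" by (rule mpt_model) auto
      have "tangent_at \<rho> t A ?p v" unfolding v_def[abs_def] by (rule r0(2)[OF Pp]) (use small[OF s] r1(2) in \<open>auto intro: order_less_le_trans\<close>)
      then have t: "Im (v i) = Re (\<Sum>g\<in>gens. pd g (Phi i) ?p * xv g v)" unfolding tangent_iff using i by auto
      have pdp: "pd g (Phi i) ?p = (if gw g \<le> wt t i then complex_of_real (s ^ (wt t i - gw g)) * pd g (Phi i) q else 0)" if g: "g \<le> k + 1" for g
      proof (cases "gw g \<le> wt t i")
        case True
        have rw: "pd g (Phi i) \<in> RW (int (wt t i - gw g))" using pd_RW[OF Phi_RW[OF i] g] True by (simp add: of_nat_diff)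
        have "pd g (Phi i) \<in> low_fun k"
        proof -
          interpret graded_family "\<lambda>_. low_fun k" by (rule graded_low_fun)
          have "pd g (Phi i) \<in> Sp X1 {..k+1} v2 (wt t i - gw g)" by (rule RW_Sp1[OF rw])
          then show ?thesis
            by (rule Sp_closed) (use xv_low_fun in \<open>auto simp: X1_def\<close>)
        qed
        then have "pd g (Phi i) ?p = pd g (Phi i) (dil s q)"
          by (rule low_funD) (auto simp: mpt_def W_0_apply W_Re)
        then show ?thesis using dil_RW[OF rw, of s q] True by simp
      next
        case False
        then have "pd g (Phi i) = 0" using RW_neg[OF pd_RW[OF Phi_RW[OF i] g]] by simp
        then show ?thesis using False by (simp add: fun_apply)
      qed
      have T: "(\<lambda>n. (pd g (Phi i) q * (if gw g \<le> wt t i \<and> wt t i \<le> n + gw g then xv g (\<lambda>i'. hom_part X i' (n + gw g - wt t i) q) else 0)) * complex_of_real s ^ n)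
        sums (pd g (Phi i) ?p * xv g v)" if g: "g \<in> gens" for g
      proof (cases "gw g \<le> wt t i")
        case True
        have "(\<lambda>n. (if wt t i - gw g \<le> n then xv g (\<lambda>i'. hom_part X i' (n - (wt t i - gw g)) q) else 0) * complex_of_real s ^ n) sums (complex_of_real s ^ (wt t i - gw g) * xv g v)"
          by (rule sums_shift[OF xv_sums[OF vs]]) (use g in auto)
        from sums_mult[OF this, of "pd g (Phi i) q"] have
          "(\<lambda>n. pd g (Phi i) q * ((if wt t i - gw g \<le> n then xv g (\<lambda>i'. hom_part X i' (n - (wt t i - gw g)) q) else 0) * complex_of_real s ^ n)) sums (pd g (Phi i) ?p * xv g v)"
          using pdp[of g] g True by (simp add: mult_ac)
        moreover have "pd g (Phi i) q * ((if wt t i - gw g \<le> n then xv g (\<lambda>i'. hom_part X i' (n - (wt t i - gw g)) q) else 0) * complex_of_real s ^ n) =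
          (pd g (Phi i) q * (if gw g \<le> wt t i \<and> wt t i \<le> n + gw g then xv g (\<lambda>i'. hom_part X i' (n + gw g - wt t i) q) else 0)) * complex_of_real s ^ n" for n
          using True by (auto simp: mult.assoc)
        ultimately show ?thesis by simp
      next
        case False
        then show ?thesis using pdp[of g] g by simp
      qed
      have sumT: "(\<lambda>n. \<Sum>g\<in>gens. (pd g (Phi i) q * (if gw g \<le> wt t i \<and> wt t i \<le> n + gw g then xv g (\<lambda>i'. hom_part X i' (n + gw g - wt t i) q) else 0)) * complex_of_real s ^ n)
        sums (\<Sum>g\<in>gens. pd g (Phi i) ?p * xv g v)" by (rule sums_sum[OF T])
      have I: "(\<lambda>n. complex_of_real (Im (hom_part X i n q)) * complex_of_real s ^ n) sums complex_of_real (Im (v i))"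
      proof -
        have "(\<lambda>n. complex_of_real (Im (hom_part X i n q * complex_of_real s ^ n))) sums complex_of_real (Im (v i))"
          by (rule sums_of_real[OF sums_Im[OF vs[OF i(2)]]])
        then show ?thesis by (simp flip: of_real_power)
      qed
      \<comment> \<open>Tangency equates \<open>Im (v i)\<close> only with the real part of the sum.
        As \<open>Phi i\<close> is real, the sum is real itself, and the identity becomes one
        between complex power series.\<close>
      have realS: "Im (\<Sum>g\<in>gens. pd g (Phi i) ?p * xv g v) = 0"
      proof -
        have "pd 0 (Phi i) ?p = cnj (pd 1 (Phi i) ?p)" "cnj (pd (Suc j) (Phi i) ?p) = pd (Suc j) (Phi i) ?p" if "1 \<le> j" "j \<le> k" for j
          using pd_cj[OF _ Phi_R[OF i], of 1] pd_cj[OF _ Phi_R[OF i], of "Suc j"] Phi_real[OF i] that by (auto simp: fun_eq_iff fun_apply)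
        then have 1: "pd 0 (Phi i) ?p = cnj (pd 1 (Phi i) ?p)" "\<And>j. j \<in> {1..k} \<Longrightarrow> Im (pd (Suc j) (Phi i) ?p) = 0" using i by (auto simp: complex_eq_iff)
        then show ?thesis by (simp add: sum_gens xv_def algebra_simps)
      qed
      have "complex_of_real (Im (v i)) = (\<Sum>g\<in>gens. pd g (Phi i) ?p * xv g v)"
        using t realS by (simp add: complex_eq_iff)
      then show ?thesis using sums_diff[OF I sumT] by (simp add: C_def left_diff_distrib sum_distrib_right)
    qed
    then have "C N = 0" by (rule powser_real_zero[OF \<epsilon>])
    then show "complex_of_real (Im (hom_part X i N q)) = (\<Sum>g\<in>gens. pd g (Phi i) q *
      (if gw g \<le> wt t i \<and> wt t i \<le> N + gw g then xv g (\<lambda>i'. hom_part X i' (N + gw g - wt t i) q) else 0))"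
      by (simp add: C_def)
  qed
qed

end

declare single_one [simp del]

context model
begin

section \<open>From formal fields back to derivations\<close>

lemma formal_aut_support: "X \<in> formal_aut \<Longrightarrow> X i \<alpha> \<noteq> 0 \<Longrightarrow> i \<le> k \<and> Poly_Mapping.keys \<alpha> \<subseteq> {..k}"
  unfolding formal_aut_def by blast

text \<open>The restriction to the model of the weight \<open>j\<close> part of \<open>X\<close>.
  The case of negative weight is separated because \<open>nat\<close> would send it to weight
  0.\<close>

definition comp :: "vfield \<Rightarrow> int \<Rightarrow> nat \<Rightarrow> pfun" where
  "comp X j i = (if 0 \<le> int (wt t i) + j then hom_part X i (nat (int (wt t i) + j)) else 0)"

text \<open>On the real variables only the real parts of the components are prescribed. That the
  imaginary parts come out right is tangency, and is the content of \<open>compD_W\<close>.\<close>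

definition compD :: "vfield \<Rightarrow> int \<Rightarrow> pfun \<Rightarrow> pfun" where
  "compD X j = mk (\<lambda>g. if g = 0 then comp X j 0 else if g = 1 then cj (comp X j 0)
     else cst (1/2) * (comp X j (g - 1) + cj (comp X j (g - 1))))"

lemma comp_RW: "comp X j i \<in> RW (int (wt t i) + j)" "Lb (comp X j i) = 0"
  using Sp_W_R[OF subset_refl hom_part_Sp[of X i "nat (int (wt t i) + j)"]]
  by (auto simp: comp_def RW_0 der_0[OF der_Lb])

lemma compD_wd: "wd j (compD X j)" "cjd (compD X j) = compD X j"
  and compD_xv: "compD X j (xv 0) = comp X j 0" "compD X j (xv 1) = cj (comp X j 0)"
    "1 \<le> i \<Longrightarrow> i \<le> k \<Longrightarrow> compD X j (xv (Suc i)) = cst (1/2) * (comp X j i + cj (comp X j i))"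
proof -
  have x: "compD X j (xv g) = (if g = 0 then comp X j 0 else if g = 1 then cj (comp X j 0)
     else cst (1/2) * (comp X j (g - 1) + cj (comp X j (g - 1))))" if "g \<le> k + 1" for g
    unfolding compD_def by (rule mk_xv[OF that])
  show x0: "compD X j (xv 0) = comp X j 0" "compD X j (xv 1) = cj (comp X j 0)"
    and xs: "1 \<le> i \<Longrightarrow> i \<le> k \<Longrightarrow> compD X j (xv (Suc i)) = cst (1/2) * (comp X j i + cj (comp X j i))" for i
    by (simp_all add: x)
  have rw: "compD X j (xv g) \<in> RW (int (gw g) + j)" if "g \<le> k + 1" for g
    using that comp_RW(1)[of X j 0] wt_0
    by (rule_tac gens_cases) (auto simp: x0 xs intro!: RW_smult RW_add RW_cj comp_RW)
  have "der (compD X j)" unfolding compD_def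
  proof (rule der_mk)
    fix g assume g: "g \<le> k + 1"
    show "(if g = 0 then comp X j 0 else if g = 1 then cj (comp X j 0)
     else cst (1/2) * (comp X j (g - 1) + cj (comp X j (g - 1)))) \<in> R"
      using RW_imp_R[OF rw[OF g]] unfolding x[OF g] .
  qed
  then show "wd j (compD X j)" by (rule wdI) (rule rw)
  show "cjd (compD X j) = compD X j"
    by (rule real_der[OF \<open>der (compD X j)\<close>]) (simp_all add: x0 xs cj_mult cj_add add.commute)
qed

text \<open>The real parts agree by construction. The imaginary part of the value on
  \<open>W i\<close> is \<open>compD X j (Phi i)\<close>, and formal tangency in weight
  \<open>wt t i + j\<close> identifies it with the imaginary part of
  \<open>comp X j i\<close>.\<close>

lemma compD_W: assumes X: "X \<in> formal_aut" and i: "i \<le> k" shows "compD X j (W i) = comp X j i"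
proof (cases "i = 0")
  case True then show ?thesis by (simp add: W_0 compD_xv)
next
  case False
  then have i': "1 \<le> i" "i \<le> k" using i by auto
  let ?D = "compD X j"
  have dD: "der ?D" by (rule wd_der[OF compD_wd(1)])
  have P: "?D (Phi i) q = complex_of_real (Im (comp X j i q))" for q
  proof (cases "int (wt t i) + j < 0")
    case True
    then have "?D (Phi i) = 0" using RW_neg[OF wd_RW[OF compD_wd(1) Phi_RW[OF i']]] by simp
    then show ?thesis using True by (simp add: comp_def fun_apply)
  next
    case False
    define N where "N = nat (int (wt t i) + j)"
    have N: "int N = int (wt t i) + j" using False by (simp add: N_def)
    have "?D (Phi i) q = (\<Sum>g\<in>gens. ?D (xv g) q * pd g (Phi i) q)"
      unfolding der_expand[OF dD Phi_R[OF i']] by (simp add: fun_apply)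
    also have "\<dots> = (\<Sum>g\<in>gens. pd g (Phi i) q *
      (if gw g \<le> wt t i \<and> wt t i \<le> N + gw g then xv g (\<lambda>i'. hom_part X i' (N + gw g - wt t i) q) else 0))"
    proof (rule sum.cong[OF refl])
      fix g assume "g \<in> gens"
      then have g: "g \<le> k + 1" by simp
      consider "wt t i < gw g" | "gw g \<le> wt t i" "wt t i \<le> N + gw g" | "N + gw g < wt t i" by linarith
      then show "?D (xv g) q * pd g (Phi i) q = pd g (Phi i) q *
        (if gw g \<le> wt t i \<and> wt t i \<le> N + gw g then xv g (\<lambda>i'. hom_part X i' (N + gw g - wt t i) q) else 0)"
      proof cases
        case 1
        then have "pd g (Phi i) = 0" using RW_neg[OF pd_RW[OF Phi_RW[OF i'] g]] by simp
        then show ?thesis by (simp add: fun_apply)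
      next
        case 2
        define n where "n = N + gw g - wt t i"
        have n: "int n = int (gw g) + j" using 2 N by (simp add: n_def of_nat_diff)
        have c: "comp X j i' = hom_part X i' n" if "wt t i' = gw g" for i'
          unfolding comp_def that n[symmetric] by simp
        have "?D (xv g) q = xv g (\<lambda>i'. hom_part X i' n q)"
          using g
        proof (rule gens_cases)
          assume "g = 0" then show ?thesis using c[of 0] wt_0 by (simp add: compD_xv) (simp add: xv_def)
        next
          assume "g = 1" then show ?thesis using c[of 0] wt_0 by (simp add: compD_xv cj_apply) (simp add: xv_def)
        next
          fix i' assume "1 \<le> i'" "i' \<le> k" "g = Suc i'"
          then show ?thesis using c[of i'] by (simp add: compD_xv fun_apply) (simp add: xv_def complex_eq_iff)
        qed
        then show ?thesis using 2 by (simp add: n_def)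
      next
        case 3
        then have "?D (xv g) = 0" using RW_neg[OF wd_RW[OF compD_wd(1) RW_xv[OF g]]] N by simp
        then show ?thesis using 3 by (simp add: fun_apply)
      qed
    qed
    also have "\<dots> = complex_of_real (Im (hom_part X i N q))"
      using X i' unfolding formal_aut_def by (auto simp del: of_real_eq_iff)
    also have "hom_part X i N = comp X j i" using False by (simp add: comp_def N_def)
    finally show ?thesis .
  qed
  show ?thesis
    unfolding der_W[OF dD i'] compD_xv(3)[OF i'] by (rule ext) (simp add: fun_apply P complex_eq_iff)
qed

lemma compD_aut: "X \<in> formal_aut \<Longrightarrow> aut j (compD X j)"
  unfolding aut_def using compD_wd compD_W comp_RW(2) by auto

lemma compD_zero: assumes X: "X \<in> formal_aut" and z: "compD X j = (\<lambda>_. 0)" and a: "int (mwt (wt t) \<alpha>) - int (wt t i) = j"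
  shows "X i \<alpha> = 0"
proof (rule ccontr)
  assume n: "X i \<alpha> \<noteq> 0"
  then have i: "i \<le> k" "Poly_Mapping.keys \<alpha> \<subseteq> {..k}" using X by (auto simp: formal_aut_def)
  have "nat (int (wt t i) + j) = mwt (wt t) \<alpha>" "0 \<le> int (wt t i) + j" using a by auto
  then have "hom_part X i (mwt (wt t) \<alpha>) = comp X j i" by (simp add: comp_def)
  also have "\<dots> = 0" using compD_W[OF X i(1), of j] z by simp
  finally show False using hom_part_zero[of X i "mwt (wt t) \<alpha>" \<alpha>] i n by (simp add: mon_wt_def)
qed

lemma rigid: assumes "2 \<le> k" "aut j D" "1 \<le> j" shows "D = (\<lambda>_. 0)"
proof -
  obtain P where P: "aut (- int 1) P" "P (xv 0) = cst 1" using aut_extend[of 1 1 "\<lambda>_. 0"] by auto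
  obtain Q where Q: "aut (- int 1) Q" "Q (xv 0) = cst \<i>" using aut_extend[of 1 "\<i>" "\<lambda>_. 0"] by auto
  interpret cr_rigid k "wt t" Phi \<rho> P Q
    by unfold_locales (use P Q assms wt_1 wt_2 wt_ge3 in auto)
  show ?thesis using aut_pos_zero[of "nat j" D] assms by simp
qed

section \<open>Coordinates and dimension\<close>

text \<open>Coordinates on the algebra: the value at \<open>0\<close> and the coefficient of \<open>z\<close> in the \<open>z\<close>-component. The
  coordinate \<open>3\<close>, rotation in \<open>z\<close>, is the one that need not be attained.\<close>

definition theta :: "vfield \<Rightarrow> nat \<Rightarrow> real" where
  "theta X n = (if n = 0 then Re (X 0 0) else if n = 1 then Im (X 0 0)
     else if n = 2 then Re (X 0 (Poly_Mapping.single 0 1)) else if n = 3 then Im (X 0 (Poly_Mapping.single 0 1))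
     else if n - 3 \<le> k then Re (X (n - 3) 0) else 0)"

lemma theta_i: "1 \<le> i \<Longrightarrow> i \<le> k \<Longrightarrow> theta X (i + 3) = Re (X i 0)"
  by (simp add: theta_def)

lemma linear_theta: "linear theta"
  by (rule linearI; rule ext) (simp_all add: theta_def fun_apply scaleR_fun_def)

lemma mon_wt_0: "mon_wt 0 = {0}"
proof -
  have "\<alpha> = 0" if "Poly_Mapping.keys \<alpha> \<subseteq> {..k}" "mwt (wt t) \<alpha> = 0" for \<alpha>
  proof -
    have "i \<notin> Poly_Mapping.keys \<alpha>" for i
      using mwt_ge[of i \<alpha> "wt t"] wt_pos[of i] that by fastforce
    then have "Poly_Mapping.keys \<alpha> = {}" by blast
    then show ?thesis by simp
  qed
  then show ?thesis by (auto simp: mon_wt_def)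
qed

lemma mon_wt_1: "mon_wt 1 = {Poly_Mapping.single 0 1}"
proof -
  have "\<alpha> = Poly_Mapping.single 0 1" if a: "Poly_Mapping.keys \<alpha> \<subseteq> {..k}" "mwt (wt t) \<alpha> = 1" for \<alpha>
  proof -
    have "\<alpha> \<noteq> 0" using a by auto
    then obtain i where i: "i \<in> Poly_Mapping.keys \<alpha>" by fastforce
    then have "i \<le> k" "wt t i \<le> 1" using mwt_ge[of i \<alpha> "wt t"] a by auto
    then have i0: "i = 0" using wt_ge2[of i] by (cases "i = 0") auto
    show ?thesis using mwt_linear[of 0 \<alpha> "wt t"] i i0 a wt_pos wt_0 by auto
  qed
  then show ?thesis by (auto simp: mon_wt_def wt_0)
qed

lemma hom_part_0: "hom_part X i 0 = cst (X i 0)"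
  by (rule ext) (simp add: hom_part_def mon_wt_0 cst_apply)

lemma hom_part_1: "hom_part X i 1 = cst (X i (Poly_Mapping.single 0 1)) * xv 0"
  by (rule ext) (simp add: hom_part_def mon_wt_1 fun_apply W_0)

text \<open>Positive weights vanish by rigidity. In weight 0 the \<open>z\<close>-component is a
  multiple of \<open>z\<close>, in weight -1 a constant, below that 0; together with the real
  constants \<open>Re (X i 0)\<close> it determines the component by
  \<open>aut_eqI0\<close>.\<close>

lemma theta_inj: assumes k: "2 \<le> k" and X: "X \<in> formal_aut" and z: "theta X = 0" shows "X = 0"
proof -
  have t: "theta X n = 0" for n using z by (simp add: fun_apply)
  have a: "X 0 0 = 0" "X 0 (Poly_Mapping.single 0 1) = 0"
    using t[of 0] t[of 1] t[of 2] t[of 3] by (simp_all add: theta_def complex_eq_iff)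
  have "compD X j = (\<lambda>_. 0)" for j
  proof (cases "1 \<le> j")
    case True then show ?thesis using rigid[OF k compD_aut[OF X]] by simp
  next
    case False
    show ?thesis
    proof (rule aut_eqI0[OF compD_aut[OF X]])
      consider "j = 0" | "j = -1" | "j < -1" using False by linarith
      moreover have "hom_part X 0 1 = 0" unfolding hom_part_1 a(2) by simp
      ultimately have "comp X j 0 = 0"
        by cases (simp_all add: comp_def wt_0 hom_part_0 One_nat_def a(1))
      then show "compD X j (xv 0) = 0" by (simp add: compD_xv)
      fix i assume i: "1 \<le> i" "i \<le> k" "int (wt t i) + j = 0"
      have "comp X j i = cst (X i 0)" using i(3) by (simp add: comp_def hom_part_0)
      moreover have "Re (X i 0) = 0" using t[of "i + 3"] theta_i[OF i(1,2)] by simp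
      ultimately show "compD X j (xv (Suc i)) = 0"
        unfolding compD_xv(3)[OF i(1,2)] by (simp add: fun_eq_iff fun_apply complex_eq_iff)
    qed
  qed
  then have "X i \<alpha> = 0" for i \<alpha> using compD_zero[OF X] by blast
  then show ?thesis by (intro ext) (simp add: fun_apply)
qed

lemma xv_add: "xv g (\<lambda>i. a i + b i) = xv g a + xv g b"
  and xv_scale: "xv g (\<lambda>i. complex_of_real r * a i) = complex_of_real r * xv g a" and xv_zero: "xv g (\<lambda>i. 0) = 0"
  by (auto simp: xv_def)

lemma subspace_formal_aut: "real_vector.subspace formal_aut"
proof (rule real_vector.subspaceI)
  have h0: "hom_part 0 i n q = 0" for i n q by (simp add: hom_part_def zero_fun_apply)
  show "0 \<in> formal_aut" unfolding formal_aut_def by (auto simp: h0 xv_zero zero_fun_apply)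
next
  fix X Y assume XY: "X \<in> formal_aut" "Y \<in> formal_aut"
  have h: "hom_part (X + Y) i n q = hom_part X i n q + hom_part Y i n q" for i n q
    by (simp add: hom_part_def plus_fun_apply distrib_right sum.distrib)
  show "X + Y \<in> formal_aut" unfolding formal_aut_def mem_Collect_eq
  proof (intro conjI allI ballI impI)
    fix i \<alpha> assume "(X + Y) i \<alpha> \<noteq> 0"
    then have "X i \<alpha> \<noteq> 0 \<or> Y i \<alpha> \<noteq> 0" by (auto simp: plus_fun_apply)
    then show "i \<le> k" "Poly_Mapping.keys \<alpha> \<subseteq> {..k}" using formal_aut_support[OF XY(1)] formal_aut_support[OF XY(2)] by blast+
  next
    fix i N q assume i: "i \<in> {1..k}"
    have e: "complex_of_real (Im (hom_part Z i N q)) = (\<Sum>g\<in>gens. pd g (Phi i) q *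
      (if gw g \<le> wt t i \<and> wt t i \<le> N + gw g then xv g (\<lambda>i'. hom_part Z i' (N + gw g - wt t i) q) else 0))" if "Z \<in> {X, Y}" for Z
      using XY i that unfolding formal_aut_def by blast
    show "complex_of_real (Im (hom_part (X + Y) i N q)) = (\<Sum>g\<in>gens. pd g (Phi i) q *
      (if gw g \<le> wt t i \<and> wt t i \<le> N + gw g then xv g (\<lambda>i'. hom_part (X + Y) i' (N + gw g - wt t i) q) else 0))"
      unfolding h xv_add plus_complex.sel of_real_add e[OF insertI1] e[OF insertI2[OF singletonI]] sum.distrib[symmetric]
      by (rule sum.cong) (auto simp: distrib_left)
  qed
next
  fix c X assume X: "X \<in> formal_aut"
  have h: "hom_part (c *\<^sub>R X) i n q = complex_of_real c * hom_part X i n q" for i n q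
    by (simp add: hom_part_def scaleR_fun_def scaleR_conv_of_real sum_distrib_left mult.assoc)
  show "c *\<^sub>R X \<in> formal_aut" unfolding formal_aut_def mem_Collect_eq
  proof (intro conjI allI ballI impI)
    fix i \<alpha> assume "(c *\<^sub>R X) i \<alpha> \<noteq> 0"
    then have "X i \<alpha> \<noteq> 0" by (auto simp: scaleR_fun_def)
    then show "i \<le> k" "Poly_Mapping.keys \<alpha> \<subseteq> {..k}" using formal_aut_support[OF X] by blast+
  next
    fix i N q assume i: "i \<in> {1..k}"
    have e: "complex_of_real (Im (hom_part X i N q)) = (\<Sum>g\<in>gens. pd g (Phi i) q *
      (if gw g \<le> wt t i \<and> wt t i \<le> N + gw g then xv g (\<lambda>i'. hom_part X i' (N + gw g - wt t i) q) else 0))"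
      using X i unfolding formal_aut_def by blast
    have "complex_of_real (Im (hom_part (c *\<^sub>R X) i N q)) = complex_of_real c * complex_of_real (Im (hom_part X i N q))"
      unfolding h by simp
    also have "\<dots> = (\<Sum>g\<in>gens. pd g (Phi i) q *
      (if gw g \<le> wt t i \<and> wt t i \<le> N + gw g then xv g (\<lambda>i'. hom_part (c *\<^sub>R X) i' (N + gw g - wt t i) q) else 0))"
      unfolding h xv_scale e sum_distrib_left by (rule sum.cong) auto
    finally show "complex_of_real (Im (hom_part (c *\<^sub>R X) i N q)) = (\<Sum>g\<in>gens. pd g (Phi i) q *
      (if gw g \<le> wt t i \<and> wt t i \<le> N + gw g then xv g (\<lambda>i'. hom_part (c *\<^sub>R X) i' (N + gw g - wt t i) q) else 0))" .
  qed
qed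

definition unit_vec :: "nat \<Rightarrow> nat \<Rightarrow> real" where "unit_vec n = (\<lambda>m. if m = n then 1 else 0)"

text \<open>A value of weight 0 is constant and can be evaluated at any \<open>q\<close>; a CR value
  of weight 1 is a multiple of \<open>z\<close>, and the factor is read off where
  \<open>q 0 = 1\<close>.\<close>

lemma field_theta:
  assumes D: "aut j D"
  shows "\<exists>X\<in>aut_CR k \<rho> t A. (\<forall>i\<le>k. \<forall>q. X i 0 = (if int (wt t i) + j = 0 then D (W i) q else 0)) \<and>
    (\<forall>q. q 0 = 1 \<longrightarrow> X 0 (Poly_Mapping.single 0 1) = (if j = 0 then D (xv 0) q else 0))"
proof -
  obtain X where X0: "X \<in> aut_CR k \<rho> t A"
    "\<forall>i \<alpha>. X i \<alpha> \<noteq> 0 \<longrightarrow> i \<le> k \<and> Poly_Mapping.keys \<alpha> \<subseteq> {..k} \<and> int (mwt (wt t) \<alpha>) = int (wt t i) + j"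
    "\<forall>i\<le>k. \<forall>q. D (W i) q = (\<Sum>\<alpha>\<in>{\<alpha>. X i \<alpha> \<noteq> 0}. X i \<alpha> * monomial_at \<alpha> (\<lambda>g. W g q))"
    using aut_to_field[OF D] by (elim bexE conjE) (rule that; assumption)
  have X: "i \<le> k" "Poly_Mapping.keys \<alpha> \<subseteq> {..k}" "int (mwt (wt t) \<alpha>) = int (wt t i) + j" if "X i \<alpha> \<noteq> 0" for i \<alpha>
    using X0(2) that by blast+
  have a: "D (W i) q = (\<Sum>\<alpha>\<in>mon_wt n. X i \<alpha> * monomial_at \<alpha> (\<lambda>g. W g q))" if "i \<le> k" "int n = int (wt t i) + j" for i n q
  proof -
    have "{\<alpha>. X i \<alpha> \<noteq> 0} \<subseteq> mon_wt n"
    proof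
      fix \<alpha> assume "\<alpha> \<in> {\<alpha>. X i \<alpha> \<noteq> 0}"
      then have "Poly_Mapping.keys \<alpha> \<subseteq> {..k}" "int (mwt (wt t) \<alpha>) = int n" using X[of i \<alpha>] that(2) by auto
      then show "\<alpha> \<in> mon_wt n" by (simp add: mon_wt_def)
    qed
    moreover have "D (W i) q = (\<Sum>\<alpha>\<in>{\<alpha>. X i \<alpha> \<noteq> 0}. X i \<alpha> * monomial_at \<alpha> (\<lambda>g. W g q))" using X0(3) that(1) by blast
    moreover have "(\<Sum>\<alpha>\<in>{\<alpha>. X i \<alpha> \<noteq> 0}. X i \<alpha> * monomial_at \<alpha> (\<lambda>g. W g q)) = (\<Sum>\<alpha>\<in>mon_wt n. X i \<alpha> * monomial_at \<alpha> (\<lambda>g. W g q))"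
      by (rule sum.mono_neutral_left[OF finite_mon_wt calculation(1)]) auto
    ultimately show ?thesis by simp
  qed
  have "X i 0 = (if int (wt t i) + j = 0 then D (W i) q else 0)" if i: "i \<le> k" for i q
    using a[OF i, of 0 q] X(3)[of i 0] by (auto simp: mon_wt_0)
  moreover have "X 0 (Poly_Mapping.single 0 1) = (if j = 0 then D (xv 0) q else 0)" if q: "q 0 = 1" for q
    using a[of 0 1 q] X(3)[of 0 "Poly_Mapping.single 0 1"] q by (auto simp: mon_wt_1 wt_0 W_0 xv_def)
  ultimately show ?thesis using X0(1) by blast
qed

text \<open>Indices 0 and 1 come from the fields of weight -1 with value 1 and \<open>\<i>\<close>
  on \<open>z\<close>, index 2 from the dilations, and \<open>n >= 4\<close> from a field of weight
  \<open>- wt t (n - 3)\<close> with a prescribed constant on that variable.\<close>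

lemma theta_image:
  assumes n: "n \<in> {0, 1, 2} \<union> {4..k+3}"
  shows "\<exists>X\<in>aut_CR k \<rho> t A. theta X = unit_vec n"
proof -
  have ext: "\<exists>X\<in>aut_CR k \<rho> t A. X 0 0 = (if m = 1 then c0 else 0) \<and> X 0 (Poly_Mapping.single 0 1) = 0 \<and>
    (\<forall>i\<in>{1..k}. Re (X i 0) = (if wt t i = m then a i else 0))"
    if m: "m \<ge> 1" "m \<noteq> 1 \<Longrightarrow> c0 = 0" for m c0 and a :: "nat \<Rightarrow> real"
  proof -
    obtain D where D: "aut (- int m) D" "D (xv 0) = cst c0" "\<And>i. i \<in> {1..k} \<Longrightarrow> wt t i = m \<Longrightarrow> D (xv (Suc i)) = cst (complex_of_real (a i))"
      using aut_extend[OF m, of a] by blast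
    obtain X where X: "X \<in> aut_CR k \<rho> t A" "\<And>i q. i \<le> k \<Longrightarrow> X i 0 = (if int (wt t i) + - int m = 0 then D (W i) q else 0)"
      "\<And>q. q 0 = 1 \<Longrightarrow> X 0 (Poly_Mapping.single 0 1) = (if - int m = 0 then D (xv 0) q else 0)"
      using field_theta[OF D(1)] by blast
    have "X 0 0 = (if m = 1 then c0 else 0)" using X(2)[of 0 0] D(2) wt_0 by (auto simp: W_0 cst_apply)
    moreover have "X 0 (Poly_Mapping.single 0 1) = 0" using X(3)[of "\<lambda>_. 1"] m by simp
    moreover have "Re (X i 0) = (if wt t i = m then a i else 0)" if i: "i \<in> {1..k}" for i
    proof (cases "wt t i = m")
      case True
      have i': "1 \<le> i" "i \<le> k" using i by auto
      have "cj (D (Phi i)) = D (Phi i)" using aut_cj[OF D(1), of "Phi i"] Phi_real[OF i'] by simp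
      from fun_cong[OF this, of 0] have "Im (D (Phi i) 0) = 0" by (simp add: cj_apply complex_eq_iff)
      then show ?thesis using X(2)[OF i'(2), of 0] der_W[OF aut_der[OF D(1)] i'] D(3)[OF i True] True by (simp add: fun_apply)
    next
      case False then show ?thesis using X(2)[of i 0] i by simp
    qed
    ultimately show ?thesis using X(1) by blast
  qed
  have th: "theta X = unit_vec n"
    if "X 0 0 = Complex (unit_vec n 0) (unit_vec n 1)" "X 0 (Poly_Mapping.single 0 1) = Complex (unit_vec n 2) (unit_vec n 3)"
      "\<And>i. i \<in> {1..k} \<Longrightarrow> Re (X i 0) = unit_vec n (i + 3)" for X
  proof
    fix m
    consider "m = 0" | "m = 1" | "m = 2" | "m = 3" | "4 \<le> m" "m \<le> k + 3" | "m > k + 3" by linarith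
    then show "theta X m = unit_vec n m"
    proof cases
      case 5
      then have "m - 3 \<in> {1..k}" "m = (m - 3) + 3" by auto
      then show ?thesis using that(3)[of "m - 3"] theta_i[of "m - 3" X] by auto
    next
      case 6 then show ?thesis using n by (auto simp: theta_def unit_vec_def)
    qed (simp_all add: theta_def that)
  qed
  consider "n = 0" | "n = 1" | "n = 2" | "4 \<le> n" "n \<le> k + 3" using n by auto
  then show ?thesis
  proof cases
    case 1
    obtain X where X: "X \<in> aut_CR k \<rho> t A" "X 0 0 = 1" "X 0 (Poly_Mapping.single 0 1) = 0" "\<And>i. i \<in> {1..k} \<Longrightarrow> Re (X i 0) = 0"
      using ext[of 1 1 "\<lambda>_. 0"] by auto
    show ?thesis by (rule bexI[OF th X(1)]) (use X 1 in \<open>auto simp: unit_vec_def complex_eq_iff\<close>)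
  next
    case 2
    obtain X where X: "X \<in> aut_CR k \<rho> t A" "X 0 0 = \<i>" "X 0 (Poly_Mapping.single 0 1) = 0" "\<And>i. i \<in> {1..k} \<Longrightarrow> Re (X i 0) = 0"
      using ext[of 1 "\<i>" "\<lambda>_. 0"] by auto
    show ?thesis by (rule bexI[OF th X(1)]) (use X 2 in \<open>auto simp: unit_vec_def complex_eq_iff\<close>)
  next
    case 3
    obtain X where X: "X \<in> aut_CR k \<rho> t A" "\<And>i q. i \<le> k \<Longrightarrow> X i 0 = (if int (wt t i) + 0 = 0 then euler (W i) q else 0)"
      "\<And>q. q 0 = 1 \<Longrightarrow> X 0 (Poly_Mapping.single 0 1) = (if (0::int) = 0 then euler (xv 0) q else 0)"
      using field_theta[OF aut_euler] by blast
    have X0: "X i 0 = 0" if "i \<le> k" for i using X(2)[OF that, of 0] wt_pos[OF that] by simp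
    have "X 0 (Poly_Mapping.single 0 1) = 1"
      using X(3)[of "\<lambda>_. 1"] euler_RW[OF xv_RW(1)] by (simp add: fun_apply xv_def)
    then show ?thesis by (intro bexI[OF th X(1)]) (use X0 3 in \<open>auto simp: unit_vec_def complex_eq_iff\<close>)
  next
    case 4
    define i0 where "i0 = n - 3"
    have i0: "1 \<le> i0" "i0 \<le> k" "n = i0 + 3" using 4 by (auto simp: i0_def)
    have m2: "wt t i0 \<ge> 2" by (rule wt_ge2[OF i0(1,2)])
    obtain X where X: "X \<in> aut_CR k \<rho> t A" "X 0 0 = 0" "X 0 (Poly_Mapping.single 0 1) = 0"
      "\<And>i. i \<in> {1..k} \<Longrightarrow> Re (X i 0) = (if wt t i = wt t i0 then (if i = i0 then 1 else 0) else 0)"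
      using ext[of "wt t i0" 0 "\<lambda>i. if i = i0 then 1 else 0"] m2 by auto
    show ?thesis by (rule bexI[OF th X(1)]) (use X i0 in \<open>auto simp: unit_vec_def complex_eq_iff\<close>)
  qed
qed

text \<open>\<open>theta\<close> maps a basis of the span injectively to independent vectors in a
  space spanned by \<open>k + 4\<close> unit vectors, and the span of the image contains each of
  these except possibly the one of index 3. Whether that one is attained decides between the two
  values.\<close>

lemma dim_aut_CR: assumes k: "2 \<le> k" shows "Real_Vector_Spaces.dim (aut_CR k \<rho> t A) \<in> {3 + k, 4 + k}"
proof -
  obtain B where B: "B \<subseteq> aut_CR k \<rho> t A" "Real_Vector_Spaces.independent B" "aut_CR k \<rho> t A \<subseteq> Real_Vector_Spaces.span B"
    "card B = Real_Vector_Spaces.dim (aut_CR k \<rho> t A)" by (rule real_vector.basis_exists)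
  have sF: "Real_Vector_Spaces.span B \<subseteq> formal_aut"
    using B(1) aut_CR_formal by (intro real_vector.span_minimal subspace_formal_aut) auto
  have inj: "inj_on theta (Real_Vector_Spaces.span B)"
  proof (rule inj_onI)
    fix X Y assume XY: "X \<in> Real_Vector_Spaces.span B" "Y \<in> Real_Vector_Spaces.span B" "theta X = theta Y"
    have "X - Y \<in> formal_aut" using sF real_vector.span_diff[OF XY(1,2)] by blast
    moreover have "theta (X - Y) = 0" using linear_diff[OF linear_theta, of X Y] XY(3) by simp
    ultimately have "X - Y = 0" by (rule theta_inj[OF k])
    then show "X = Y" by simp
  qed
  then have injB: "inj_on theta B" by (rule inj_on_subset[OF _ real_vector.span_superset])
  have ind: "Real_Vector_Spaces.independent (theta ` B)"
    by (rule linear_independent_injective_image[OF linear_theta B(2) inj])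
  have sp: "theta X \<in> Real_Vector_Spaces.span (unit_vec ` {..<k+4})" for X
  proof -
    have "theta X = (\<Sum>n<k+4. theta X n *\<^sub>R unit_vec n)"
    proof
      fix m
      have "(\<Sum>n<k+4. theta X n * (if m = n then 1 else 0)) = theta X m"
      proof -
        have "(\<Sum>n<k+4. theta X n * (if m = n then 1 else 0)) = (\<Sum>n<k+4. if m = n then theta X n else 0)"
          by (rule sum.cong) auto
        also have "\<dots> = (if m < k + 4 then theta X m else 0)" by (simp add: sum.delta')
        also have "\<dots> = theta X m" by (auto simp: theta_def)
        finally show ?thesis .
      qed
      then show "theta X m = (\<Sum>n<k+4. theta X n *\<^sub>R unit_vec n) m"
        by (simp add: fun_apply scaleR_fun_def unit_vec_def)
    qed
    moreover have "(\<Sum>n<k+4. theta X n *\<^sub>R unit_vec n) \<in> Real_Vector_Spaces.span (unit_vec ` {..<k+4})"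
      by (intro real_vector.span_sum real_vector.span_scale real_vector.span_base) auto
    ultimately show ?thesis by simp
  qed
  have b: "finite (theta ` B) \<and> card (theta ` B) \<le> card (unit_vec ` {..<k+4})"
    by (rule real_vector.independent_span_bound[OF _ ind]) (use sp in auto)
  have up: "card B \<le> k + 4"
    using b card_image_le[of "{..<k+4}" unit_vec] card_image[OF injB] by simp
  let ?I = "{0, 1, 2} \<union> {4..k+3}"
  have inju: "inj unit_vec" unfolding unit_vec_def by (rule injI) (metis zero_neq_one)
  have "unit_vec ` ?I \<subseteq> Real_Vector_Spaces.span (theta ` B)"
  proof
    fix e assume "e \<in> unit_vec ` ?I"
    then obtain X where "X \<in> aut_CR k \<rho> t A" "theta X = e" using theta_image by blast
    then have "e \<in> theta ` Real_Vector_Spaces.span B" using B(3) by blast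
    then show "e \<in> Real_Vector_Spaces.span (theta ` B)" using linear_span_image[OF linear_theta, of B] by simp
  qed
  moreover have "Real_Vector_Spaces.independent (unit_vec ` ?I)"
  proof (rule real_vector.independent_if_scalars_zero)
    fix f x assume s: "(\<Sum>x\<in>unit_vec ` ?I. f x *\<^sub>R x) = 0" and x: "x \<in> unit_vec ` ?I"
    from x obtain n where n: "n \<in> ?I" "x = unit_vec n" by (rule imageE) (rule that)
    have "(\<Sum>x\<in>unit_vec ` ?I. f x *\<^sub>R x) = (\<Sum>n\<in>?I. f (unit_vec n) *\<^sub>R unit_vec n)"
      by (rule sum.reindex_cong[OF inj_on_subset[OF inju]]) auto
    then have "(\<Sum>m\<in>?I. f (unit_vec m) *\<^sub>R unit_vec m) n = 0" using s by (simp add: zero_fun_apply)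
    moreover have "(\<Sum>m\<in>?I. f (unit_vec m) *\<^sub>R unit_vec m) n = (\<Sum>m\<in>?I. if m = n then f (unit_vec m) else 0)"
      unfolding sum_fun_apply by (rule sum.cong) (auto simp: scaleR_fun_def unit_vec_def)
    ultimately show "f x = 0" using n by (simp add: sum.delta)
  qed simp
  ultimately have "card (unit_vec ` ?I) \<le> card (theta ` B)" using real_vector.independent_span_bound b by blast
  moreover have "card (unit_vec ` ?I) = k + 3"
  proof -
    have "?I = {..<k+4} - {3}" by auto
    then have "card ?I = k + 3" by simp
    then show ?thesis using card_image[OF inj_on_subset[OF inju], of ?I] by simp
  qed
  ultimately have "k + 3 \<le> card B" using card_image[OF injB] by simp
  then show ?thesis using up B(4) by auto
qed

lemma zero_aut_CR: "0 \<in> aut_CR k \<rho> t A"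
proof -
  have g: "germ_eval 0 p = 0" for p unfolding germ_eval_def by (simp add: zero_fun_apply)
  have "0 \<in> hol_germs (1 + k)" unfolding hol_germs_def by (auto simp: zero_fun_apply intro: exI[of _ 1])
  then have "0 \<in> hol_vfields (1 + k)" by (simp add: hol_vfields_def zero_fun_apply)
  moreover have "tangent_at \<rho> t A p (\<lambda>i. germ_eval ((0::vfield) i) p)" for p
    unfolding tangent_iff by (simp add: zero_fun_apply g xv_zero)
  ultimately show ?thesis unfolding aut_CR_def by (auto intro: exI[of _ 1])
qed

lemma aut_CR_component_zero: assumes k: "2 \<le> k" and j: "1 \<le> j" shows "aut_CR_component k \<rho> t A j = {0}"
proof
  show "aut_CR_component k \<rho> t A j \<subseteq> {0}"
  proof
    fix X assume "X \<in> aut_CR_component k \<rho> t A j"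
    then have X: "X \<in> formal_aut" "\<And>i \<alpha>. X i \<alpha> \<noteq> 0 \<Longrightarrow> int (mwt (wt t) \<alpha>) - int (wt t i) = j"
      using aut_CR_formal by (auto simp: aut_CR_component_def monomial_wt_mwt)
    have "X i \<alpha> = 0" for i \<alpha>
      using compD_zero[OF X(1) rigid[OF k compD_aut[OF X(1)] j], of \<alpha> i] X(2)[of i \<alpha>] by blast
    then show "X \<in> {0}" by (auto simp: fun_eq_iff zero_fun_apply)
  qed
  show "{0} \<subseteq> aut_CR_component k \<rho> t A j" using zero_aut_CR by (auto simp: aut_CR_component_def zero_fun_apply)
qed

end

theorem theorem6p1:
  fixes k \<rho> :: nat
    and t :: basis_family
    and A :: "nat \<Rightarrow> real mat"
  assumes "model_data k \<rho> t A"
  shows "(\<rho> \<ge> 3 \<longleftrightarrow> k \<ge> 2) \<and>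
    (\<rho> \<ge> 3 \<longrightarrow>
      (\<forall>j\<ge>1. aut_CR_component k \<rho> t A j = {0}) \<and>
      Real_Vector_Spaces.dim (aut_CR k \<rho> t A) \<in> {3 + k, 4 + k})"
proof -
  interpret model k \<rho> t A by unfold_locales (rule assms)
  show ?thesis using rho_k aut_CR_component_zero dim_aut_CR by blast
qed

end
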